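(* Let $\{\boldsymbol u_\eta\}$ and $\{\eta\,\mathrm{div}\,\boldsymbol u_\eta\}$ be two uniformly bounded sequences in $L^2(\Omega;\mathbb{R}^3)$ and in $L^2(\Omega)$, respectively. Then there exist a subsequence $\{\boldsymbol u_{\eta_k}\}$ and a function $\boldsymbol u_0\in L^2(\Omega,\mathcal H_\sharp(\mathrm{div}_{\mathbf R},Y^m))$ such that, as $\eta_k\to0$, in the sense of weak two-scale convergence for the matrix $\mathbf R$, $$\boldsymbol u_{\eta_k}\rightharpoonup\boldsymbol u_0(\boldsymbol x,\boldsymbol y),\qquad \eta_k\,\mathrm{div}\,\boldsymbol u_{\eta_k}\rightharpoonup\mathrm{div}_{\mathbf R}\,\boldsymbol u_0(\boldsymbol x,\boldsymbol y).$$
   Context: $\Omega\subset\mathbb{R}^3$ is a bounded open set with Lipschitz boundary; $\eta>0$ is a parameter tending to $0$. $\mathbf R$ is a real matrix with $m$ rows and $3$ columns, $m>3$, satisfying $\mathbf R^T\boldsymbol k\neq\boldsymbol 0$ for all $\boldsymbol k\in\mathbb{Z}^m\setminus\{\boldsymbol 0\}$. $Y^m=]0,1[^m$; the subscript $\sharp$ denotes $Y^m$-periodicity in $\boldsymbol y$. Weak two-scale convergence for $\mathbf R$: $(u_\eta)\subset L^2(\Omega)$ converges to $u_0\in L^2(\Omega\times Y^m)$ if $\lim_{\eta\to0}\int_\Omega u_\eta(\boldsymbol x)\varphi(\boldsymbol x,\mathbf R\boldsymbol x/\eta)\,d\boldsymbol x=\int\!\!\int_{\Omega\times Y^m}u_0\varphi\,d\boldsymbol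 x\,d\boldsymbol y$ for every $\varphi\in L^2(\Omega,C_\sharp(Y^m))$ (componentwise for vector fields). $\mathrm{div}_{\mathbf R}\,\boldsymbol u=(\mathbf R^T\nabla_{\boldsymbol y})\cdot\boldsymbol u$, and $\mathcal H_\sharp(\mathrm{div}_{\mathbf R},Y^m)=\{\boldsymbol u\in L^2_\sharp(Y^m;\mathbb{R}^3):\mathrm{div}_{\mathbf R}\,\boldsymbol u\in L^2_\sharp(Y^m)\}$. *)

theory Defs
  imports "HOL-Analysis.Analysis"
begin

text \<open>
  Elements of \<open>L\<^sup>2\<close> spaces are represented by functions rather than by classes of functions equal
  almost everywhere; all notions below depend on those classes only.
\<close>

definition L2_space :: "'a measure \<Rightarrow> ('a \<Rightarrow> 'b::real_normed_vector) set" where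
  "L2_space M = {f. f \<in> borel_measurable M \<and> integrable M (\<lambda>x. (norm (f x))\<^sup>2)}"

definition norm_L2 :: "'a measure \<Rightarrow> ('a \<Rightarrow> 'b::real_normed_vector) \<Rightarrow> real" where
  "norm_L2 M f = sqrt (\<integral>x. (norm (f x))\<^sup>2 \<partial>M)"

definition L2_bounded_seq :: "'a measure \<Rightarrow> (nat \<Rightarrow> 'a \<Rightarrow> 'b::real_normed_vector) \<Rightarrow> bool" where
  "L2_bounded_seq M f \<longleftrightarrow> (\<forall>n. f n \<in> L2_space M) \<and> (\<exists>C. \<forall>n. norm_L2 M (f n) \<le> C)"

text \<open>
  Near each boundary point, \<open>\<Omega>\<close> lies strictly on one side of the graph of a Lipschitz function over
  the hyperplane orthogonal to some unit vector \<open>e\<close>.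
\<close>

definition Lipschitz_boundary :: "'a::euclidean_space set \<Rightarrow> bool" where
  "Lipschitz_boundary \<Omega> \<longleftrightarrow>
     (\<forall>p\<in>frontier \<Omega>. \<exists>r>0. \<exists>e. norm e = 1 \<and>
        (\<exists>L \<gamma>. L-lipschitz_on {z. z \<bullet> e = 0} \<gamma> \<and>
           \<Omega> \<inter> ball p r = {x \<in> ball p r. (\<gamma> (x - (x \<bullet> e) *\<^sub>R e) :: real) < x \<bullet> e}))"

primrec C_k :: "nat \<Rightarrow> ('a::euclidean_space \<Rightarrow> real) \<Rightarrow> bool" where
  "C_k 0 f \<longleftrightarrow> continuous_on UNIV f"
| "C_k (Suc k) f \<longleftrightarrow> (\<forall>x. f differentiable at x) \<and>
     (\<forall>b\<in>Basis. C_k k (\<lambda>x. frechet_derivative f (at x) b))"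

definition C_infinity :: "('a::euclidean_space \<Rightarrow> real) \<Rightarrow> bool" where
  "C_infinity f \<longleftrightarrow> (\<forall>k. C_k k f)"

definition test_functions :: "'a::euclidean_space set \<Rightarrow> ('a \<Rightarrow> real) set" where
  "test_functions \<Omega> = {\<psi>. C_infinity \<psi> \<and> (\<exists>K. compact K \<and> K \<subseteq> \<Omega> \<and> (\<forall>x. x \<notin> K \<longrightarrow> \<psi> x = 0))}"

definition grad :: "(real ^ 'n \<Rightarrow> real) \<Rightarrow> real ^ 'n \<Rightarrow> real ^ 'n" where
  "grad \<psi> x = (\<chi> i. frechet_derivative \<psi> (at x) (axis i 1))"

text \<open>\<open>g\<close> is the distributional divergence of \<open>u\<close> in \<open>\<Omega>\<close>.\<close>

definition has_weak_div :: "(real ^ 'n) set \<Rightarrow> (real ^ 'n \<Rightarrow> real ^ 'n) \<Rightarrow> (real ^ 'n \<Rightarrow> real) \<Rightarrow> bool"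
  where
  "has_weak_div \<Omega> u g \<longleftrightarrow>
     (\<forall>\<psi>\<in>test_functions \<Omega>.
        (\<integral>x. u x \<bullet> grad \<psi> x \<partial>lebesgue_on \<Omega>) = - (\<integral>x. g x * \<psi> x \<partial>lebesgue_on \<Omega>))"

definition int_vec :: "int ^ 'm \<Rightarrow> real ^ 'm" where
  "int_vec k = (\<chi> i. real_of_int (k $ i))"

definition unit_cell :: "(real ^ 'm) set" where
  "unit_cell = {y. \<forall>i. 0 < y $ i \<and> y $ i < 1}"

definition cell_periodic :: "(real ^ 'm \<Rightarrow> 'b) \<Rightarrow> bool" where
  "cell_periodic f \<longleftrightarrow> (\<forall>y k. f (y + int_vec k) = f y)"

definition L2_sharp :: "(real ^ 'm \<Rightarrow> 'b::real_normed_vector) set" where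
  "L2_sharp = {f. cell_periodic f \<and> f \<in> L2_space (lebesgue_on unit_cell)}"

text \<open>
  Periodic continuous functions are automatically bounded, so nothing is lost by building the space
  inside the type of bounded continuous functions, whose norm is the supremum norm.
\<close>

definition C_sharp :: "((real ^ 'm) \<Rightarrow>\<^sub>C real) set" where
  "C_sharp = {f. cell_periodic (apply_bcontfun f)}"

text \<open>
  The space \<open>L\<^sup>2(\<Omega>, C\<^sub>\<sharp>)\<close>. As \<open>C_sharp\<close> is separable, Borel measurability of a map with values in
  it coincides with strong (Bochner) measurability.
\<close>

definition L2_C_sharp :: "(real ^ 3) set \<Rightarrow> (real ^ 3 \<Rightarrow> ((real ^ 'm) \<Rightarrow>\<^sub>C real)) set" where
  "L2_C_sharp \<Omega> = {\<phi> \<in> L2_space (lebesgue_on \<Omega>). \<forall>x\<in>\<Omega>. \<phi> x \<in> C_sharp}"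

definition two_scale_converges ::
  "(real ^ 3) set \<Rightarrow> real ^ 3 ^ 'm \<Rightarrow> (nat \<Rightarrow> real) \<Rightarrow> (nat \<Rightarrow> real ^ 3 \<Rightarrow> real)
     \<Rightarrow> (real ^ 3 \<Rightarrow> real ^ 'm \<Rightarrow> real) \<Rightarrow> bool" where
  "two_scale_converges \<Omega> R \<eta> u u0 \<longleftrightarrow>
     (\<forall>n. u n \<in> L2_space (lebesgue_on \<Omega>)) \<and>
     (\<lambda>(x, y). u0 x y) \<in> L2_space (lebesgue_on (\<Omega> \<times> unit_cell)) \<and>
     (\<forall>\<phi>\<in>L2_C_sharp \<Omega>.
        (\<lambda>n. \<integral>x. u n x * apply_bcontfun (\<phi> x) ((R *v x) /\<^sub>R \<eta> n) \<partial>lebesgue_on \<Omega>)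
          \<longlonglongrightarrow> (\<integral>(x, y). u0 x y * apply_bcontfun (\<phi> x) y \<partial>lebesgue_on (\<Omega> \<times> unit_cell)))"

definition two_scale_converges_vec ::
  "(real ^ 3) set \<Rightarrow> real ^ 3 ^ 'm \<Rightarrow> (nat \<Rightarrow> real) \<Rightarrow> (nat \<Rightarrow> real ^ 3 \<Rightarrow> real ^ 3)
     \<Rightarrow> (real ^ 3 \<Rightarrow> real ^ 'm \<Rightarrow> real ^ 3) \<Rightarrow> bool" where
  "two_scale_converges_vec \<Omega> R \<eta> u u0 \<longleftrightarrow>
     (\<forall>i. two_scale_converges \<Omega> R \<eta> (\<lambda>n x. u n x $ i) (\<lambda>x y. u0 x y $ i))"

text \<open>
  \<open>g\<close> is \<open>div\<^sub>R v = (R\<^sup>T \<nabla>\<^sub>y) \<cdot> v\<close> in the sense of periodic distributions, i.e. tested against smooth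
  periodic functions.
\<close>

definition has_div_R :: "real ^ 3 ^ 'm \<Rightarrow> (real ^ 'm \<Rightarrow> real ^ 3) \<Rightarrow> (real ^ 'm \<Rightarrow> real) \<Rightarrow> bool" where
  "has_div_R R v g \<longleftrightarrow>
     (\<forall>\<psi>. C_infinity \<psi> \<and> cell_periodic \<psi> \<longrightarrow>
        (\<integral>y. v y \<bullet> (transpose R *v grad \<psi> y) \<partial>lebesgue_on unit_cell)
          = - (\<integral>y. g y * \<psi> y \<partial>lebesgue_on unit_cell))"

definition H_sharp_div_R :: "real ^ 3 ^ 'm \<Rightarrow> (real ^ 'm \<Rightarrow> real ^ 3) set" where
  "H_sharp_div_R R = {v \<in> L2_sharp. \<exists>g\<in>L2_sharp. has_div_R R v g}"

text \<open>
  \<open>d\<close> is \<open>div\<^sub>R u\<close> for a field \<open>u\<close> depending on \<open>(x, y)\<close>, with \<open>d\<close> in \<open>L\<^sup>2(\<Omega> \<times> Y)\<close>. A relation is used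
  because choosing \<open>div\<^sub>R (u x)\<close> separately for each \<open>x\<close> need not give a jointly measurable function.
\<close>

definition has_div_R_field ::
  "(real ^ 3) set \<Rightarrow> real ^ 3 ^ 'm \<Rightarrow> (real ^ 3 \<Rightarrow> real ^ 'm \<Rightarrow> real ^ 3)
     \<Rightarrow> (real ^ 3 \<Rightarrow> real ^ 'm \<Rightarrow> real) \<Rightarrow> bool" where
  "has_div_R_field \<Omega> R u d \<longleftrightarrow>
     (\<lambda>(x, y). d x y) \<in> L2_space (lebesgue_on (\<Omega> \<times> unit_cell)) \<and>
     (AE x in lebesgue_on \<Omega>. d x \<in> L2_sharp \<and> has_div_R R (u x) (d x))"

text \<open>
  The space \<open>L\<^sup>2(\<Omega>, H\<^sub>\<sharp>(div\<^sub>R, Y))\<close> for the graph norm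
  \<open>\<parallel>v\<parallel>\<^sup>2 = \<integral> \<bar>v\<bar>\<^sup>2 + \<integral> \<bar>div\<^sub>R v\<bar>\<^sup>2\<close>, under the usual identification of \<open>L\<^sup>2(\<Omega>, L\<^sup>2(Y))\<close> with
  \<open>L\<^sup>2(\<Omega> \<times> Y)\<close>.
\<close>

definition L2_H_sharp_div_R ::
  "(real ^ 3) set \<Rightarrow> real ^ 3 ^ 'm \<Rightarrow> (real ^ 3 \<Rightarrow> real ^ 'm \<Rightarrow> real ^ 3) set" where
  "L2_H_sharp_div_R \<Omega> R =
     {u. (\<lambda>(x, y). u x y) \<in> L2_space (lebesgue_on (\<Omega> \<times> unit_cell)) \<and>
         (AE x in lebesgue_on \<Omega>. u x \<in> H_sharp_div_R R) \<and>
         (\<exists>d. has_div_R_field \<Omega> R u d)}"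

end

theory Submission
  imports Defs "HOL-Complex_Analysis.Great_Picard"
begin

text \<open>
  A bounded sequence in \<open>L\<^sup>2(\<Omega>)\<close>, tested against \<open>\<phi>(x, R x / \<eta>)\<close>, defines functionals of \<open>\<phi>\<close>. The
  theorem rests on two facts about them.

  The first is compactness. Since \<open>R\<^sup>T k \<noteq> 0\<close> for every nonzero integer vector \<open>k\<close>, the functions
  \<open>cos (2 \<pi> k \<cdot> R x / \<eta>)\<close> oscillate faster and faster as \<open>\<eta> \<longrightarrow> 0\<close>, so by the Riemann-Lebesgue lemma
  the points \<open>R x / \<eta>\<close> equidistribute in the cell (\<open>trig_equidistribution\<close>). Hence, for \<open>\<phi>\<close> in the
  span of the products of an indicator in \<open>x\<close> and a trigonometric function in \<open>y\<close>, the
  norm of \<open>\<phi>(x, R x / \<eta>)\<close> in \<open>L\<^sup>2(\<Omega>)\<close> tends to the norm of \<open>\<phi>\<close> in \<open>L\<^sup>2(\<Omega> \<times> Y)\<close>. Countably many such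
  products suffice, so a diagonal subsequence makes the functionals converge on the span; the
  limit is bounded for the norm of \<open>L\<^sup>2(\<Omega> \<times> Y)\<close> and is represented by an \<open>L\<^sup>2\<close> function
  (\<open>Riesz_representation_subspace\<close>, \<open>two_scale_compactness\<close>). The convergence extends from the span
  to all of \<open>L\<^sup>2(\<Omega>, C\<^sub>\<sharp>)\<close> because trigonometric polynomials are dense in \<open>C\<^sub>\<sharp>\<close> and both sides are
  continuous for the norm of \<open>L\<^sup>2(\<Omega>, C\<^sub>\<sharp>)\<close>, uniformly in \<open>\<eta>\<close> (\<open>osc_converges_from_basis\<close>).

  The second is the identification of the limit of \<open>\<eta> div u\<^sub>\<eta>\<close>. The weak divergence is tested with
  \<open>\<psi>(x) w(R x / \<eta>)\<close>, whose gradient is \<open>\<eta>\<^sup>-\<^sup>1 \<psi> (R\<^sup>T \<nabla> w)(R x / \<eta>)\<close> up to a bounded term; after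
  multiplication by \<open>\<eta>\<close> the bounded term disappears in the limit and what remains is the
  identity \<open>d\<^sub>0 = div\<^sub>R u\<^sub>0\<close> integrated against \<open>\<psi>(x) w(y)\<close> (\<open>two_scale_div_identity\<close>). The fundamental
  lemma of the calculus of variations localises it at almost every \<open>x\<close>, for one \<open>w\<close> at a time.
  The exceptional null set is made independent of \<open>w\<close> by using only countably many \<open>w\<close> such that
  the pairs \<open>(w, R\<^sup>T \<nabla> w)\<close> are uniformly dense among all such pairs (\<open>AE_has_div_R\<close>).
\<close>

section \<open>Completeness of \<open>L\<^sup>2\<close> and representation of functionals\<close>

lemma L2_space_real_iff:
  fixes f :: "'a \<Rightarrow> real"
  shows "f \<in> L2_space M \<longleftrightarrow> f \<in> borel_measurable M \<and> integrable M (\<lambda>x. (f x)\<^sup>2)"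
  by (simp add: L2_space_def)

lemma norm_L2_real: "norm_L2 M (f :: 'a \<Rightarrow> real) = sqrt (\<integral>x. (f x)\<^sup>2 \<partial>M)"
  by (simp add: norm_L2_def)

lemma norm_L2_nonneg [simp]: "0 \<le> norm_L2 M f"
  by (simp add: norm_L2_def)

lemma norm_L2_squared: "(norm_L2 M (f :: 'a \<Rightarrow> real))\<^sup>2 = (\<integral>x. (f x)\<^sup>2 \<partial>M)"
  by (simp add: norm_L2_real)

lemma L2_mult_integrable:
  fixes f g :: "'a \<Rightarrow> real"
  assumes "f \<in> L2_space M" "g \<in> L2_space M"
  shows "integrable M (\<lambda>x. f x * g x)"
proof (rule Bochner_Integration.integrable_bound[where f="\<lambda>x. (f x)\<^sup>2 + (g x)\<^sup>2"])
  show "AE x in M. norm (f x * g x) \<le> norm ((f x)\<^sup>2 + (g x)\<^sup>2)"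
  proof (rule AE_I2)
    fix x
    have "2 * (\<bar>f x\<bar> * \<bar>g x\<bar>) \<le> (f x)\<^sup>2 + (g x)\<^sup>2"
      using sum_squares_bound[of "\<bar>f x\<bar>" "\<bar>g x\<bar>"] by simp
    moreover have "0 \<le> \<bar>f x\<bar> * \<bar>g x\<bar>" by simp
    ultimately show "norm (f x * g x) \<le> norm ((f x)\<^sup>2 + (g x)\<^sup>2)"
      by (simp add: abs_mult del: zero_le_mult_iff mult_nonneg_nonneg)
  qed
qed (use assms in \<open>auto simp: L2_space_real_iff\<close>)

lemma L2_add:
  fixes f g :: "'a \<Rightarrow> real"
  assumes "f \<in> L2_space M" "g \<in> L2_space M"
  shows "(\<lambda>x. f x + g x) \<in> L2_space M"
proof -
  have "integrable M (\<lambda>x. (f x)\<^sup>2 + 2 * (f x * g x) + (g x)\<^sup>2)"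
    using assms L2_mult_integrable[OF assms] by (auto simp: L2_space_real_iff)
  then show ?thesis
    using assms by (auto simp: L2_space_real_iff power2_sum algebra_simps)
qed

lemma L2_cmult:
  fixes f :: "'a \<Rightarrow> real"
  assumes "f \<in> L2_space M"
  shows "(\<lambda>x. c * f x) \<in> L2_space M"
  using assms by (auto simp: L2_space_real_iff power_mult_distrib)

lemma L2_diff:
  fixes f g :: "'a \<Rightarrow> real"
  assumes "f \<in> L2_space M" "g \<in> L2_space M"
  shows "(\<lambda>x. f x - g x) \<in> L2_space M"
  using L2_add[OF assms(1) L2_cmult[OF assms(2), of "-1"]] by simp

lemma abs_le_power2: "\<bar>a\<bar> \<le> norm b \<Longrightarrow> (a::real)\<^sup>2 \<le> (norm b)\<^sup>2"
  by (simp add: abs_le_square_iff[symmetric])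

lemma L2_bound:
  fixes f :: "'a \<Rightarrow> real" and g :: "'a \<Rightarrow> 'b::real_normed_vector"
  assumes "f \<in> borel_measurable M" "g \<in> L2_space M" "AE x in M. \<bar>f x\<bar> \<le> norm (g x)"
  shows "f \<in> L2_space M"
proof -
  have "integrable M (\<lambda>x. (f x)\<^sup>2)"
    by (rule Bochner_Integration.integrable_bound[where f="\<lambda>x. (norm (g x))\<^sup>2"])
       (use assms in \<open>auto simp: L2_space_def elim!: eventually_mono intro: abs_le_power2\<close>)
  with assms show ?thesis by (simp add: L2_space_real_iff)
qed

lemma L2_integrable:
  fixes f :: "'a \<Rightarrow> real"
  assumes "finite_measure M" "f \<in> L2_space M"
  shows "integrable M f"
proof -
  interpret finite_measure M by fact
  have "(\<lambda>_. 1) \<in> L2_space M" by (auto simp: L2_space_def)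
  from L2_mult_integrable[OF assms(2) this] show ?thesis by simp
qed

lemma L2_Cauchy_Schwarz:
  fixes f g :: "'a \<Rightarrow> real"
  assumes "f \<in> L2_space M" "g \<in> L2_space M"
  shows "\<bar>\<integral>x. f x * g x \<partial>M\<bar> \<le> norm_L2 M f * norm_L2 M g"
proof -
  define a b c where "a = (\<integral>x. (f x)\<^sup>2 \<partial>M)" and "b = (\<integral>x. f x * g x \<partial>M)"
    and "c = (\<integral>x. (g x)\<^sup>2 \<partial>M)"
  have int: "integrable M (\<lambda>x. (f x)\<^sup>2)" "integrable M (\<lambda>x. (g x)\<^sup>2)" "integrable M (\<lambda>x. f x * g x)"
    using assms L2_mult_integrable[OF assms] by (auto simp: L2_space_real_iff)
  have quad: "s\<^sup>2 * a + 2 * s * t * b + t\<^sup>2 * c \<ge> 0" for s t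
  proof -
    have "0 \<le> (\<integral>x. (s * f x + t * g x)\<^sup>2 \<partial>M)" by simp
    also have "\<dots> = (\<integral>x. s\<^sup>2 * (f x)\<^sup>2 + (2 * s * t) * (f x * g x) + t\<^sup>2 * (g x)\<^sup>2 \<partial>M)"
      by (intro Bochner_Integration.integral_cong) (auto simp: power2_sum power_mult_distrib algebra_simps)
    also have "\<dots> = s\<^sup>2 * a + 2 * s * t * b + t\<^sup>2 * c"
      using int by (simp add: a_def b_def c_def)
    finally show ?thesis .
  qed
  have nn: "a \<ge> 0" "c \<ge> 0" by (simp_all add: a_def c_def)
  have "b\<^sup>2 \<le> a * c"
  proof (cases "c = 0")
    case True
    have "b = 0"
    proof (rule ccontr)
      assume "b \<noteq> 0"
      have "a + 2 * (- (a + 1) / (2 * b)) * b \<ge> 0"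
        using quad[of 1 "- (a + 1) / (2 * b)"] True by simp
      then show False using \<open>b \<noteq> 0\<close> by (simp add: field_simps)
    qed
    then show ?thesis using nn by simp
  next
    case False
    have "c\<^sup>2 * a + 2 * c * (-b) * b + (-b)\<^sup>2 * c \<ge> 0" by (rule quad)
    then have "c * (a * c - b\<^sup>2) \<ge> 0" by (simp add: power2_eq_square algebra_simps)
    then show ?thesis using False nn by (simp add: zero_le_mult_iff)
  qed
  then have "\<bar>b\<bar> \<le> sqrt (a * c)" using real_le_rsqrt by fastforce
  then show ?thesis by (simp add: a_def b_def c_def norm_L2_real real_sqrt_mult)
qed

lemma L2_norm_mono:
  fixes f :: "'a \<Rightarrow> real" and g :: "'a \<Rightarrow> 'b::real_normed_vector"
  assumes "f \<in> borel_measurable M" "g \<in> L2_space M" "AE x in M. \<bar>f x\<bar> \<le> norm (g x)"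
  shows "norm_L2 M f \<le> norm_L2 M g"
proof -
  have "(\<integral>x. (f x)\<^sup>2 \<partial>M) \<le> (\<integral>x. (norm (g x))\<^sup>2 \<partial>M)"
    using L2_bound[OF assms] assms
    by (intro integral_mono_AE) (auto simp: L2_space_def elim!: eventually_mono intro: abs_le_power2)
  then show ?thesis by (simp add: norm_L2_def)
qed

lemma indicator_power2: "(indicator A x :: real)\<^sup>2 = indicator A x"
  by (simp add: indicator_def)

lemma norm_L2_indicator_le:
  fixes f :: "'a \<Rightarrow> real"
  assumes "finite_measure M" "f \<in> borel_measurable M" "0 \<le> B" "A \<in> sets M"
    and "\<And>x. x \<in> space M \<Longrightarrow> \<bar>f x\<bar> \<le> B * indicator A x"
  shows "f \<in> L2_space M" "norm_L2 M f \<le> B * sqrt (measure M A)"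
proof -
  interpret finite_measure M by fact
  have g: "(\<lambda>x. B * indicator A x :: real) \<in> L2_space M"
    using assms by (intro L2_cmult) (auto simp: L2_space_real_iff indicator_power2 less_top[symmetric] intro!: integrable_real_indicator)
  have le: "AE x in M. \<bar>f x\<bar> \<le> norm (B * indicator A x :: real)"
    using assms by (auto simp: abs_mult)
  show "f \<in> L2_space M" by (rule L2_bound[OF assms(2) g le])
  have "norm_L2 M f \<le> norm_L2 M (\<lambda>x. B * indicator A x :: real)" by (rule L2_norm_mono[OF assms(2) g le])
  also have "\<dots> = B * sqrt (measure M A)"
    using assms by (simp add: norm_L2_real power_mult_distrib indicator_power2 real_sqrt_mult)
  finally show "norm_L2 M f \<le> B * sqrt (measure M A)" .
qed

text \<open>
  The increments have \<open>L\<^sup>2\<close> norm at most \<open>2 (1/2)\<^sup>k\<close>, hence summable \<open>L\<^sup>1\<close> norms on a finite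
  measure space, so the sequence converges almost everywhere. Fatou's lemma carries the Cauchy
  bound over to the pointwise limit.
\<close>

lemma L2_complete:
  fixes v :: "nat \<Rightarrow> 'a \<Rightarrow> real"
  assumes "finite_measure M" and v: "\<And>k. v k \<in> L2_space M"
    and cauchy: "\<And>k l. k \<le> l \<Longrightarrow> (\<integral>x. (v k x - v l x)\<^sup>2 \<partial>M) \<le> 4 * (1/4)^k"
  obtains u where "u \<in> L2_space M" "\<And>k. (\<integral>x. (v k x - u x)\<^sup>2 \<partial>M) \<le> 4 * (1/4)^k"
proof -
  interpret finite_measure M by fact
  have meas[measurable]: "v k \<in> borel_measurable M" for k using v by (auto simp: L2_space_real_iff)
  have dL2: "(\<lambda>x. v k x - v l x) \<in> L2_space M" for k l by (intro L2_diff v)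
  define D where "D k x = \<bar>v (Suc k) x - v k x\<bar>" for k x
  have [measurable]: "D k \<in> borel_measurable M" for k unfolding D_def by measurable
  have D1: "integrable M (D k)" for k
    unfolding D_def by (intro integrable_abs L2_integrable dL2 assms)
  have D2: "(\<integral>x. D k x \<partial>M) \<le> 2 * sqrt (measure M (space M)) * (1/2)^k" for k
  proof -
    have "D k \<in> L2_space M"
      by (rule L2_bound[OF _ dL2[of "Suc k" k]]) (auto simp: D_def)
    then have "\<bar>\<integral>x. D k x * 1 \<partial>M\<bar> \<le> norm_L2 M (D k) * norm_L2 M (\<lambda>_. 1::real)"
      by (intro L2_Cauchy_Schwarz) (auto simp: L2_space_real_iff)
    also have "norm_L2 M (D k) \<le> sqrt (4 * (1/4)^k)"
      using cauchy[of k "Suc k"] by (auto simp: norm_L2_real D_def power2_commute)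
    also have "sqrt (4 * (1/4::real)^k) = 2 * (1/2)^k"
      by (simp add: real_sqrt_mult real_sqrt_power real_sqrt_divide)
    finally show ?thesis by (simp add: norm_L2_real mult_ac mult_right_mono)
  qed
  have "(\<integral>\<^sup>+x. (\<Sum>k. ennreal (D k x)) \<partial>M) = (\<Sum>k. \<integral>\<^sup>+x. ennreal (D k x) \<partial>M)"
    by (intro nn_integral_suminf) auto
  also have "\<dots> = (\<Sum>k. ennreal (\<integral>x. D k x \<partial>M))"
    by (intro suminf_cong nn_integral_eq_integral D1) (simp add: D_def)
  also have "\<dots> \<le> (\<Sum>k. ennreal (2 * sqrt (measure M (space M)) * (1/2)^k))"
    by (intro suminf_le ennreal_leI D2) auto
  also have "\<dots> < \<infinity>"
    by (subst suminf_ennreal2) (auto intro!: summable_mult summable_geometric)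
  finally have "AE x in M. (\<Sum>k. ennreal (D k x)) \<noteq> \<infinity>"
    by (intro nn_integral_PInf_AE) auto
  then have conv: "AE x in M. convergent (\<lambda>k. v k x)"
  proof (rule eventually_mono)
    fix x assume *: "(\<Sum>k. ennreal (D k x)) \<noteq> \<infinity>"
    have "summable (\<lambda>k. D k x)" by (rule summable_suminf_not_top) (use * in \<open>auto simp: D_def\<close>)
    then have "summable (\<lambda>k. v (Suc k) x - v k x)"
      unfolding D_def by (rule summable_rabs_cancel)
    then show "convergent (\<lambda>k. v k x)"
      using sum_lessThan_telescope[of "\<lambda>k. v k x"]
      by (simp add: summable_iff_convergent convergent_diff_const_right_iff)
  qed
  define u where "u x = lim (\<lambda>k. v k x)" for x
  have um[measurable]: "u \<in> borel_measurable M" unfolding u_def by measurable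
  have lim: "AE x in M. (\<lambda>k. v k x) \<longlonglongrightarrow> u x"
    using conv by eventually_elim (simp add: u_def convergent_LIMSEQ_iff)
  have nn: "(\<integral>\<^sup>+x. ennreal ((v k x - u x)\<^sup>2) \<partial>M) \<le> ennreal (4 * (1/4)^k)" for k
  proof -
    have "(\<integral>\<^sup>+x. ennreal ((v k x - u x)\<^sup>2) \<partial>M) = (\<integral>\<^sup>+x. liminf (\<lambda>l. ennreal ((v k x - v l x)\<^sup>2)) \<partial>M)"
    proof (rule nn_integral_cong_AE, use lim in eventually_elim)
      case (elim x)
      then have "(\<lambda>l. ennreal ((v k x - v l x)\<^sup>2)) \<longlonglongrightarrow> ennreal ((v k x - u x)\<^sup>2)"
        by (intro tendsto_intros)
      then show ?case by (rule lim_imp_Liminf[OF sequentially_bot, symmetric])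
    qed
    also have "\<dots> \<le> liminf (\<lambda>l. \<integral>\<^sup>+x. ennreal ((v k x - v l x)\<^sup>2) \<partial>M)"
      by (intro nn_integral_liminf) auto
    also have "\<dots> \<le> ennreal (4 * (1/4)^k)"
    proof (rule Liminf_le)
      show "\<forall>\<^sub>F l in sequentially. (\<integral>\<^sup>+x. ennreal ((v k x - v l x)\<^sup>2) \<partial>M) \<le> ennreal (4 * (1/4)^k)"
        using eventually_ge_at_top[of k]
      proof eventually_elim
        case (elim l)
        have "(\<integral>\<^sup>+x. ennreal ((v k x - v l x)\<^sup>2) \<partial>M) = ennreal (\<integral>x. (v k x - v l x)\<^sup>2 \<partial>M)"
          using dL2[of k l] by (intro nn_integral_eq_integral) (auto simp: L2_space_real_iff)
        then show ?case using cauchy[OF elim] by (simp add: ennreal_leI)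
      qed
    qed simp
    finally show ?thesis .
  qed
  have d: "integrable M (\<lambda>x. (v k x - u x)\<^sup>2)" for k
    using nn[of k] by (intro integrableI_bounded) (auto simp: order_le_less_trans)
  have "(\<lambda>x. v 0 x - u x) \<in> L2_space M" using d by (simp add: L2_space_real_iff)
  from L2_diff[OF v[of 0] this] have "u \<in> L2_space M" by simp
  moreover have "(\<integral>x. (v k x - u x)\<^sup>2 \<partial>M) \<le> 4 * (1/4)^k" for k
    using nn[of k] nn_integral_eq_integral[OF d[of k]] by simp
  ultimately show ?thesis by (rule that)
qed

text \<open>
  The function \<open>u\<close> is the limit of a minimising sequence for \<open>\<parallel>f\<parallel>\<^sup>2 - 2 F f\<close> on \<open>V\<close>: the
  parallelogram identity makes such a sequence Cauchy, and minimality in every direction of \<open>V\<close>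
  gives the representation. Since \<open>V\<close> need not be closed, \<open>u\<close> lies in its closure only.
\<close>

lemma Riesz_representation_subspace:
  fixes V :: "('a \<Rightarrow> real) set" and F :: "('a \<Rightarrow> real) \<Rightarrow> real"
  assumes fin: "finite_measure M" and V: "V \<subseteq> L2_space M" and V0: "(\<lambda>_. 0) \<in> V"
    and Vadd: "\<And>f g c. f \<in> V \<Longrightarrow> g \<in> V \<Longrightarrow> (\<lambda>x. f x + c * g x) \<in> V"
    and F: "\<And>f g c. f \<in> V \<Longrightarrow> g \<in> V \<Longrightarrow> F (\<lambda>x. f x + c * g x) = F f + c * F g"
    and bd: "\<And>f. f \<in> V \<Longrightarrow> \<bar>F f\<bar> \<le> C * norm_L2 M f"
  obtains u where "u \<in> L2_space M" "\<And>f. f \<in> V \<Longrightarrow> F f = (\<integral>x. u x * f x \<partial>M)"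
proof -
  define q where "q f = (\<integral>x. (f x)\<^sup>2 \<partial>M)" for f :: "'a \<Rightarrow> real"
  define J where "J f = q f - 2 * F f" for f
  have q_nn: "q f \<ge> 0" for f by (simp add: q_def)
  have Vs: "(\<lambda>x. c * f x) \<in> V" "F (\<lambda>x. c * f x) = c * F f" if "f \<in> V" for f c
  proof -
    have "F (\<lambda>x. 0 + 0 * 0) = F (\<lambda>_. 0) + 0 * F (\<lambda>_. 0)" by (rule F[OF V0 V0])
    have "F (\<lambda>_. 0) = 0" using bd[OF V0] by (simp add: norm_L2_real)
    then show "(\<lambda>x. c * f x) \<in> V" "F (\<lambda>x. c * f x) = c * F f"
      using Vadd[OF V0 that, of c] F[OF V0 that, of c] by simp_all
  qed
  have q_add: "q (\<lambda>x. f x + c * g x) = q f + 2 * c * (\<integral>x. f x * g x \<partial>M) + c\<^sup>2 * q g"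
    if "f \<in> L2_space M" "g \<in> L2_space M" for f g c
  proof -
    have int: "integrable M (\<lambda>x. (f x)\<^sup>2)" "integrable M (\<lambda>x. (g x)\<^sup>2)" "integrable M (\<lambda>x. f x * g x)"
      using that L2_mult_integrable[OF that] by (auto simp: L2_space_real_iff)
    have "q (\<lambda>x. f x + c * g x) = (\<integral>x. (f x)\<^sup>2 + (2 * c) * (f x * g x) + c\<^sup>2 * (g x)\<^sup>2 \<partial>M)"
      unfolding q_def by (intro Bochner_Integration.integral_cong) (auto simp: power2_sum power_mult_distrib algebra_simps)
    also have "\<dots> = q f + 2 * c * (\<integral>x. f x * g x \<partial>M) + c\<^sup>2 * q g"
      using int by (simp add: q_def)
    finally show ?thesis .
  qed
  have J_lower: "J f \<ge> - C\<^sup>2" if "f \<in> V" for f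
  proof -
    have "F f \<le> C * norm_L2 M f" using bd[OF that] by simp
    moreover have "q f = (norm_L2 M f)\<^sup>2" by (simp add: q_def norm_L2_squared)
    moreover have "0 \<le> (norm_L2 M f - C)\<^sup>2" by simp
    ultimately show ?thesis by (simp add: J_def power2_diff algebra_simps)
  qed
  define m where "m = (INF f\<in>V. J f)"
  have bddJ: "bdd_below (J ` V)" using J_lower by (auto simp: bdd_below_def)
  have mJ: "m \<le> J f" if "f \<in> V" for f
    unfolding m_def by (rule cINF_lower[OF bddJ that])
  have "\<exists>f\<in>V. J f < m + (1/4)^k" for k :: nat
    using cInf_lessD[of "J ` V" "m + (1/4)^k"] V0 by (auto simp: m_def)
  then obtain v where vV: "\<And>k. v k \<in> V" and vJ: "\<And>k. J (v k) < m + (1/4)^k" by metis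
  have vL: "v k \<in> L2_space M" for k using vV V by auto
  have "(\<integral>x. (v k x - v l x)\<^sup>2 \<partial>M) \<le> 4 * (1/4)^k" if "k \<le> l" for k l
  proof -
    define w where "w = (\<lambda>x. (1/2) * (v k x + 1 * v l x))"
    have wV: "w \<in> V" unfolding w_def by (intro Vs Vadd vV)
    have Fw: "F w = (1/2) * (F (v k) + F (v l))"
      unfolding w_def using Vs(2)[OF Vadd[OF vV vV, of k 1 l], of "1/2"] F[OF vV vV, of k 1 l] by simp
    have qw: "4 * q w = q (v k) + 2 * (\<integral>x. v k x * v l x \<partial>M) + q (v l)"
    proof -
      have "4 * q w = q (\<lambda>x. v k x + 1 * v l x)"
        unfolding q_def w_def by (simp add: power_mult_distrib power_divide)
      then show ?thesis using q_add[OF vL[of k] vL[of l], of 1] by simp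
    qed
    have "q (\<lambda>x. v k x + (-1) * v l x) = q (v k) - 2 * (\<integral>x. v k x * v l x \<partial>M) + q (v l)"
      using q_add[OF vL[of k] vL[of l], of "-1"] by simp
    then have "(\<integral>x. (v k x - v l x)\<^sup>2 \<partial>M) = 2 * J (v k) + 2 * J (v l) - 4 * J w"
      using Fw qw by (simp add: J_def q_def algebra_simps)
    also have "\<dots> \<le> 2 * (1/4)^k + 2 * (1/4)^l"
      using vJ[of k] vJ[of l] mJ[OF wV] by simp
    also have "(1/4::real)^l \<le> (1/4)^k" using that by (intro power_decreasing) auto
    finally show ?thesis by simp
  qed
  from L2_complete[OF fin vL this] obtain u where u: "u \<in> L2_space M"
    and conv: "\<And>k. (\<integral>x. (v k x - u x)\<^sup>2 \<partial>M) \<le> 4 * (1/4)^k" by auto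
  have "F f = (\<integral>x. u x * f x \<partial>M)" if f: "f \<in> V" for f
  proof -
    have fL: "f \<in> L2_space M" using f V by auto
    define b where "b k = (\<integral>x. v k x * f x \<partial>M)" for k
    have "(\<lambda>k. b k - (\<integral>x. u x * f x \<partial>M)) \<longlonglongrightarrow> 0"
    proof (rule Lim_null_comparison)
      show "\<forall>\<^sub>F k in sequentially. norm (b k - (\<integral>x. u x * f x \<partial>M)) \<le> (2 * norm_L2 M f) * (1/2)^k"
      proof (rule always_eventually, rule allI)
        fix k
        have "b k - (\<integral>x. u x * f x \<partial>M) = (\<integral>x. (v k x - u x) * f x \<partial>M)"
          unfolding b_def using L2_mult_integrable[OF vL[of k] fL] L2_mult_integrable[OF u fL]
          by (simp add: left_diff_distrib)
        also have "\<bar>\<dots>\<bar> \<le> norm_L2 M (\<lambda>x. v k x - u x) * norm_L2 M f"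
          by (intro L2_Cauchy_Schwarz L2_diff vL u fL)
        also have "norm_L2 M (\<lambda>x. v k x - u x) \<le> sqrt (4 * (1/4)^k)"
          using conv[of k] by (simp add: norm_L2_real)
        also have "sqrt (4 * (1/4::real)^k) = 2 * (1/2)^k"
          by (simp add: real_sqrt_mult real_sqrt_power real_sqrt_divide)
        also have "2 * (1/2)^k * norm_L2 M f = (2 * norm_L2 M f) * (1/2)^k" by simp
        finally show "norm (b k - (\<integral>x. u x * f x \<partial>M)) \<le> (2 * norm_L2 M f) * (1/2)^k"
          by (simp add: mult_right_mono)
      qed
      show "(\<lambda>k. (2 * norm_L2 M f) * (1/2)^k) \<longlonglongrightarrow> 0"
        by (intro tendsto_mult_right_zero LIMSEQ_power_zero) simp
    qed
    then have blim: "b \<longlonglongrightarrow> (\<integral>x. u x * f x \<partial>M)" by (simp add: LIM_zero_cancel)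
    define \<delta> where "\<delta> = (\<integral>x. u x * f x \<partial>M) - F f"
    have quad: "0 \<le> 2 * t * \<delta> + t\<^sup>2 * q f" for t
    proof (rule LIMSEQ_le_const)
      show "(\<lambda>k. (1/4)^k + 2 * t * (b k - F f) + t\<^sup>2 * q f) \<longlonglongrightarrow> 2 * t * \<delta> + t\<^sup>2 * q f"
        unfolding \<delta>_def by (rule tendsto_eq_intros blim LIMSEQ_power_zero | simp)+
      have "0 \<le> (1/4)^k + 2 * t * (b k - F f) + t\<^sup>2 * q f" for k
      proof -
        have "m \<le> J (\<lambda>x. v k x + t * f x)" by (intro mJ Vadd vV f)
        also have "\<dots> = J (v k) + 2 * t * (b k - F f) + t\<^sup>2 * q f"
          using q_add[OF vL[of k] fL, of t] F[OF vV[of k] f, of t]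
          by (simp add: J_def b_def algebra_simps)
        finally show ?thesis using vJ[of k] by simp
      qed
      then show "\<exists>N. \<forall>k\<ge>N. 0 \<le> (1/4)^k + 2 * t * (b k - F f) + t\<^sup>2 * q f" by auto
    qed
    have "\<delta> = 0"
    proof (cases "q f = 0")
      case True
      then show ?thesis using quad[of "-\<delta>"] by (simp add: power2_eq_square[symmetric])
    next
      case False
      then have pos: "q f > 0" using q_nn[of f] by simp
      have "0 \<le> 2 * (-\<delta> / q f) * \<delta> + (-\<delta> / q f)\<^sup>2 * q f" by (rule quad)
      also have "\<dots> = - (\<delta>\<^sup>2 / q f)" using pos by (simp add: field_simps power2_eq_square)
      finally show ?thesis using pos by (simp add: divide_le_0_iff)
    qed
    then show ?thesis by (simp add: \<delta>_def)
  qed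
  with u show ?thesis by (rule that)
qed

section \<open>Trigonometric polynomials on the cell\<close>

lemma int_vec_simps:
  "int_vec (k + l) = int_vec k + int_vec l"
  "int_vec (k - l) = int_vec k - int_vec l"
  "int_vec 0 = 0"
  by (simp_all add: int_vec_def vec_eq_iff)

lemma int_vec_inner: "int_vec k \<bullet> int_vec l = real_of_int (\<Sum>i\<in>UNIV. k $ i * l $ i)"
  by (simp add: int_vec_def inner_vec_def)

lemma unit_cell_eq_box: "unit_cell = box 0 (1 :: real ^ 'm)"
  by (auto simp: unit_cell_def mem_box_cart)

lemma unit_cell_facts:
  "open (unit_cell :: (real ^ 'm) set)"
  "unit_cell \<in> sets (borel :: (real ^ 'm) measure)"
  "unit_cell \<in> sets (lebesgue :: (real ^ 'm) measure)"
  "emeasure lborel (unit_cell :: (real ^ 'm) set) = 1"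
  "emeasure lebesgue (unit_cell :: (real ^ 'm) set) = 1"
proof -
  show 1: "emeasure lborel (unit_cell :: (real ^ 'm) set) = 1"
    unfolding unit_cell_eq_box
    by (subst emeasure_lborel_box) (auto simp: Basis_vec_def inner_axis intro!: prod.neutral)
  show "open (unit_cell :: (real ^ 'm) set)" unfolding unit_cell_eq_box by (rule open_box)
  then show 2: "unit_cell \<in> sets (borel :: (real ^ 'm) measure)" by simp
  then show "unit_cell \<in> sets (lebesgue :: (real ^ 'm) measure)"
    "emeasure lebesgue (unit_cell :: (real ^ 'm) set) = 1"
    using 1 by simp_all
qed

text \<open>
  Sines are the cosines shifted by an odd multiple of a right angle. With all multiples admitted,
  the linear span of the family is closed under multiplication, see \<open>trig_mult\<close>.
\<close>

definition trig :: "int ^ 'm \<Rightarrow> int \<Rightarrow> real ^ 'm \<Rightarrow> real" where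
  "trig k j y = cos (2 * pi * (int_vec k \<bullet> y) + of_int j * (pi / 2))"

lemma continuous_on_trig [continuous_intros]: "continuous_on S (trig k j)"
  unfolding trig_def by (intro continuous_intros)

lemma trig_measurable [measurable]: "trig k j \<in> borel_measurable borel"
  by (intro borel_measurable_continuous_onI continuous_on_trig)

lemma abs_trig_le: "\<bar>trig k j y\<bar> \<le> 1"
  by (simp add: trig_def)

lemma cos_add_of_int_pi: "cos (x + 2 * pi * of_int n) = cos x" "cos (2 * pi * of_int n + x) = cos x"
  by (simp_all add: cos_add cos_int_2pin sin_int_2pin)

lemma trig_periodic: "cell_periodic (trig k j)"
  unfolding cell_periodic_def
proof (intro allI)
  fix y l
  have "2 * pi * (int_vec k \<bullet> (y + int_vec l)) + of_int j * (pi / 2) =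
    (2 * pi * (int_vec k \<bullet> y) + of_int j * (pi / 2)) + 2 * pi * of_int (\<Sum>i\<in>UNIV. k $ i * l $ i)"
    by (simp add: inner_add_right int_vec_inner algebra_simps)
  then show "trig k j (y + int_vec l) = trig k j y"
    unfolding trig_def by (simp only: cos_add_of_int_pi)
qed

lemma trig_mult:
  "trig k j y * trig k' j' y = 1/2 * trig (k + k') (j + j') y + 1/2 * trig (k - k') (j - j') y"
  unfolding trig_def
  by (simp add: cos_times_cos int_vec_simps algebra_simps add_divide_distrib diff_divide_distrib)

definition trigB :: "int ^ 'm \<Rightarrow> int \<Rightarrow> (real ^ 'm) \<Rightarrow>\<^sub>C real" where
  "trigB k j = Bcontfun (trig k j)"

lemma apply_trigB [simp]: "apply_bcontfun (trigB k j) = trig k j"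
  unfolding trigB_def
  by (rule Bcontfun_inverse, rule bcontfun_normI[where b=1]) (auto intro: continuous_on_trig simp: abs_trig_le)

definition trig_polynomials :: "((real ^ 'm) \<Rightarrow>\<^sub>C real) set" where
  "trig_polynomials = span (range (\<lambda>(k, j). trigB k j))"

lemma trigB_in: "trigB k j \<in> trig_polynomials"
  unfolding trig_polynomials_def by (rule span_base) auto

lemma subspace_trig: "subspace trig_polynomials"
  by (simp add: trig_polynomials_def)

lemma subspace_C_sharp: "subspace C_sharp"
  by (auto simp: subspace_def C_sharp_def cell_periodic_def)

lemma trig_polynomials_C_sharp: "trig_polynomials \<subseteq> C_sharp"
  unfolding trig_polynomials_def
  by (rule span_minimal) (auto simp: subspace_C_sharp, simp add: C_sharp_def trig_periodic)

lemma trig_polynomials_mult: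
  fixes p q :: "(real ^ 'm) \<Rightarrow>\<^sub>C real"
  assumes "p \<in> trig_polynomials" "q \<in> trig_polynomials"
  shows "\<exists>r\<in>trig_polynomials. \<forall>y. apply_bcontfun r y = apply_bcontfun p y * apply_bcontfun q y"
proof -
  let ?M = "\<lambda>p q. \<exists>r\<in>trig_polynomials. \<forall>y. apply_bcontfun r y = apply_bcontfun p y * apply_bcontfun q y"
  have lin: "subspace {q. ?M p q}" for p :: "(real ^ 'm) \<Rightarrow>\<^sub>C real"
  proof (rule subspaceI)
    show "0 \<in> {q. ?M p q}" using subspace_0[OF subspace_trig] by (auto intro!: bexI[of _ 0])
  next
    fix q q' assume "q \<in> {q. ?M p q}" "q' \<in> {q. ?M p q}"
    then obtain r r' where "r \<in> trig_polynomials" "r' \<in> trig_polynomials"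
      "\<forall>y. apply_bcontfun r y = apply_bcontfun p y * apply_bcontfun q y"
      "\<forall>y. apply_bcontfun r' y = apply_bcontfun p y * apply_bcontfun q' y" by auto
    then show "q + q' \<in> {q. ?M p q}"
      by (auto intro!: bexI[of _ "r + r'"] subspace_add[OF subspace_trig] simp: algebra_simps)
  next
    fix c q assume "q \<in> {q. ?M p q}"
    then obtain r where "r \<in> trig_polynomials"
      "\<forall>y. apply_bcontfun r y = apply_bcontfun p y * apply_bcontfun q y" by auto
    then show "c *\<^sub>R q \<in> {q. ?M p q}"
      by (auto intro!: bexI[of _ "c *\<^sub>R r"] subspace_scale[OF subspace_trig] simp: algebra_simps)
  qed
  have base: "?M (trigB k j) (trigB k' j')" for k k' :: "int ^ 'm" and j j'
    by (rule bexI[of _ "(1/2) *\<^sub>R trigB (k + k') (j + j') + (1/2) *\<^sub>R trigB (k - k') (j - j')"])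
       (auto simp: trig_mult intro!: subspace_add[OF subspace_trig] subspace_scale[OF subspace_trig] trigB_in)
  have one: "?M (trigB k j) q" if "q \<in> trig_polynomials" for k :: "int ^ 'm" and j q
  proof -
    have "range (\<lambda>(k, j). trigB k j) \<subseteq> {q. ?M (trigB k j) q}"
    proof
      fix q' :: "(real ^ 'm) \<Rightarrow>\<^sub>C real" assume "q' \<in> range (\<lambda>(k, j). trigB k j)"
      then obtain k' j' where "q' = trigB k' j'" by auto
      then show "q' \<in> {q. ?M (trigB k j) q}" using base[of k j k' j'] by simp
    qed
    from span_minimal[OF this lin] that show ?thesis
      unfolding trig_polynomials_def[symmetric] by blast
  qed
  have "?M q (trigB k j)" if "q \<in> trig_polynomials" for k :: "int ^ 'm" and j q
    using one[OF that, of k j] by (simp add: mult.commute)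
  then have pk: "?M p (trigB k j)" for k j using assms(1) by simp
  have "range (\<lambda>(k, j). trigB k j) \<subseteq> {q. ?M p q}"
  proof
    fix q' :: "(real ^ 'm) \<Rightarrow>\<^sub>C real" assume "q' \<in> range (\<lambda>(k, j). trigB k j)"
    then obtain k' j' where "q' = trigB k' j'" by auto
    then show "q' \<in> {q. ?M p q}" using pk[of k' j'] by simp
  qed
  from span_minimal[OF this lin] assms(2) show ?thesis
    unfolding trig_polynomials_def[symmetric] by blast
qed

text \<open>
  The torus, as a compact set on which the periodic functions are the continuous functions.
\<close>

definition torus :: "real ^ 'm \<Rightarrow> complex ^ 'm" where
  "torus y = (\<chi> i. cis (2 * pi * y $ i))"

lemma continuous_on_torus: "continuous_on S torus"
  unfolding torus_def cis_conv_exp by (intro continuous_intros)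

lemma torus_eq_imp:
  assumes "torus y = torus z"
  shows "\<exists>k. y = z + int_vec k"
proof -
  have "\<exists>n::int. y $ i = z $ i + of_int n" for i
  proof -
    have "cis (2 * pi * y $ i) = cis (2 * pi * z $ i)"
      using assms by (simp add: torus_def vec_eq_iff)
    then have "sin (2 * pi * y $ i) = sin (2 * pi * z $ i) \<and> cos (2 * pi * y $ i) = cos (2 * pi * z $ i)"
      by (metis cis.sel)
    then obtain n :: int where "2 * pi * y $ i = 2 * pi * z $ i + 2 * pi * n"
      using sin_cos_eq_iff[of "2 * pi * y $ i" "2 * pi * z $ i"] by (auto simp: mult_ac)
    then have "2 * pi * (y $ i) = 2 * pi * (z $ i + of_int n)" by (simp add: distrib_left)
    then have "y $ i = z $ i + of_int n" by simp
    then show ?thesis ..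
  qed
  then obtain n where "\<And>i. y $ i = z $ i + of_int (n i)" by metis
  then show ?thesis
    by (intro exI[of _ "\<chi> i. n i"]) (simp add: vec_eq_iff int_vec_def)
qed

lemma torus_periodic: "torus (y + int_vec k) = torus y"
  by (simp add: torus_def int_vec_def vec_eq_iff distrib_left cis_mult[symmetric])

lemma torus_image_cube: "torus ` cbox 0 1 = range (torus :: real ^ 'm \<Rightarrow> _)"
proof -
  have "torus y \<in> torus ` cbox 0 1" for y :: "real ^ 'm"
  proof (rule image_eqI)
    show "torus y = torus (y + int_vec (\<chi> i. - \<lfloor>y $ i\<rfloor>))" by (simp add: torus_periodic)
    show "y + int_vec (\<chi> i. - \<lfloor>y $ i\<rfloor>) \<in> cbox 0 1"
      by (auto simp: mem_box_cart int_vec_def) linarith+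
  qed
  then show ?thesis by auto
qed

text \<open>
  The Stone-Weierstrass theorem on the torus: coordinates of the torus are trigonometric functions,
  so trigonometric polynomials separate its points.
\<close>

lemma trig_polynomials_dense:
  fixes q :: "(real ^ 'm) \<Rightarrow>\<^sub>C real"
  assumes q: "q \<in> C_sharp" and "e > 0"
  obtains p where "p \<in> trig_polynomials" "norm (q - p) < e"
proof -
  let ?S = "range (torus :: real ^ 'm \<Rightarrow> _)"
  define \<R> where "\<R> = {F. continuous_on ?S F \<and>
    (\<exists>p\<in>trig_polynomials. \<forall>y::real ^ 'm. F (torus y) = apply_bcontfun p y)}"
  have compS: "compact ?S"
    unfolding torus_image_cube[symmetric]
    by (intro compact_continuous_image continuous_on_torus compact_cbox)
  interpret function_ring_on \<R> ?S
  proof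
    fix f g :: "complex ^ 'm \<Rightarrow> real" assume "f \<in> \<R>" "g \<in> \<R>"
    then obtain p p' where *: "continuous_on ?S f" "continuous_on ?S g"
      "p \<in> trig_polynomials" "\<And>y. f (torus y) = apply_bcontfun p y"
      "p' \<in> trig_polynomials" "\<And>y. g (torus y) = apply_bcontfun p' y"
      unfolding \<R>_def by blast
    show "(\<lambda>x. f x + g x) \<in> \<R>"
      unfolding \<R>_def using * subspace_add[OF subspace_trig *(3,5)]
      by (auto intro!: continuous_intros bexI[of _ "p + p'"])
    obtain r where "r \<in> trig_polynomials" "\<And>y. apply_bcontfun r y = apply_bcontfun p y * apply_bcontfun p' y"
      using trig_polynomials_mult[OF *(3,5)] by auto
    then show "(\<lambda>x. f x * g x) \<in> \<R>"
      unfolding \<R>_def using * by (auto intro!: continuous_intros bexI[of _ r])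
  next
    fix c :: real
    have "c *\<^sub>R trigB 0 0 \<in> trig_polynomials" by (intro subspace_scale[OF subspace_trig] trigB_in)
    then show "(\<lambda>_. c) \<in> \<R>"
      unfolding \<R>_def by (auto intro!: bexI[of _ "c *\<^sub>R trigB 0 0"] simp: trig_def int_vec_simps)
  next
    fix x y assume "x \<in> ?S" "y \<in> ?S" "x \<noteq> y"
    then obtain i where i: "x $ i \<noteq> y $ i" by (auto simp: vec_eq_iff)
    have inner: "int_vec (axis i 1) \<bullet> z = z $ i" for z :: "real ^ 'm"
    proof -
      have "int_vec (axis i 1) = (axis i 1 :: real ^ 'm)"
        by (simp add: int_vec_def vec_eq_iff axis_def)
      then show ?thesis by (simp add: inner_axis')
    qed
    have R1: "(\<lambda>z. Re (z $ i)) \<in> \<R>"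
      unfolding \<R>_def
      by (auto intro!: continuous_intros bexI[of _ "trigB (axis i 1) 0"] trigB_in
          simp: torus_def trig_def inner)
    have R2: "(\<lambda>z. Im (z $ i)) \<in> \<R>"
      unfolding \<R>_def
      by (auto intro!: continuous_intros bexI[of _ "trigB (axis i 1) (-1)"] trigB_in
          simp: torus_def trig_def inner cos_diff)
    show "\<exists>f\<in>\<R>. f x \<noteq> f y"
      using i bexI[OF _ R1, of "\<lambda>f. f x \<noteq> f y"] bexI[OF _ R2, of "\<lambda>f. f x \<noteq> f y"]
      by (auto simp: complex_eq_iff)
  qed (auto simp: compS \<R>_def)
  define F where "F z = apply_bcontfun q (inv torus z)" for z
  have F: "F (torus y) = apply_bcontfun q y" for y
  proof -
    have "torus (inv torus (torus y)) = torus y" by (rule f_inv_into_f) simp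
    then obtain k where "inv torus (torus y) = y + int_vec k" using torus_eq_imp by blast
    then show ?thesis using q by (simp add: F_def C_sharp_def cell_periodic_def)
  qed
  have "continuous_on ?S F"
  proof (subst continuous_on_closed_vimage)
    show "closed ?S" by (rule compact_imp_closed[OF compS])
    show "\<forall>B. closed B \<longrightarrow> closed (F -` B \<inter> ?S)"
    proof (intro allI impI)
      fix B :: "real set" assume "closed B"
      have "F -` B \<inter> ?S = torus ` (apply_bcontfun q -` B \<inter> cbox 0 1)"
      proof -
        have "F -` B \<inter> ?S = F -` B \<inter> torus ` cbox 0 1" by (simp add: torus_image_cube)
        then show ?thesis using F by auto
      qed
      moreover have "compact (torus ` (apply_bcontfun q -` B \<inter> cbox 0 1))"
        by (intro compact_continuous_image continuous_on_torus)
           (metis \<open>closed B\<close> closed_Int_compact compact_cbox continuous_on_apply_bcontfun continuous_on_closed_vimage closed_UNIV Int_UNIV_right)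
      ultimately show "closed (F -` B \<inter> ?S)" by (simp add: compact_imp_closed)
    qed
  qed
  then obtain g where g: "g \<in> \<R>" "\<And>x. x \<in> ?S \<Longrightarrow> \<bar>F x - g x\<bar> < e / 2"
    using Stone_Weierstrass_basic[of F "e / 2"] \<open>e > 0\<close> by auto
  then obtain p where p: "p \<in> trig_polynomials" "\<And>y. g (torus y) = apply_bcontfun p y"
    by (auto simp: \<R>_def)
  have "norm (q - p) \<le> e / 2"
    by (rule norm_bound) (use g(2)[of "torus _"] F p(2) in \<open>auto intro: less_imp_le\<close>)
  with p(1) \<open>e > 0\<close> show ?thesis by (intro that[of p]) auto
qed

lemma countable_int_vec: "countable (UNIV :: (int ^ 'm) set)"
proof (rule countableI')
  show "inj (\<lambda>k :: int ^ 'm. to_nat (vec_nth k))"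
    by (auto simp: inj_on_def vec_eq_iff)
qed

text \<open>
  Trigonometric polynomials with rational coefficients are dense; they are built by adding one
  rational multiple of a generator at a time.
\<close>

lemma countable_dense_C_sharp:
  obtains D :: "((real ^ 'm) \<Rightarrow>\<^sub>C real) set"
  where "countable D" "D \<subseteq> C_sharp" "\<And>q e. q \<in> C_sharp \<Longrightarrow> e > 0 \<Longrightarrow> \<exists>d\<in>D. norm (q - d) < e"
proof -
  let ?T = "range (\<lambda>(k, j). trigB k j :: (real ^ 'm) \<Rightarrow>\<^sub>C real)"
  define E where "E n = ((\<lambda>A. (\<lambda>(r, b, p). r *\<^sub>R b + p) ` (\<rat> \<times> ?T \<times> A)) ^^ n) {0}" for n :: nat
  define D where "D = (\<Union>n. E n)"
  have E_Suc: "E (Suc n) = (\<lambda>(r, b, p). r *\<^sub>R b + p) ` (\<rat> \<times> ?T \<times> E n)" for n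
    by (simp add: E_def)
  have "countable (UNIV :: ((int ^ 'm) \<times> int) set)"
    using countable_int_vec countable_SIGMA[of "UNIV :: (int ^ 'm) set" "\<lambda>_. UNIV :: int set"] by simp
  then have cT: "countable ?T" by (rule countable_image)
  have cE: "countable (E n)" for n
    by (induction n) (auto simp: E_Suc cT countable_rat intro!: countable_image countable_SIGMA, simp add: E_def)
  have ET: "E n \<subseteq> trig_polynomials" for n
    by (induction n)
       (auto simp: E_Suc intro!: subspace_add[OF subspace_trig] subspace_scale[OF subspace_trig] trigB_in,
        simp add: E_def subspace_0[OF subspace_trig])
  have dense: "\<forall>e>0. \<exists>d\<in>D. norm (p - d) < e" if "p \<in> span ?T" for p
    using that
  proof (induction rule: span_induct_alt)
    case base
    have "0 \<in> D" unfolding D_def using E_def[of 0] by (intro UN_I[of 0]) auto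
    then show ?case by (auto intro!: bexI[of _ 0])
  next
    case (step c x y)
    show ?case
    proof (intro allI impI)
      fix e :: real assume "e > 0"
      with step obtain d where d: "d \<in> D" "norm (y - d) < e / 2" by (meson half_gt_zero)
      then obtain n where n: "d \<in> E n" by (auto simp: D_def)
      have nx: "norm x \<le> 1"
        using step(1) by (intro norm_bound) (auto simp: abs_trig_le)
      obtain r where r: "r \<in> \<rat>" "c < r" "r < c + e / 2"
        using Rats_dense_in_real[of c "c + e / 2"] \<open>e > 0\<close> by auto
      have "r *\<^sub>R x + d \<in> E (Suc n)" using n r step(1) unfolding E_Suc by force
      moreover have "norm ((c *\<^sub>R x + y) - (r *\<^sub>R x + d)) < e"
      proof -
        have "(c *\<^sub>R x + y) - (r *\<^sub>R x + d) = (c - r) *\<^sub>R x + (y - d)" by (simp add: algebra_simps)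
        also have "norm \<dots> \<le> \<bar>c - r\<bar> * norm x + norm (y - d)"
          by (rule order_trans[OF norm_triangle_ineq]) simp
        also have "\<dots> \<le> \<bar>c - r\<bar> * 1 + norm (y - d)" using nx by (intro add_mono mult_left_mono) auto
        also have "\<dots> < e" using r d by simp
        finally show ?thesis .
      qed
      ultimately show "\<exists>d\<in>D. norm ((c *\<^sub>R x + y) - d) < e" by (auto simp: D_def)
    qed
  qed
  show ?thesis
  proof (rule that)
    show "countable D" unfolding D_def using cE by auto
    show "D \<subseteq> C_sharp" using ET trig_polynomials_C_sharp by (auto simp: D_def)
    fix q :: "(real ^ 'm) \<Rightarrow>\<^sub>C real" and e :: real assume "q \<in> C_sharp" "e > 0"
    then obtain p where p: "p \<in> trig_polynomials" "norm (q - p) < e / 2"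
      using trig_polynomials_dense[of q "e / 2"] by auto
    then obtain d where d: "d \<in> D" "norm (p - d) < e / 2"
      using dense[of p] \<open>e > 0\<close> unfolding trig_polynomials_def by (meson half_gt_zero)
    have "norm (q - d) < e"
      using norm_triangle_lt[of "q - p" "p - d" e] p d by simp
    with d show "\<exists>d\<in>D. norm (q - d) < e" by auto
  qed
qed

lemma lborel_integral_translation:
  fixes f :: "'a::euclidean_space \<Rightarrow> real"
  assumes [measurable]: "f \<in> borel_measurable borel"
  shows "(\<integral>x. f (a + x) \<partial>lborel) = (\<integral>x. f x \<partial>lborel)"
proof -
  have "(\<integral>x. f x \<partial>lborel) = (\<integral>x. f x \<partial>distr lborel borel ((+) a))" by (simp add: lborel_distr_plus)
  also have "\<dots> = (\<integral>x. f (a + x) \<partial>lborel)" by (rule integral_distr) auto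
  finally show ?thesis ..
qed

text \<open>
  Moving \<open>y\<close> by half a wave in a direction \<open>i\<close> with \<open>k\<^sub>i \<noteq> 0\<close> reverses the sign of the function. The part
  of the cell that leaves the cell in this motion is brought back by an integer translation,
  which changes nothing, so the mean equals its own negative.
\<close>

lemma trig_mean:
  fixes k :: "int ^ 'm"
  assumes "k \<noteq> 0"
  shows "(\<integral>y. trig k j y \<partial>lebesgue_on unit_cell) = 0"
proof -
  obtain i where i: "k $ i \<noteq> 0" using assms by (auto simp: vec_eq_iff)
  \<comment> \<open>Half a wave length in direction \<open>i\<close>; shifts by \<open>t\<close> and by \<open>t - 1\<close> both reverse the sign.\<close>
  define t where "t = 1 / (2 * \<bar>real_of_int (k $ i)\<bar>)"
  have k1: "\<bar>real_of_int (k $ i)\<bar> \<ge> 1" using i by linarith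
  then have t: "0 < t" "t < 1" by (auto simp: t_def field_simps)
  define e :: "real ^ 'm" where "e = axis i 1"
  have ke: "int_vec k \<bullet> e = of_int (k $ i)" by (simp add: e_def inner_axis int_vec_def)
  have en: "e $ j = (if j = i then 1 else 0)" for j by (simp add: e_def axis_def)
  have shift: "trig k j (s *\<^sub>R e + y) = - trig k j y" if "s * of_int (k $ i) = 1/2 + of_int n" for s y n
  proof -
    have "2 * pi * (int_vec k \<bullet> (s *\<^sub>R e + y)) + of_int j * (pi / 2) =
      2 * pi * of_int n + (2 * pi * (int_vec k \<bullet> y) + of_int j * (pi / 2)) + pi"
      using that by (simp add: inner_add_right ke algebra_simps)
    then have "trig k j (s *\<^sub>R e + y) =
      cos (2 * pi * of_int n + ((2 * pi * (int_vec k \<bullet> y) + of_int j * (pi / 2)) + pi))"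
      unfolding trig_def by (simp only: add.assoc)
    then show ?thesis unfolding trig_def by (simp only: cos_add_of_int_pi cos_periodic_pi)
  qed
  have "t * of_int (k $ i) = 1/2 \<or> t * of_int (k $ i) = 1/2 + of_int (-1)"
    using i by (auto simp: t_def abs_if field_simps)
  then obtain n :: int where tn: "t * of_int (k $ i) = 1/2 + of_int n"
    by (metis add_0_right of_int_0)
  have sh1: "trig k j (t *\<^sub>R e + y) = - trig k j y" for y by (rule shift[OF tn])
  have "(t - 1) * of_int (k $ i) = 1/2 + of_int (n - k $ i)" using tn by (simp add: algebra_simps)
  then have sh2: "trig k j ((t - 1) *\<^sub>R e + y) = - trig k j y" for y by (rule shift)
  \<comment> \<open>The half-open cell is used because its two pieces fit together exactly after translation.\<close>
  define Z :: "(real ^ 'm) set" where "Z = {y. \<forall>j. 0 \<le> y $ j \<and> y $ j < 1}"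
  have Zm[measurable]: "Z \<in> sets borel" unfolding Z_def by measurable
  have Zbox: "box 0 1 \<subseteq> Z" "Z \<subseteq> cbox 0 1" by (auto simp: Z_def mem_box_cart less_imp_le)
  have int: "integrable lborel (\<lambda>y. indicator A y * trig k j y)"
    if A: "A \<subseteq> Z" "A \<in> sets borel" for A
  proof (rule Bochner_Integration.integrable_bound[where f="indicator (cbox 0 1) :: _ \<Rightarrow> real"])
    show "integrable lborel (indicator (cbox 0 1 :: (real ^ 'm) set) :: _ \<Rightarrow> real)"
      by (intro integrable_real_indicator) (auto simp: emeasure_lborel_cbox_eq)
    show "AE y in lborel. norm (indicator A y * trig k j y) \<le> norm (indicator (cbox 0 1) y :: real)"
      using A Zbox by (intro AE_I2) (auto simp: indicator_def abs_mult abs_trig_le)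
  qed (use A in measurable)
  define I where "I A = (\<integral>y. indicator A y * trig k j y \<partial>lborel)" for A
  have split: "I Z = I {y\<in>Z. P y} + I {y\<in>Z. \<not> P y}" if [measurable]: "Measurable.pred borel P" for P
  proof -
    have "I Z = (\<integral>y. indicator {y\<in>Z. P y} y * trig k j y + indicator {y\<in>Z. \<not> P y} y * trig k j y \<partial>lborel)"
      unfolding I_def by (intro Bochner_Integration.integral_cong) (auto simp: indicator_def)
    also have "\<dots> = I {y\<in>Z. P y} + I {y\<in>Z. \<not> P y}"
      unfolding I_def by (intro Bochner_Integration.integral_add int) auto
    finally show ?thesis .
  qed
  have tr: "I A = - I {y. s *\<^sub>R e + y \<in> A}"
    if [measurable]: "A \<in> sets borel" and sh: "\<And>y. trig k j (s *\<^sub>R e + y) = - trig k j y" for A s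
  proof -
    have "I A = (\<integral>y. indicator A (s *\<^sub>R e + y) * trig k j (s *\<^sub>R e + y) \<partial>lborel)"
      unfolding I_def by (subst lborel_integral_translation) auto
    also have "\<dots> = (\<integral>y. - (indicator {y. s *\<^sub>R e + y \<in> A} y * trig k j y) \<partial>lborel)"
      by (intro Bochner_Integration.integral_cong) (auto simp: sh indicator_def)
    finally show ?thesis by (simp add: I_def)
  qed
  define W where "W y \<longleftrightarrow> (\<forall>j. j \<noteq> i \<longrightarrow> 0 \<le> y $ j \<and> y $ j < 1)" for y :: "real ^ 'm"
  have Zi: "y \<in> Z \<longleftrightarrow> 0 \<le> y $ i \<and> y $ i < 1 \<and> W y" for y
    unfolding Z_def W_def mem_Collect_eq by metis
  have Wshift: "W (s *\<^sub>R e + y) = W y" for s y by (simp add: W_def en)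
  have "{y. t *\<^sub>R e + y \<in> {y\<in>Z. t \<le> y $ i}} = {y\<in>Z. \<not> 1 - t \<le> y $ i}"
  using t by (auto simp: Zi Wshift en)
  then have a: "I {y\<in>Z. t \<le> y $ i} = - I {y\<in>Z. \<not> 1 - t \<le> y $ i}"
    using tr[OF _ sh1, of "{y\<in>Z. t \<le> y $ i}"] by simp
  have "{y. (t - 1) *\<^sub>R e + y \<in> {y\<in>Z. \<not> t \<le> y $ i}} = {y\<in>Z. 1 - t \<le> y $ i}"
  using t by (auto simp: Zi Wshift en)
  then have b: "I {y\<in>Z. \<not> t \<le> y $ i} = - I {y\<in>Z. 1 - t \<le> y $ i}"
    using tr[OF _ sh2, of "{y\<in>Z. \<not> t \<le> y $ i}"] by simp
  have "I Z = - I Z" using a b split[of "\<lambda>y. t \<le> y $ i"] split[of "\<lambda>y. 1 - t \<le> y $ i"] by simp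
  then have IZ: "I Z = 0" by simp
  have "AE y in lebesgue. y \<notin> cbox 0 1 - box 0 (1 :: real ^ 'm)"
    using negligible_frontier_interval[of "0 :: real ^ 'm" 1]
    unfolding negligible_iff_null_sets by (rule AE_not_in)
  then have ae: "AE y in lborel. y \<notin> cbox 0 1 - box 0 (1 :: real ^ 'm)"
    unfolding AE_completion_iff .
  note [measurable] = unit_cell_facts(2)
  have "(\<integral>y. trig k j y \<partial>lebesgue_on unit_cell) = (\<integral>y. indicator unit_cell y *\<^sub>R trig k j y \<partial>lebesgue)"
    by (rule integral_restrict_space) (simp add: unit_cell_facts)
  also have "\<dots> = (\<integral>y. indicator unit_cell y *\<^sub>R trig k j y \<partial>lborel)"
    using unit_cell_facts by (intro integral_completion) auto
  also have "\<dots> = I Z"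
    unfolding I_def
  proof (rule integral_cong_AE)
    show "AE y in lborel. indicator unit_cell y *\<^sub>R trig k j y = indicator Z y * trig k j y"
      using ae by eventually_elim (use Zbox in \<open>auto simp: indicator_def unit_cell_eq_box\<close>)
  qed (use unit_cell_facts in auto)
  finally show ?thesis using IZ by simp
qed

section \<open>Equidistribution of the oscillating points\<close>

lemma integral_indicator_approx:
  fixes f :: "'a::euclidean_space \<Rightarrow> real"
  assumes "A \<in> sets borel" "B \<in> sets borel" "A \<subseteq> B" "emeasure lborel B < \<infinity>"
    and [measurable]: "f \<in> borel_measurable borel" and f: "\<And>x. \<bar>f x\<bar> \<le> 1"
  shows "\<bar>(\<integral>x. indicator B x * f x \<partial>lborel) - (\<integral>x. indicator A x * f x \<partial>lborel)\<bar>
    \<le> measure lborel B - measure lborel A"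
proof -
  have fA: "emeasure lborel A < \<infinity>"
    using emeasure_mono[of A B lborel] assms by (auto simp: order_le_less_trans)
  have int: "integrable lborel (indicator C :: _ \<Rightarrow> real)"
    "integrable lborel (\<lambda>x. indicator C x * f x)"
    if "C \<in> sets borel" "emeasure lborel C < \<infinity>" for C :: "'a set"
  proof -
    show 1: "integrable lborel (indicator C :: _ \<Rightarrow> real)" using that by (intro integrable_real_indicator) auto
    show "integrable lborel (\<lambda>x. indicator C x * f x)"
      by (rule Bochner_Integration.integrable_bound[OF 1]) (use that f in \<open>auto simp: indicator_def\<close>)
  qed
  have "\<bar>(\<integral>x. indicator B x * f x \<partial>lborel) - (\<integral>x. indicator A x * f x \<partial>lborel)\<bar> =
    \<bar>\<integral>x. indicator B x * f x - indicator A x * f x \<partial>lborel\<bar>"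
    using assms fA int by simp
  also have "\<dots> \<le> (\<integral>x. \<bar>indicator B x * f x - indicator A x * f x\<bar> \<partial>lborel)"
    by (rule integral_abs_bound)
  also have "\<dots> \<le> (\<integral>x. indicator B x - indicator A x \<partial>lborel)"
    by (intro integral_mono integrable_abs Bochner_Integration.integrable_diff int)
       (use assms fA in \<open>auto simp: indicator_def\<close>)
  also have "\<dots> = measure lborel B - measure lborel A"
    using assms fA int by (subst Bochner_Integration.integral_diff) auto
  finally show ?thesis .
qed

lemma open_inner_compact:
  fixes U :: "'a::euclidean_space set"
  assumes U: "open U" and fin: "emeasure lborel U < \<infinity>" and "e > 0"
  obtains K where "compact K" "K \<subseteq> U" "measure lborel U - measure lborel K < e"
proof -
  obtain C where C: "\<And>n::nat. compact (C n)" "\<And>n. C n \<subseteq> U"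
      "\<And>n. C n \<subseteq> interior (C (Suc n))" "\<Union>(range C) = U"
    by (rule open_Union_compact_subsets[OF U]) blast
  have inc: "incseq C"
    using C(3) interior_subset by (intro incseq_SucI) blast
  have "(\<lambda>n. measure lborel (C n)) \<longlonglongrightarrow> measure lborel (\<Union>n. C n)"
    using inc C fin by (intro Lim_measure_incseq) (auto simp: compact_imp_closed)
  then have "eventually (\<lambda>n. dist (measure lborel (C n)) (measure lborel U) < e) sequentially"
    using C(4) \<open>e > 0\<close> by (auto dest: tendstoD)
  then obtain n where "dist (measure lborel (C n)) (measure lborel U) < e"
    by (auto simp: eventually_sequentially)
  then show ?thesis using C by (intro that[of "C n"]) (auto simp: dist_real_def)
qed

text \<open>
  Translation by \<open>h = \<pi> \<xi> / \<bar>\<xi>\<bar>\<^sup>2\<close> reverses the sign of the cosine. A large compact subset \<open>K\<close> of \<open>U\<close> and its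
  translate by the short vector \<open>h\<close> both fill \<open>U\<close> up to a small set, so the integral over \<open>U\<close> nearly
  equals its own negative.
\<close>

lemma Riemann_Lebesgue_open:
  fixes U :: "'a::euclidean_space set" and \<xi> :: "nat \<Rightarrow> 'a"
  assumes U: "open U" and fin: "emeasure lborel U < \<infinity>"
    and \<xi>: "filterlim \<xi> at_infinity sequentially"
  shows "(\<lambda>n. \<integral>x. indicator U x * cos (\<xi> n \<bullet> x + \<theta>) \<partial>lborel) \<longlonglongrightarrow> 0"
proof (rule LIMSEQ_I)
  fix e :: real assume "e > 0"
  then obtain K where K: "compact K" "K \<subseteq> U" and small: "measure lborel U - measure lborel K < e / 2"
    using open_inner_compact[OF U fin, of "e / 2"] by auto
  have [measurable]: "U \<in> sets borel" "K \<in> sets borel"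
    using U K by (auto simp: compact_imp_closed)
  have finK: "emeasure lborel K < \<infinity>"
    using emeasure_mono[OF K(2), of lborel] fin by (auto simp: order_le_less_trans)
  obtain d where d: "d > 0" "\<And>x y. x \<in> K \<Longrightarrow> y \<in> - U \<Longrightarrow> d \<le> dist x y"
  proof -
    have "\<exists>d>0. \<forall>x\<in>K. \<forall>y\<in>- U. d \<le> dist x y"
      by (rule separate_compact_closed) (use K U in auto)
    then show thesis using that by blast
  qed
  \<comment> \<open>Frequencies above \<open>\<pi> / d\<close> make the translation vector shorter than \<open>d\<close>.\<close>
  have "\<forall>r>0. eventually (\<lambda>n. r \<le> norm (\<xi> n)) sequentially"
    using \<xi> by (subst (asm) filterlim_at_infinity[of 0]) auto
  moreover have "pi / d + 1 > 0" using d by (intro add_pos_pos) auto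
  ultimately have "eventually (\<lambda>n. pi / d + 1 \<le> norm (\<xi> n)) sequentially" by blast
  then obtain N where N: "\<And>n. n \<ge> N \<Longrightarrow> pi / d + 1 \<le> norm (\<xi> n)"
    by (auto simp: eventually_sequentially)
  show "\<exists>N. \<forall>n\<ge>N. norm ((\<integral>x. indicator U x * cos (\<xi> n \<bullet> x + \<theta>) \<partial>lborel) - 0) < e"
  proof (intro exI allI impI)
    fix n assume "n \<ge> N"
    define f where "f x = cos (\<xi> n \<bullet> x + \<theta>)" for x
    have [measurable]: "f \<in> borel_measurable borel"
      unfolding f_def by (intro borel_measurable_continuous_onI continuous_intros)
    have f1: "\<bar>f x\<bar> \<le> 1" for x by (simp add: f_def)
    have big: "norm (\<xi> n) > pi / d" using N[OF \<open>n \<ge> N\<close>] by simp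
    moreover have "pi / d > 0" using d by simp
    ultimately have pos: "norm (\<xi> n) > 0" by linarith
    define h where "h = (pi / (norm (\<xi> n))\<^sup>2) *\<^sub>R \<xi> n"
    have "norm h = pi / norm (\<xi> n)" using pos by (simp add: h_def power2_eq_square)
    also have "\<dots> < d" using big pos d by (simp add: field_simps)
    finally have hd: "norm h < d" .
    have "\<xi> n \<bullet> h = pi" using pos by (simp add: h_def dot_square_norm)
    then have fh: "f (- h + x) = - f x" for x
      by (simp add: f_def inner_add_right inner_diff_right cos_diff add.commute[of _ \<theta>] algebra_simps)
    have KU: "x \<in> U" if "- h + x \<in> K" for x
    proof (rule ccontr)
      assume "x \<notin> U"
      then have "d \<le> dist (- h + x) x" using that by (intro d(2)) auto
      then show False using hd by (simp add: dist_norm)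
    qed
    have int: "integrable lborel (\<lambda>x. indicator K x :: real)" "integrable lborel (\<lambda>x. indicator U x :: real)"
      using fin finK by (auto intro!: integrable_real_indicator)
    define K' where "K' = {x. - h + x \<in> K}"
    have [measurable]: "K' \<in> sets borel" unfolding K'_def by measurable
    have indK': "indicator K' x = (indicator K (- h + x) :: real)" for x
      by (simp add: K'_def indicator_def)
    have "K' \<subseteq> U" using KU by (auto simp: K'_def)
    then have finK': "emeasure lborel K' < \<infinity>"
      using emeasure_mono[of K' U lborel] fin by (auto simp: order_le_less_trans)
    have mK': "measure lborel K' = measure lborel K"
    proof -
      have "measure lborel K' = (\<integral>x. indicator K (- h + x) \<partial>lborel)"
        unfolding indK'[symmetric] using finK' by simp
      also have "\<dots> = (\<integral>x. indicator K x \<partial>lborel)" by (rule lborel_integral_translation) simp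
      finally show ?thesis using finK by simp
    qed
    let ?I = "\<lambda>A. \<integral>x. indicator A x * f x \<partial>lborel"
    have "?I K = (\<integral>x. indicator K (- h + x) * f (- h + x) \<partial>lborel)"
      by (rule lborel_integral_translation[symmetric]) simp
    also have "\<dots> = - ?I K'" unfolding fh indK'[symmetric] by simp
    finally have "?I K = - ?I K'" .
    moreover have "\<bar>?I U - ?I K\<bar> \<le> measure lborel U - measure lborel K"
      by (rule integral_indicator_approx) (use K fin f1 in auto)
    moreover have "\<bar>?I U - ?I K'\<bar> \<le> measure lborel U - measure lborel K"
      unfolding mK'[symmetric]
      by (rule integral_indicator_approx) (use \<open>K' \<subseteq> U\<close> fin f1 in auto)
    ultimately have "\<bar>?I U\<bar> < e" using small by linarith
    then show "norm ((\<integral>x. indicator U x * cos (\<xi> n \<bullet> x + \<theta>) \<partial>lborel) - 0) < e"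
      by (simp add: f_def)
  qed
qed

text \<open>
  The condition on \<open>R\<close> enters here: the frequency vectors \<open>2 \<pi> R\<^sup>T k / \<eta>\<close> tend to infinity for every
  \<open>k \<noteq> 0\<close>.
\<close>

lemma trig_equidistribution:
  fixes R :: "real ^ 'n ^ 'm"
  assumes R: "\<And>k :: int ^ 'm. k \<noteq> 0 \<Longrightarrow> transpose R *v int_vec k \<noteq> 0"
    and \<eta>: "\<And>n. \<eta> n > 0" "\<eta> \<longlonglongrightarrow> 0"
    and U: "open U" "emeasure lborel U < \<infinity>"
  shows "(\<lambda>n. \<integral>x. indicator U x * trig k j ((R *v x) /\<^sub>R \<eta> n) \<partial>lborel)
    \<longlonglongrightarrow> measure lborel U * (\<integral>y. trig k j y \<partial>lebesgue_on unit_cell)"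
proof (cases "k = 0")
  case True
  have "measure (lebesgue_on unit_cell) (unit_cell :: (real ^ 'm) set) = 1"
    using unit_cell_facts[where 'm='m] by (simp add: emeasure_restrict_space measure_def)
  then have "(\<integral>y. trig k j y \<partial>lebesgue_on unit_cell) = cos (of_int j * (pi / 2))"
    using True by (simp add: trig_def int_vec_simps space_restrict_space)
  moreover have "(\<integral>x. indicator U x * trig k j ((R *v x) /\<^sub>R \<eta> n) \<partial>lborel) = measure lborel U * cos (of_int j * (pi / 2))" for n
    using True U by (simp add: trig_def int_vec_simps)
  ultimately show ?thesis by simp
next
  case False
  define w where "w = transpose R *v int_vec k"
  have w: "w \<noteq> 0" using R[OF False] by (simp add: w_def)
  define \<xi> where "\<xi> n = (2 * pi / \<eta> n) *\<^sub>R w" for n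
  have eq: "trig k j ((R *v x) /\<^sub>R \<eta> n) = cos (\<xi> n \<bullet> x + of_int j * (pi / 2))" for x n
  proof -
    have "int_vec k \<bullet> (R *v x) = w \<bullet> x"
      by (simp add: w_def transpose_matrix_vector dot_lmul_matrix)
    then show ?thesis by (simp add: trig_def \<xi>_def field_simps)
  qed
  have "filterlim (\<lambda>n. inverse (\<eta> n)) at_top sequentially"
    using \<eta> by (intro filterlim_inverse_at_top) auto
  then have "filterlim (\<lambda>n. (2 * pi * norm w) * inverse (\<eta> n)) at_top sequentially"
    using w by (intro filterlim_tendsto_pos_mult_at_top[OF tendsto_const]) auto
  moreover have "norm (\<xi> n) = (2 * pi * norm w) * inverse (\<eta> n)" for n
    using \<eta>(1)[of n] by (simp add: \<xi>_def field_simps)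
  ultimately have "filterlim \<xi> at_infinity sequentially"
    by (intro filterlim_norm_at_top_imp_at_infinity) simp
  from Riemann_Lebesgue_open[OF U this, of "of_int j * (pi / 2)"]
  show ?thesis unfolding eq trig_mean[OF False] by simp
qed

section \<open>Smooth functions and the fundamental lemma of the calculus of variations\<close>

lemma C_k_SucI:
  fixes f :: "'a::euclidean_space \<Rightarrow> real"
  assumes "\<And>x. (f has_derivative f' x) (at x)" "\<And>b. b \<in> Basis \<Longrightarrow> C_k k (\<lambda>x. f' x b)"
  shows "C_k (Suc k) f"
proof -
  have "frechet_derivative f (at x) = f' x" for x
    using frechet_derivative_at[OF assms(1)] by simp
  then show ?thesis using assms by (auto simp: differentiable_def)
qed

lemma C_k_has_derivative:
  assumes "C_k (Suc k) f"
  shows "(f has_derivative frechet_derivative f (at x)) (at x)"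
  using assms frechet_derivative_works by auto

lemma C_k_SucD: "C_k (Suc k) f \<Longrightarrow> C_k k f"
proof (induction k arbitrary: f)
  case 0
  then show ?case
    by (auto intro!: differentiable_imp_continuous_on simp: differentiable_on_def differentiable_at_withinI)
next
  case (Suc k)
  then show ?case using C_k.simps(2) by blast
qed

lemma C_k_const: "C_k k (\<lambda>_. c)"
  by (induction k arbitrary: c) (auto intro!: C_k_SucI[where f'="\<lambda>_ _. 0"] simp del: C_k.simps(2))

lemma C_k_add: "C_k k f \<Longrightarrow> C_k k g \<Longrightarrow> C_k k (\<lambda>x. f x + g x)"
proof (induction k arbitrary: f g)
  case (Suc k)
  show ?case
  proof (rule C_k_SucI)
    show "((\<lambda>x. f x + g x) has_derivative
        (\<lambda>b. frechet_derivative f (at x) b + frechet_derivative g (at x) b)) (at x)" for x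
      by (intro has_derivative_add C_k_has_derivative[OF Suc.prems(1)] C_k_has_derivative[OF Suc.prems(2)])
  qed (use Suc in auto)
qed (auto intro: continuous_intros)

lemma C_k_mult: "C_k k f \<Longrightarrow> C_k k g \<Longrightarrow> C_k k (\<lambda>x. f x * g x)"
proof (induction k arbitrary: f g)
  case (Suc k)
  show ?case
  proof (rule C_k_SucI)
    show "((\<lambda>x. f x * g x) has_derivative
        (\<lambda>b. f x * frechet_derivative g (at x) b + frechet_derivative f (at x) b * g x)) (at x)" for x
      by (intro has_derivative_mult C_k_has_derivative[OF Suc.prems(1)] C_k_has_derivative[OF Suc.prems(2)])
    fix b :: 'a assume "b \<in> Basis"
    then show "C_k k (\<lambda>x. f x * frechet_derivative g (at x) b + frechet_derivative f (at x) b * g x)"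
      using Suc C_k_SucD[OF Suc.prems(1)] C_k_SucD[OF Suc.prems(2)] by (intro C_k_add Suc.IH) auto
  qed
qed (auto intro: continuous_intros)

lemma C_k_cmult: "C_k k f \<Longrightarrow> C_k k (\<lambda>x. c * f x)"
  by (rule C_k_mult[OF C_k_const])

lemma C_k_diff: "C_k k f \<Longrightarrow> C_k k g \<Longrightarrow> C_k k (\<lambda>x. f x - g x)"
  using C_k_add[of k f "\<lambda>x. -1 * g x"] C_k_cmult[of k g "-1"] by simp

lemma C_k_sum: "(\<And>i. i \<in> I \<Longrightarrow> C_k k (f i)) \<Longrightarrow> C_k k (\<lambda>x. \<Sum>i\<in>I. f i x)"
  by (induction I rule: infinite_finite_induct) (auto intro: C_k_const C_k_add)

lemma C_k_prod: "(\<And>i. i \<in> I \<Longrightarrow> C_k k (f i)) \<Longrightarrow> C_k k (\<lambda>x. \<Prod>i\<in>I. f i x)"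
  by (induction I rule: infinite_finite_induct) (auto intro: C_k_const C_k_mult)

lemma C_k_linear_compose:
  fixes f :: "'b::euclidean_space \<Rightarrow> real" and L :: "'a::euclidean_space \<Rightarrow> 'b"
  assumes L: "bounded_linear L"
  shows "C_k k f \<Longrightarrow> C_k k (\<lambda>x. f (L x))"
proof (induction k arbitrary: f)
  case 0
  then show ?case
    by (auto intro!: continuous_on_compose2[OF _ linear_continuous_on[OF L]])
next
  case (Suc k)
  show ?case
  proof (rule C_k_SucI)
    show "((\<lambda>x. f (L x)) has_derivative (\<lambda>b. frechet_derivative f (at (L x)) (L b))) (at x)" for x
      by (rule has_derivative_compose[OF bounded_linear_imp_has_derivative[OF L] C_k_has_derivative[OF Suc.prems]])
    fix b :: 'a assume "b \<in> Basis"
    have "frechet_derivative f (at (L x)) (L b) =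
        (\<Sum>i\<in>Basis. (L b \<bullet> i) * frechet_derivative f (at (L x)) i)" for x
    proof -
      have lin: "linear (frechet_derivative f (at (L x)))"
        using C_k_has_derivative[OF Suc.prems] by (rule has_derivative_linear)
      have "frechet_derivative f (at (L x)) (L b) = frechet_derivative f (at (L x)) (\<Sum>i\<in>Basis. (L b \<bullet> i) *\<^sub>R i)"
        by (simp add: euclidean_representation)
      also have "\<dots> = (\<Sum>i\<in>Basis. (L b \<bullet> i) * frechet_derivative f (at (L x)) i)"
        by (simp add: linear_sum[OF lin] linear_scale[OF lin])
      finally show ?thesis .
    qed
    then show "C_k k (\<lambda>x. frechet_derivative f (at (L x)) (L b))"
      using Suc by (auto intro!: C_k_sum C_k_cmult Suc.IH)
  qed
qed

text \<open>
  The smooth function \<open>exp (- c / t)\<close>, extended by \<open>0\<close>, has derivatives in the span of this family;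
  the powers of \<open>t\<close> are there to make the span closed under differentiation.
\<close>

definition flat :: "real \<Rightarrow> nat \<Rightarrow> real \<Rightarrow> real" where
  "flat c j t = (if t > 0 then exp (- c / t) / t ^ j else 0)"

lemma flat_tendsto_0:
  assumes "c > 0"
  shows "(flat c j \<longlongrightarrow> 0) (at_right 0)"
proof -
  have 1: "filterlim (\<lambda>t. c * inverse t) at_top (at_right (0::real))"
    using assms by (intro filterlim_tendsto_pos_mult_at_top[OF tendsto_const _ filterlim_inverse_at_top_right])
  have "((\<lambda>t. (c * inverse t) ^ j / exp (c * inverse t) / c ^ j) \<longlongrightarrow> 0 / c ^ j) (at_right 0)"
    using assms by (intro tendsto_divide filterlim_compose[OF tendsto_power_div_exp_0 1] tendsto_const) auto
  then have 2: "((\<lambda>t. (c * inverse t) ^ j / exp (c * inverse t) / c ^ j) \<longlongrightarrow> 0) (at_right 0)" by simp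
  have "eventually (\<lambda>t. flat c j t = (c * inverse t) ^ j / exp (c * inverse t) / c ^ j) (at_right 0)"
    using eventually_at_right_less[of 0] by eventually_elim
      (use assms in \<open>simp add: flat_def power_mult_distrib exp_minus field_simps\<close>)
  then show ?thesis using 2 by (simp add: filterlim_cong)
qed

lemma flat_has_derivative:
  assumes "c > 0"
  shows "(flat c j has_real_derivative (- real j * flat c (j + 1) t + c * flat c (j + 2) t)) (at t)"
proof -
  consider "t > 0" | "t < 0" | "t = 0" by linarith
  then show ?thesis
  proof cases
    case 1
    have "((\<lambda>t. exp (- c / t) / t ^ j) has_real_derivative
        (- real j * flat c (j + 1) t + c * flat c (j + 2) t)) (at t)"
      using 1
      by (auto intro!: derivative_eq_intros simp: flat_def field_simps power2_eq_square)
         (cases j; simp add: field_simps)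
    then show ?thesis
      by (rule DERIV_cong_ev[THEN iffD1, rotated -1])
         (use 1 eventually_nhds_in_open[of "{0<..}" t] in \<open>auto simp: flat_def elim!: eventually_mono\<close>)
  next
    case 2
    have "((\<lambda>t. 0) has_real_derivative 0) (at t)" by simp
    then have "(flat c j has_real_derivative 0) (at t)"
      by (rule DERIV_cong_ev[THEN iffD1, rotated -1])
         (use 2 eventually_nhds_in_open[of "{..<0}" t] in \<open>auto simp: flat_def elim!: eventually_mono\<close>)
    then show ?thesis using 2 by (simp add: flat_def)
  next
    case 3
    have "((\<lambda>h. flat c j h / h) \<longlongrightarrow> 0) (at 0)"
    proof (rule filterlim_split_at)
      have "eventually (\<lambda>h. flat c j h / h = 0) (at_left 0)"
        by (auto simp: eventually_at_filter flat_def)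
      then show "((\<lambda>h. flat c j h / h) \<longlongrightarrow> 0) (at_left 0)" by (rule tendsto_eventually)
      have "eventually (\<lambda>h. flat c (j + 1) h = flat c j h / h) (at_right 0)"
        using eventually_at_right_less[of 0] by eventually_elim (simp add: flat_def)
      then show "((\<lambda>h. flat c j h / h) \<longlongrightarrow> 0) (at_right 0)"
        using flat_tendsto_0[OF assms, of "j + 1"] by (simp add: filterlim_cong)
    qed
    then show ?thesis using 3 by (simp add: DERIV_def flat_def)
  qed
qed

lemma C_k_flat:
  fixes v :: "'a::euclidean_space"
  assumes "c > 0"
  shows "C_k k (\<lambda>x. flat c j (v \<bullet> x + s))"
proof (induction k arbitrary: j)
  case 0
  have "continuous_on UNIV (flat c j)"
    using DERIV_isCont[OF flat_has_derivative[OF assms]] by (simp add: continuous_at_imp_continuous_on)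
  then show ?case by (auto intro!: continuous_on_compose2[of UNIV "flat c j"] continuous_intros)
next
  case (Suc k)
  show ?case
  proof (rule C_k_SucI)
    fix x :: 'a
    have "((\<lambda>x. v \<bullet> x + s) has_derivative (\<lambda>h. v \<bullet> h)) (at x)"
      by (auto intro!: derivative_eq_intros)
    from has_derivative_compose[OF this flat_has_derivative[OF assms, of j "v \<bullet> x + s", unfolded has_field_derivative_def]]
    show "((\<lambda>x. flat c j (v \<bullet> x + s)) has_derivative
        (\<lambda>h. (- real j * flat c (j + 1) (v \<bullet> x + s) + c * flat c (j + 2) (v \<bullet> x + s)) * (v \<bullet> h))) (at x)"
      by simp
  next
    fix b :: 'a
    have "C_k k (\<lambda>x. (v \<bullet> b) * (- real j * flat c (j + 1) (v \<bullet> x + s) + c * flat c (j + 2) (v \<bullet> x + s)))"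
      by (intro C_k_cmult C_k_add Suc)
    then show "C_k k (\<lambda>x. (- real j * flat c (j + 1) (v \<bullet> x + s) + c * flat c (j + 2) (v \<bullet> x + s)) * (v \<bullet> b))"
      by (simp add: mult.commute)
  qed
qed

text \<open>
  Smooth and positive exactly on the open box; it tends to the indicator of the box as \<open>c \<longrightarrow> 0\<close>,
  because \<open>exp (- c / t) \<longrightarrow> 1\<close> for every \<open>t > 0\<close>.
\<close>

definition box_bump :: "real \<Rightarrow> 'a::euclidean_space \<Rightarrow> 'a \<Rightarrow> 'a \<Rightarrow> real" where
  "box_bump c a b x = (\<Prod>i\<in>Basis. flat c 0 (i \<bullet> x + - (a \<bullet> i)) * flat c 0 (- i \<bullet> x + b \<bullet> i))"

lemma box_bump_C_infinity: "c > 0 \<Longrightarrow> C_infinity (box_bump c a b)"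
  unfolding C_infinity_def box_bump_def by (intro allI C_k_prod C_k_mult C_k_flat)

lemma flat_0_bounds: "c > 0 \<Longrightarrow> 0 \<le> flat c 0 t" "c > 0 \<Longrightarrow> flat c 0 t \<le> 1"
  by (auto simp: flat_def)

lemma box_bump_bounds: "c > 0 \<Longrightarrow> 0 \<le> box_bump c a b x" "c > 0 \<Longrightarrow> box_bump c a b x \<le> 1"
  unfolding box_bump_def
  by (auto intro!: prod_nonneg prod_le_1 mult_nonneg_nonneg mult_le_one simp: flat_0_bounds)

lemma box_bump_outside: "x \<notin> box a b \<Longrightarrow> box_bump c a b x = 0"
  by (force simp: box_bump_def mem_box flat_def inner_commute not_less)

lemma box_bump_tendsto_indicator:
  "(\<lambda>n. box_bump (1 / real (Suc n)) a b x) \<longlonglongrightarrow> indicator (box a b) x"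
proof (cases "x \<in> box a b")
  case True
  have lim: "(\<lambda>n. flat (1 / real (Suc n)) 0 t) \<longlonglongrightarrow> 1" if "t > 0" for t
  proof -
    have "(\<lambda>n. exp (- (1 / real (Suc n)) / t)) \<longlonglongrightarrow> exp (- 0 / t)"
      by (intro tendsto_exp tendsto_divide tendsto_minus LIMSEQ_Suc[OF lim_1_over_n] tendsto_const)
         (use that in auto)
    then show ?thesis using that by (simp add: flat_def)
  qed
  have "(\<lambda>n. box_bump (1 / real (Suc n)) a b x) \<longlonglongrightarrow> (\<Prod>i\<in>(Basis::'a set). 1 * 1)"
    unfolding box_bump_def
    by (intro tendsto_prod tendsto_mult lim) (use True in \<open>auto simp: mem_box inner_commute\<close>)
  then show ?thesis using True by simp
qed (simp add: box_bump_outside)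

definition rational_points :: "'a::euclidean_space set" where
  "rational_points = {a. \<forall>i\<in>Basis. a \<bullet> i \<in> \<rat>}"

definition inner_boxes :: "'a::euclidean_space set \<Rightarrow> ('a \<times> 'a) set" where
  "inner_boxes \<Omega> = {(a, b). a \<in> rational_points \<and> b \<in> rational_points \<and> cbox a b \<subseteq> \<Omega>}"

text \<open>
  A countable family of open sets that approximates every measurable subset of \<open>\<Omega>\<close>. The closed boxes
  are required to lie in \<open>\<Omega>\<close>, so that the bump functions of the boxes have compact support in \<open>\<Omega>\<close>.
\<close>

definition box_unions :: "'a::euclidean_space set \<Rightarrow> 'a set set" where
  "box_unions \<Omega> = (\<lambda>P. \<Union>(a, b)\<in>P. box a b) ` {P. finite P \<and> P \<subseteq> inner_boxes \<Omega>}"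

lemma countable_inner_boxes: "countable (inner_boxes \<Omega>)"
proof -
  have "(rational_points :: 'a set) \<subseteq> (\<lambda>f. \<Sum>i\<in>Basis. f i *\<^sub>R i) ` (Basis \<rightarrow>\<^sub>E \<rat>)"
  proof
    fix a :: 'a assume "a \<in> rational_points"
    then show "a \<in> (\<lambda>f. \<Sum>i\<in>Basis. f i *\<^sub>R i) ` (Basis \<rightarrow>\<^sub>E \<rat>)"
      by (intro image_eqI[of _ _ "restrict (\<lambda>i. a \<bullet> i) Basis"])
         (auto simp: rational_points_def euclidean_representation)
  qed
  moreover have "countable ((\<lambda>f. \<Sum>i\<in>Basis. f i *\<^sub>R i) ` (Basis \<rightarrow>\<^sub>E \<rat>) :: 'a set)"
    by (intro countable_image countable_PiE) (auto simp: countable_rat)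
  ultimately have "countable (rational_points :: 'a set)" by (rule countable_subset)
  then have "countable (rational_points \<times> rational_points :: ('a \<times> 'a) set)" by (intro countable_SIGMA)
  then show ?thesis by (rule countable_subset[rotated]) (auto simp: inner_boxes_def)
qed

lemma countable_box_unions: "countable (box_unions \<Omega>)"
  unfolding box_unions_def
  by (intro countable_image countable_Collect_finite_subset countable_inner_boxes)

lemma box_unions_open: "U \<in> box_unions \<Omega> \<Longrightarrow> open U"
  by (auto simp: box_unions_def intro!: open_UN open_box)

lemma box_unions_subset: "U \<in> box_unions \<Omega> \<Longrightarrow> U \<subseteq> \<Omega>"
  using box_subset_cbox by (fastforce simp: box_unions_def inner_boxes_def)

lemma Union_inner_boxes:
  assumes "open T"
  shows "(\<Union>(a, b)\<in>inner_boxes T. box a b) = T"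
proof -
  have "\<exists>(a, b)\<in>inner_boxes T. x \<in> box a b" if x: "x \<in> T" for x
  proof -
    obtain e where e: "e > 0" "ball x e \<subseteq> T" using assms x openE by blast
    obtain a b where ab: "\<forall>i\<in>Basis. a \<bullet> i \<in> \<rat> \<and> b \<bullet> i \<in> \<rat>" "x \<in> box a b" "box a b \<subseteq> ball x (e / 2)"
      using rational_boxes[of "e / 2" x] e by auto
    have "cbox a b = closure (box a b)" using ab by (intro closure_box[symmetric]) auto
    also have "\<dots> \<subseteq> closure (ball x (e / 2))" by (rule closure_mono[OF ab(3)])
    also have "\<dots> \<subseteq> ball x e" using e by auto
    finally show ?thesis
      using ab e by (intro bexI[of _ "(a, b)"]) (auto simp: inner_boxes_def rational_points_def)
  qed
  moreover have "box a b \<subseteq> T" if "(a, b) \<in> inner_boxes T" for a b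
    using that box_subset_cbox by (fastforce simp: inner_boxes_def)
  ultimately show ?thesis by fastforce
qed

text \<open>
  By outer regularity \<open>A\<close> nearly fills an open set \<open>T \<subseteq> \<Omega>\<close>, and \<open>T\<close> is an increasing union of finite
  unions of its rational boxes.
\<close>

lemma box_unions_approx:
  fixes \<Omega> :: "'a::euclidean_space set"
  assumes \<Omega>: "open \<Omega>" "bounded \<Omega>" and A: "A \<in> sets (lebesgue_on \<Omega>)" and "e > 0"
  obtains U where "U \<in> box_unions \<Omega>"
    "(\<integral>x. \<bar>indicator A x - indicator U x\<bar> \<partial>lebesgue_on \<Omega>) < (e::real)"
proof -
  let ?M = "lebesgue_on \<Omega>"
  have \<Omega>leb: "\<Omega> \<in> lmeasurable" using \<Omega> by (intro lmeasurable_open)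
  then have \<Omega>s: "\<Omega> \<in> sets lebesgue" by auto
  interpret finite_measure ?M by (rule finite_measure_lebesgue_on[OF \<Omega>leb])
  have A': "A \<in> sets lebesgue" "A \<subseteq> \<Omega>" using A \<Omega>s by (auto simp: sets_restrict_space_iff)
  obtain T0 where T0: "open T0" "A \<subseteq> T0" "T0 - A \<in> lmeasurable" "emeasure lebesgue (T0 - A) < ennreal (e / 2)"
    by (rule sets_lebesgue_outer_open[OF A'(1) half_gt_zero[OF \<open>e > 0\<close>]])
  define T where "T = T0 \<inter> \<Omega>"
  have T: "open T" "A \<subseteq> T" "T \<subseteq> \<Omega>"
    using open_Int[OF T0(1) \<Omega>(1)] T0(2) A'(2) by (auto simp only: T_def)
  have sM: "S \<in> sets ?M" if "S \<in> sets lebesgue" "S \<subseteq> \<Omega>" for S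
    using that \<Omega>s by (simp add: sets_restrict_space_iff)
  have TA: "T - A \<in> sets ?M" using T A' by (intro sM) auto
  have "emeasure ?M (T - A) = emeasure lebesgue (T - A)"
    using T \<Omega>s by (intro emeasure_restrict_space) auto
  also have "\<dots> \<le> emeasure lebesgue (T0 - A)"
    using T0 A' by (intro emeasure_mono) (auto simp: T_def)
  also have "\<dots> < ennreal (e / 2)" by fact
  finally have mTA: "measure ?M (T - A) < e / 2"
    using \<open>e > 0\<close> by (simp add: emeasure_eq_measure ennreal_less_iff)
  define P where "P = from_nat_into (inner_boxes T)"
  \<comment> \<open>The empty box makes the family nonempty, hence enumerable, even for empty \<open>T\<close>.\<close>
  have ne: "inner_boxes T \<noteq> {}"
  proof -
    have "cbox One 0 = ({} :: 'a set)"
      using nonempty_Basis by (fastforce simp: mem_box)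
    then have "(One, 0) \<in> inner_boxes T"
      by (auto simp: inner_boxes_def rational_points_def)
    then show ?thesis by auto
  qed
  define U where "U n = (\<Union>(a, b)\<in>P ` {..<n}. box a b)" for n :: nat
  have PT: "P n \<in> inner_boxes T" for n unfolding P_def by (rule from_nat_into[OF ne])
  have inner_mono: "inner_boxes T \<subseteq> inner_boxes \<Omega>" using T by (auto simp: inner_boxes_def)
  have U\<Omega>: "U n \<in> box_unions \<Omega>" for n
    unfolding box_unions_def U_def using PT inner_mono by (intro image_eqI[OF refl]) auto
  have "U n \<in> box_unions T" for n
    unfolding box_unions_def U_def using PT by (intro image_eqI[OF refl]) auto
  then have UT: "U n \<subseteq> T" for n by (rule box_unions_subset)
  have Uo: "open (U n)" for n using U\<Omega> by (rule box_unions_open)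
  have UM: "U n \<in> sets ?M" for n using UT[of n] T Uo by (intro sM) auto
  have "(\<Union>n. U n) = (\<Union>p\<in>(\<Union>n. P ` {..<n}). case p of (a, b) \<Rightarrow> box a b)"
    unfolding U_def by (simp only: UN_UN_flatten)
  also have "(\<Union>n. P ` {..<n}) = range P" by auto
  also have "(\<Union>(a, b)\<in>range P. box a b) = T"
    unfolding P_def range_from_nat_into[OF ne countable_inner_boxes] by (rule Union_inner_boxes[OF T(1)])
  finally have UnT: "(\<Union>n. U n) = T" .
  have "(\<lambda>n. measure ?M (U n)) \<longlonglongrightarrow> measure ?M (\<Union>n. U n)"
  proof (rule finite_Lim_measure_incseq)
    show "incseq U" unfolding incseq_def U_def by (intro allI impI UN_mono image_mono) auto
  qed (use UM in auto)
  then have "eventually (\<lambda>n. dist (measure ?M (U n)) (measure ?M T) < e / 2) sequentially"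
    using UnT \<open>e > 0\<close> by (auto dest!: tendstoD[of _ _ _ "e / 2"])
  then obtain n where n: "dist (measure ?M (U n)) (measure ?M T) < e / 2"
    by (auto simp: eventually_sequentially)
  have TM: "T \<in> sets ?M" using T by (intro sM) auto
  have TU: "measure ?M (T - U n) < e / 2"
    using n finite_measure_Diff[OF TM UM UT, of n] unfolding dist_real_def by linarith
  have int: "integrable ?M (indicator S :: _ \<Rightarrow> real)" if "S \<in> sets ?M" for S
    using that by (intro integrable_real_indicator) (auto simp: less_top[symmetric])
  have TUM: "T - U n \<in> sets ?M" using TM UM by auto
  have "(\<integral>x. \<bar>indicator A x - indicator (U n) x :: real\<bar> \<partial>?M) \<le>
      (\<integral>x. indicator (T - A) x + indicator (T - U n) x \<partial>?M)"
    using T(2) UT[of n]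
    by (intro integral_mono integrable_abs Bochner_Integration.integrable_diff Bochner_Integration.integrable_add int A UM TA TUM)
       (auto simp: indicator_def)
  also have "\<dots> = measure ?M (T - A) + measure ?M (T - U n)"
    using int[OF TA] int[OF TUM] sets.Int_space_eq2[OF TA] sets.Int_space_eq2[OF TUM]
    by (simp only: Bochner_Integration.integral_add Bochner_Integration.integral_indicator)
  also have "\<dots> < e" using TU mTA by simp
  finally show ?thesis using U\<Omega> that by blast
qed

text \<open>
  The function \<open>1 - \<Prod> (1 - \<beta>)\<close>, over the bump functions \<open>\<beta>\<close> of the boxes, is the smooth counterpart of
  the indicator of their union.
\<close>

lemma test_functions_approx_box_union:
  fixes \<Omega> :: "'a::euclidean_space set"
  assumes U: "U \<in> box_unions \<Omega>"
  obtains \<psi> where "\<And>n::nat. \<psi> n \<in> test_functions \<Omega>" "\<And>n x. \<bar>\<psi> n x\<bar> \<le> 1"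
    "\<And>x. (\<lambda>n. \<psi> n x) \<longlonglongrightarrow> indicator U x"
proof -
  obtain P where P: "finite P" "P \<subseteq> inner_boxes \<Omega>" "U = (\<Union>(a, b)\<in>P. box a b)"
    using U by (auto simp: box_unions_def)
  define \<psi> where "\<psi> n x = 1 - (\<Prod>p\<in>P. 1 - box_bump (1 / real (Suc n)) (fst p) (snd p) x)" for n x
  have bounds: "0 \<le> (\<Prod>p\<in>P. 1 - box_bump (1 / real (Suc n)) (fst p) (snd p) x)"
    "(\<Prod>p\<in>P. 1 - box_bump (1 / real (Suc n)) (fst p) (snd p) x) \<le> 1" for n x
    by (auto intro!: prod_nonneg prod_le_1 simp: box_bump_bounds)
  show ?thesis
  proof (rule that)
    fix n
    have "C_infinity (\<psi> n)"
      unfolding \<psi>_def C_infinity_def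
      using box_bump_C_infinity[of "1 / real (Suc n)"]
      by (intro allI C_k_diff C_k_const C_k_prod) (auto simp: C_infinity_def)
    moreover have "\<exists>K. compact K \<and> K \<subseteq> \<Omega> \<and> (\<forall>x. x \<notin> K \<longrightarrow> \<psi> n x = 0)"
    proof (intro exI conjI allI impI)
      show "compact (\<Union>p\<in>P. cbox (fst p) (snd p))" using P by (intro compact_UN) auto
      have "cbox (fst p) (snd p) \<subseteq> \<Omega>" if "p \<in> P" for p
        using subsetD[OF P(2) that] by (auto simp: inner_boxes_def)
      then show "(\<Union>p\<in>P. cbox (fst p) (snd p)) \<subseteq> \<Omega>" by blast
      fix x assume "x \<notin> (\<Union>p\<in>P. cbox (fst p) (snd p))"
      then have "x \<notin> box (fst p) (snd p)" if "p \<in> P" for p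
        using that box_subset_cbox by blast
      then show "\<psi> n x = 0" by (simp add: \<psi>_def box_bump_outside)
    qed
    ultimately show "\<psi> n \<in> test_functions \<Omega>" by (simp add: test_functions_def)
    show "\<bar>\<psi> n x\<bar> \<le> 1" for x using bounds[of n x] by (simp add: \<psi>_def)
  next
    fix x
    have "(\<lambda>n. \<psi> n x) \<longlonglongrightarrow> 1 - (\<Prod>p\<in>P. 1 - indicator (box (fst p) (snd p)) x)"
      unfolding \<psi>_def by (intro tendsto_intros box_bump_tendsto_indicator)
    also have "1 - (\<Prod>p\<in>P. 1 - indicator (box (fst p) (snd p)) x) = (indicator U x :: real)"
    proof (cases "x \<in> U")
      case True
      then obtain p where "p \<in> P" "x \<in> box (fst p) (snd p)" using P(3) by auto
      then have "(\<Prod>p\<in>P. 1 - indicator (box (fst p) (snd p)) x) = (0::real)"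
        using P(1) by (intro prod_zero bexI[of _ p]) auto
      then show ?thesis using True by simp
    next
      case False
      then have "x \<notin> box (fst p) (snd p)" if "p \<in> P" for p using P(3) that by auto
      then show ?thesis using False by simp
    qed
    finally show "(\<lambda>n. \<psi> n x) \<longlonglongrightarrow> indicator U x" .
  qed
qed

lemma test_functions_measurable:
  assumes "\<psi> \<in> test_functions \<Omega>"
  shows "\<psi> \<in> borel_measurable borel" "continuous_on UNIV \<psi>"
proof -
  have "C_k 0 \<psi>" using assms by (simp add: test_functions_def C_infinity_def)
  then show "continuous_on UNIV \<psi>" by simp
  then show "\<psi> \<in> borel_measurable borel" by (rule borel_measurable_continuous_onI)
qed

text \<open>
  Test functions converge boundedly to indicators of finite unions of boxes, and these
  approximate indicators of measurable sets, so \<open>G\<close> has integral \<open>0\<close> over every measurable set,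
  in particular over the sets where it is positive and where it is negative.
\<close>

lemma fundamental_lemma_calculus_of_variations:
  fixes \<Omega> :: "'a::euclidean_space set" and G :: "'a \<Rightarrow> real"
  assumes \<Omega>: "open \<Omega>" "bounded \<Omega>" and G: "integrable (lebesgue_on \<Omega>) G"
    and zero: "\<And>\<psi>. \<psi> \<in> test_functions \<Omega> \<Longrightarrow> (\<integral>x. \<psi> x * G x \<partial>lebesgue_on \<Omega>) = 0"
  shows "AE x in lebesgue_on \<Omega>. G x = 0"
proof -
  let ?M = "lebesgue_on \<Omega>"
  have \<Omega>leb: "\<Omega> \<in> lmeasurable" using \<Omega> by (intro lmeasurable_open)
  then have \<Omega>s: "\<Omega> \<in> sets lebesgue" by auto
  interpret finite_measure ?M by (rule finite_measure_lebesgue_on[OF \<Omega>leb])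
  have borelM: "f \<in> borel_measurable ?M" if "f \<in> borel_measurable borel" for f :: "'a \<Rightarrow> real"
    using that by (intro measurable_restrict_space1 measurable_completion) simp
  have [measurable]: "G \<in> borel_measurable ?M" using G by simp
  have boxU: "(\<integral>x. indicator U x * G x \<partial>?M) = 0" if U: "U \<in> box_unions \<Omega>" for U
  proof -
    obtain \<psi> where \<psi>: "\<And>n::nat. \<psi> n \<in> test_functions \<Omega>" "\<And>n x. \<bar>\<psi> n x\<bar> \<le> 1"
      "\<And>x. (\<lambda>n. \<psi> n x) \<longlonglongrightarrow> indicator U x"
      using test_functions_approx_box_union[OF U] by metis
    have Um: "indicator U \<in> borel_measurable (borel :: 'a measure)"
      using box_unions_open[OF U] by (intro borel_measurable_indicator) auto
    have "(\<lambda>n. \<integral>x. \<psi> n x * G x \<partial>?M) \<longlonglongrightarrow> (\<integral>x. indicator U x * G x \<partial>?M)"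
    proof (rule integral_dominated_convergence[where w="\<lambda>x. \<bar>G x\<bar>"])
      show "AE x in ?M. norm (\<psi> n x * G x) \<le> \<bar>G x\<bar>" for n
        using \<psi>(2) by (intro AE_I2) (auto simp: abs_mult intro!: mult_left_le_one_le)
      show "(\<lambda>x. indicator U x * G x) \<in> borel_measurable ?M"
        using borelM[OF Um] by measurable
      show "(\<lambda>x. \<psi> n x * G x) \<in> borel_measurable ?M" for n
        using borelM[OF test_functions_measurable(1)[OF \<psi>(1)[of n]]] by measurable
      show "AE x in ?M. (\<lambda>n. \<psi> n x * G x) \<longlonglongrightarrow> indicator U x * G x"
        by (intro AE_I2 tendsto_mult \<psi>(3) tendsto_const)
    qed (use G in auto)
    then show ?thesis using zero[OF \<psi>(1)] by (simp add: LIMSEQ_const_iff)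
  qed
  have setA: "(\<integral>x. indicator A x * G x \<partial>?M) = 0" if A: "A \<in> sets ?M" for A
  proof -
    have "\<exists>U\<in>box_unions \<Omega>. (\<integral>x. \<bar>indicator A x - indicator U x\<bar> \<partial>?M) < 1 / real (Suc n)" for n
      using box_unions_approx[OF \<Omega> A, of "1 / real (Suc n)"] by auto
    then obtain U where U: "\<And>n. U n \<in> box_unions \<Omega>"
      and Ulim: "\<And>n. (\<integral>x. \<bar>indicator A x - indicator (U n) x\<bar> \<partial>?M) < 1 / real (Suc n)" by metis
    have UM: "U n \<in> sets ?M" for n
      using box_unions_open[OF U, of n] box_unions_subset[OF U, of n] \<Omega>s
      by (simp add: sets_restrict_space_iff)
    note [measurable] = A UM
    have int: "integrable ?M (indicator S :: _ \<Rightarrow> real)" if "S \<in> sets ?M" for S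
      using that by (intro integrable_real_indicator) (auto simp: less_top[symmetric])
    have "(\<lambda>n. \<integral>x. norm (indicator A x - indicator (U n) x :: real) \<partial>?M) \<longlonglongrightarrow> 0"
    proof (rule Lim_null_comparison)
      show "\<forall>\<^sub>F n in sequentially. norm (\<integral>x. norm (indicator A x - indicator (U n) x :: real) \<partial>?M) \<le> 1 / real (Suc n)"
        using Ulim by (auto intro!: always_eventually simp: less_imp_le)
      show "(\<lambda>n. 1 / real (Suc n)) \<longlonglongrightarrow> 0" by (rule LIMSEQ_Suc[OF lim_1_over_n])
    qed
    from tendsto_L1_AE_subseq[OF _ this] int A UM
    obtain r :: "nat \<Rightarrow> nat" where r: "AE x in ?M. (\<lambda>n. indicator A x - indicator (U (r n)) x :: real) \<longlonglongrightarrow> 0"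
      by auto
    have "(\<lambda>n. \<integral>x. (indicator A x - indicator (U (r n)) x) * G x \<partial>?M) \<longlonglongrightarrow> (\<integral>x. 0 \<partial>?M)"
    proof (rule integral_dominated_convergence[where w="\<lambda>x. \<bar>G x\<bar>"])
      show "AE x in ?M. (\<lambda>n. (indicator A x - indicator (U (r n)) x) * G x) \<longlonglongrightarrow> 0"
        using r by eventually_elim (rule tendsto_mult_left_zero)
      show "AE x in ?M. norm ((indicator A x - indicator (U (r n)) x) * G x) \<le> \<bar>G x\<bar>" for n
        by (intro AE_I2) (auto simp: indicator_def)
    qed (use G in auto)
    moreover have "(\<integral>x. (indicator A x - indicator (U (r n)) x) * G x \<partial>?M) = (\<integral>x. indicator A x * G x \<partial>?M)" for n
    proof -
      have i: "integrable ?M (\<lambda>x. indicator S x * G x)" if [measurable]: "S \<in> sets ?M" for S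
        by (rule Bochner_Integration.integrable_bound[OF G]) (auto simp: indicator_def)
      show ?thesis using i[OF A] i[OF UM, of "r n"] boxU[OF U, of "r n"] by (simp add: left_diff_distrib)
    qed
    ultimately show ?thesis by (simp add: LIMSEQ_const_iff)
  qed
  \<comment> \<open>To be used with \<open>s = 1\<close> and \<open>s = -1\<close>, for the positive and the negative part of \<open>G\<close>.\<close>
  have "AE x in ?M. indicator {x\<in>space ?M. s * G x > 0} x * (s * G x) = 0" for s :: real
  proof (rule integral_nonneg_eq_0_iff_AE[THEN iffD1])
    show "integrable ?M (\<lambda>x. indicator {x\<in>space ?M. s * G x > 0} x * (s * G x))"
    proof (rule Bochner_Integration.integrable_bound[where f="\<lambda>x. s * G x"])
      show "(\<lambda>x. indicator {x\<in>space ?M. s * G x > 0} x * (s * G x)) \<in> borel_measurable ?M"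
        by measurable
    qed (use G in \<open>auto simp: indicator_def\<close>)
    have "(\<integral>x. indicator {x\<in>space ?M. s * G x > 0} x * (s * G x) \<partial>?M) =
        s * (\<integral>x. indicator {x\<in>space ?M. s * G x > 0} x * G x \<partial>?M)"
      by (subst integral_mult_right_zero[symmetric]) (simp add: mult_ac)
    moreover have "{x\<in>space ?M. s * G x > 0} \<in> sets ?M" by measurable
    ultimately show "(\<integral>x. indicator {x\<in>space ?M. s * G x > 0} x * (s * G x) \<partial>?M) = 0"
      by (simp only: setA mult_zero_right)
  qed (auto simp: indicator_def)
  from this[of 1] this[of "-1"] show ?thesis
    using AE_space by eventually_elim (auto simp: indicator_def split: if_splits)
qed

section \<open>Integration over the product with the cell\<close>

lemma lebesgue_on_borel:
  fixes f :: "'a::euclidean_space \<Rightarrow> real"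
  assumes S: "S \<in> sets borel" and f: "f \<in> borel_measurable borel"
  shows "integrable (lebesgue_on S) f \<longleftrightarrow> integrable lborel (\<lambda>x. indicator S x * f x)"
    and "(\<integral>x. f x \<partial>lebesgue_on S) = (\<integral>x. indicator S x * f x \<partial>lborel)"
proof -
  have S': "S \<inter> space lebesgue \<in> sets lebesgue" using S by simp
  have m: "(\<lambda>x. indicator S x *\<^sub>R f x) \<in> borel_measurable lborel" using S f by simp
  show "integrable (lebesgue_on S) f \<longleftrightarrow> integrable lborel (\<lambda>x. indicator S x * f x)"
    using integrable_completion[OF m] integrable_restrict_space[OF S', of f] by simp
  show "(\<integral>x. f x \<partial>lebesgue_on S) = (\<integral>x. indicator S x * f x \<partial>lborel)"
    using integral_completion[OF m] integral_restrict_space[OF S', of f] by simp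
qed

lemma AE_lebesgue_on:
  assumes S: "S \<in> sets lebesgue"
  shows "(AE x in lebesgue_on S. P x) \<longleftrightarrow> (AE x in lborel. x \<in> S \<longrightarrow> P x)"
  using S by (simp add: AE_restrict_space_iff AE_completion_iff)

lemma borel_Times_cell: "\<Omega> \<in> sets borel \<Longrightarrow> \<Omega> \<times> (unit_cell :: (real ^ 'm) set) \<in> sets borel"
  for \<Omega> :: "'a::euclidean_space set"
  unfolding borel_prod[symmetric] by (intro pair_measureI unit_cell_facts(2))

text \<open>
  The function is taken to be Borel, so that every section is measurable.
\<close>

lemma Fubini_cell:
  fixes g :: "'a::euclidean_space \<times> (real ^ 'm) \<Rightarrow> real"
  assumes \<Omega>: "\<Omega> \<in> sets borel" and g: "g \<in> borel_measurable borel"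
    and int: "integrable (lebesgue_on (\<Omega> \<times> unit_cell)) g"
  shows "AE x in lebesgue_on \<Omega>. integrable (lebesgue_on unit_cell) (\<lambda>y. g (x, y))"
    and "integrable (lebesgue_on \<Omega>) (\<lambda>x. \<integral>y. g (x, y) \<partial>lebesgue_on unit_cell)"
    and "(\<integral>z. g z \<partial>lebesgue_on (\<Omega> \<times> unit_cell)) =
      (\<integral>x. (\<integral>y. g (x, y) \<partial>lebesgue_on unit_cell) \<partial>lebesgue_on \<Omega>)"
proof -
  have S: "\<Omega> \<times> (unit_cell :: (real ^ 'm) set) \<in> sets borel" by (rule borel_Times_cell[OF \<Omega>])
  note Y = unit_cell_facts(2)[where 'm='m]
  have gx: "(\<lambda>y. g (x, y)) \<in> borel_measurable borel" for x
    by (rule measurable_compose[OF _ g]) (simp add: borel_prod[symmetric])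
  define g1 where "g1 z = indicator (\<Omega> \<times> unit_cell) z * g z" for z
  have g1: "g1 \<in> borel_measurable (lborel \<Otimes>\<^sub>M lborel)"
    unfolding g1_def using S g by (simp add: lborel_prod)
  have int1: "integrable (lborel \<Otimes>\<^sub>M lborel) g1"
    using int unfolding lborel_prod g1_def lebesgue_on_borel(1)[OF S g] .
  have sec: "g1 (x, y) = indicator \<Omega> x * (indicator unit_cell y * g (x, y))" for x y
    by (simp add: g1_def indicator_times)
  have inner: "(\<integral>y. g1 (x, y) \<partial>lborel) = indicator \<Omega> x * (\<integral>y. g (x, y) \<partial>lebesgue_on unit_cell)" for x
    by (simp add: sec lebesgue_on_borel(2)[OF Y gx])
  have meas: "(\<lambda>x. \<integral>y. g (x, y) \<partial>lebesgue_on unit_cell) \<in> borel_measurable borel"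
  proof -
    have "(\<lambda>x. \<integral>y. indicator unit_cell y * g (x, y) \<partial>lborel) \<in> borel_measurable lborel"
    proof (rule lborel.borel_measurable_lebesgue_integral)
      have [measurable]: "unit_cell \<in> sets (borel :: (real ^ 'm) measure)" by (rule Y)
      have [measurable]: "g \<in> borel_measurable (borel \<Otimes>\<^sub>M borel)" using g by (simp add: borel_prod)
      show "(\<lambda>(x, y). indicator unit_cell y * g (x, y)) \<in> borel_measurable (lborel \<Otimes>\<^sub>M lborel)"
        by measurable
    qed
    then show ?thesis by (simp add: lebesgue_on_borel(2)[OF Y gx])
  qed
  have "AE x in lborel. integrable lborel (\<lambda>y. g1 (x, y))"
    by (rule lborel_pair.AE_integrable_fst'[OF int1])
  then have "AE x in lborel. x \<in> \<Omega> \<longrightarrow> integrable (lebesgue_on unit_cell) (\<lambda>y. g (x, y))"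
    by eventually_elim (auto simp: sec lebesgue_on_borel(1)[OF Y gx] split: split_indicator_asm)
  then show "AE x in lebesgue_on \<Omega>. integrable (lebesgue_on unit_cell) (\<lambda>y. g (x, y))"
    using \<Omega> by (simp add: AE_lebesgue_on)
  show "integrable (lebesgue_on \<Omega>) (\<lambda>x. \<integral>y. g (x, y) \<partial>lebesgue_on unit_cell)"
    using lborel_pair.integrable_fst'[OF int1] unfolding inner lebesgue_on_borel(1)[OF \<Omega> meas] .
  show "(\<integral>z. g z \<partial>lebesgue_on (\<Omega> \<times> unit_cell)) =
      (\<integral>x. (\<integral>y. g (x, y) \<partial>lebesgue_on unit_cell) \<partial>lebesgue_on \<Omega>)"
    using lborel_pair.integral_fst'[OF int1]
    unfolding inner lebesgue_on_borel(2)[OF \<Omega> meas] lebesgue_on_borel(2)[OF S g] lborel_prod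
    by (simp add: g1_def[abs_def])
qed

text \<open>
  A Lebesgue set differs from a Borel set by a subset of a Borel null set, and the product of the
  latter with the cell is again null.
\<close>

lemma lebesgue_Times_cell:
  fixes A :: "'a::euclidean_space set"
  assumes A: "A \<in> sets lebesgue"
  shows "A \<times> (unit_cell :: (real ^ 'm) set) \<in> sets lebesgue"
    and "emeasure lebesgue (A \<times> (unit_cell :: (real ^ 'm) set)) = emeasure lebesgue A"
proof -
  let ?Y = "unit_cell :: (real ^ 'm) set"
  obtain S N N' where A_eq: "A = S \<union> N" "N \<subseteq> N'" "N' \<in> null_sets lborel" "S \<in> sets lborel"
    using A by (elim sets_completionE) auto
  have em: "emeasure lborel (B \<times> ?Y) = emeasure lborel B" if "B \<in> sets borel" for B :: "'a set"
  proof -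
    have "emeasure lborel (B \<times> ?Y) = emeasure (lborel \<Otimes>\<^sub>M lborel) (B \<times> ?Y)" by (simp add: lborel_prod)
    also have "\<dots> = emeasure lborel B * emeasure lborel ?Y"
      using that unit_cell_facts by (intro lborel.emeasure_pair_measure_Times) auto
    finally show ?thesis by (simp add: unit_cell_facts)
  qed
  have Sb: "S \<in> sets borel" "N' \<in> sets borel" using A_eq by auto
  have SY: "S \<times> ?Y \<in> sets borel" "N' \<times> ?Y \<in> sets borel" using Sb borel_Times_cell by blast+
  have null: "N' \<times> ?Y \<in> null_sets lborel" using SY em[OF Sb(2)] A_eq(3) by (simp add: null_sets_def)
  have eq: "A \<times> ?Y = (S \<times> ?Y) \<union> (N \<times> ?Y)" using A_eq(1) by auto
  have "N \<times> ?Y \<subseteq> N' \<times> ?Y" using A_eq(2) by auto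
  then have N0: "N \<in> null_sets lebesgue" "N \<times> ?Y \<in> null_sets lebesgue"
    using A_eq(2,3) null by (auto intro: null_sets_completion_subset[OF _ null_sets_completionI])
  show "A \<times> ?Y \<in> sets lebesgue" unfolding eq using SY N0 by auto
  have "emeasure lebesgue (A \<times> ?Y) = emeasure lebesgue (S \<times> ?Y)"
    unfolding eq using SY N0 by (intro emeasure_Un_null_set) auto
  also have "\<dots> = emeasure lebesgue S" using em[OF Sb(1)] SY Sb by simp
  also have "\<dots> = emeasure lebesgue A"
    unfolding A_eq(1) using N0 Sb by (intro emeasure_Un_null_set[symmetric]) auto
  finally show "emeasure lebesgue (A \<times> ?Y) = emeasure lebesgue A" .
qed

text \<open>
  As the cell has measure \<open>1\<close>, a function of \<open>x\<close> alone has the same norm over \<open>\<Omega> \<times> Y\<close> as over \<open>\<Omega>\<close>.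
\<close>

lemma fst_measure_preserving:
  fixes \<Omega> :: "'a::euclidean_space set"
  assumes \<Omega>: "\<Omega> \<in> sets lebesgue"
  shows "fst \<in> lebesgue_on (\<Omega> \<times> (unit_cell :: (real ^ 'm) set)) \<rightarrow>\<^sub>M lebesgue_on \<Omega>"
    and "distr (lebesgue_on (\<Omega> \<times> (unit_cell :: (real ^ 'm) set))) (lebesgue_on \<Omega>) fst = lebesgue_on \<Omega>"
proof -
  let ?N = "lebesgue_on (\<Omega> \<times> (unit_cell :: (real ^ 'm) set))"
  have vim: "fst -` A \<inter> space ?N = A \<times> unit_cell" if "A \<subseteq> \<Omega>" for A
    using that by (auto simp: space_restrict_space)
  have A: "A \<in> sets lebesgue" "A \<subseteq> \<Omega>" if "A \<in> sets (lebesgue_on \<Omega>)" for A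
    using that \<Omega> by (auto simp: sets_restrict_space_iff)
  show m: "fst \<in> ?N \<rightarrow>\<^sub>M lebesgue_on \<Omega>"
  proof (rule measurableI)
    fix A assume "A \<in> sets (lebesgue_on \<Omega>)"
    note A = A[OF this]
    show "fst -` A \<inter> space ?N \<in> sets ?N"
      unfolding vim[OF A(2)] using A lebesgue_Times_cell(1)[OF A(1)] lebesgue_Times_cell(1)[OF \<Omega>]
      by (subst sets_restrict_space_iff) auto
  qed (auto simp: space_restrict_space)
  show "distr ?N (lebesgue_on \<Omega>) fst = lebesgue_on \<Omega>"
  proof (rule measure_eqI)
    fix S assume "S \<in> sets (distr ?N (lebesgue_on \<Omega>) fst)"
    then have S: "S \<in> sets (lebesgue_on \<Omega>)" by simp
    note A = A[OF S]
    have "emeasure (distr ?N (lebesgue_on \<Omega>) fst) S = emeasure ?N (S \<times> unit_cell)"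
      unfolding emeasure_distr[OF m S] vim[OF A(2)] ..
    also have "\<dots> = emeasure lebesgue (S \<times> (unit_cell :: (real ^ 'm) set))"
      using A lebesgue_Times_cell(1)[OF \<Omega>] by (intro emeasure_restrict_space) auto
    also have "\<dots> = emeasure (lebesgue_on \<Omega>) S"
      using lebesgue_Times_cell(2)[OF A(1), where 'm='m] emeasure_restrict_space[of \<Omega> lebesgue S] A \<Omega>
      by (simp del: emeasure_completion)
    finally show "emeasure (distr ?N (lebesgue_on \<Omega>) fst) S = emeasure (lebesgue_on \<Omega>) S" .
  qed simp
qed

lemma lebesgue_on_borel_measurable:
  "f \<in> borel_measurable borel \<Longrightarrow> f \<in> lebesgue_on S \<rightarrow>\<^sub>M borel"
  by (intro measurable_restrict_space1 measurable_completion) simp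

lemma pair_measurable:
  fixes \<Omega> :: "'a::euclidean_space set"
  assumes \<Omega>: "\<Omega> \<in> sets lebesgue"
  shows "(\<lambda>z. z) \<in> lebesgue_on (\<Omega> \<times> (unit_cell :: (real ^ 'm) set)) \<rightarrow>\<^sub>M (lebesgue_on \<Omega> \<Otimes>\<^sub>M borel)"
proof -
  have "snd \<in> lebesgue_on (\<Omega> \<times> (unit_cell :: (real ^ 'm) set)) \<rightarrow>\<^sub>M borel"
    by (intro lebesgue_on_borel_measurable borel_measurable_continuous_onI continuous_on_snd continuous_on_id)
  from measurable_Pair[OF fst_measure_preserving(1)[OF \<Omega>] this] show ?thesis by simp
qed

lemma osc_measurable:
  fixes R :: "real ^ 'n ^ 'm"
  shows "(\<lambda>x. (x, (R *v x) /\<^sub>R \<epsilon>)) \<in> lebesgue_on \<Omega> \<rightarrow>\<^sub>M (lebesgue_on \<Omega> \<Otimes>\<^sub>M borel)"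
proof (rule measurable_Pair)
  have "continuous_on UNIV (\<lambda>x. (R *v x) /\<^sub>R \<epsilon>)"
    by (intro continuous_intros)
  then show "(\<lambda>x. (R *v x) /\<^sub>R \<epsilon>) \<in> lebesgue_on \<Omega> \<rightarrow>\<^sub>M borel"
    by (intro lebesgue_on_borel_measurable borel_measurable_continuous_onI)
qed simp

section \<open>Admissible test functions\<close>

text \<open>
  The class contains the functions \<open>\<phi>(x)(y)\<close> for \<open>\<phi>\<close> in \<open>L\<^sup>2(\<Omega>, C\<^sub>\<sharp>)\<close> (\<open>oscillating_L2_C_sharp\<close>). Joint
  measurability is stable under linear combinations, whereas Borel measurability of maps into the
  nonseparable space of bounded continuous functions is not evidently so. The dominating
  function \<open>h\<close> replaces the pointwise supremum norm.
\<close>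

definition oscillating :: "(real ^ 'n) set \<Rightarrow> ((real ^ 'n) \<times> (real ^ 'm) \<Rightarrow> real) set" where
  "oscillating \<Omega> = {g. g \<in> borel_measurable (lebesgue_on \<Omega> \<Otimes>\<^sub>M borel) \<and>
     (\<exists>h\<in>L2_space (lebesgue_on \<Omega>). \<forall>x\<in>\<Omega>. \<forall>y. \<bar>g (x, y)\<bar> \<le> (h x :: real))}"

lemma oscillatingI:
  assumes "g \<in> borel_measurable (lebesgue_on \<Omega> \<Otimes>\<^sub>M borel)" "h \<in> L2_space (lebesgue_on \<Omega>)"
    "\<And>x y. x \<in> \<Omega> \<Longrightarrow> \<bar>g (x, y)\<bar> \<le> (h x :: real)"
  shows "g \<in> oscillating \<Omega>"
  using assms unfolding oscillating_def by blast

lemma oscillating_add: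
  assumes "g \<in> oscillating \<Omega>" "g' \<in> oscillating \<Omega>"
  shows "(\<lambda>z. g z + c * g' z) \<in> oscillating \<Omega>"
proof -
  obtain h h' where *: "g \<in> borel_measurable (lebesgue_on \<Omega> \<Otimes>\<^sub>M borel)" "g' \<in> borel_measurable (lebesgue_on \<Omega> \<Otimes>\<^sub>M borel)"
    "h \<in> L2_space (lebesgue_on \<Omega>)" "h' \<in> L2_space (lebesgue_on \<Omega>)"
    "\<And>x y. x \<in> \<Omega> \<Longrightarrow> \<bar>g (x, y)\<bar> \<le> h x" "\<And>x y. x \<in> \<Omega> \<Longrightarrow> \<bar>g' (x, y)\<bar> \<le> h' x"
    using assms unfolding oscillating_def by blast
  show ?thesis
  proof (rule oscillatingI)
    show "(\<lambda>x. h x + \<bar>c\<bar> * h' x) \<in> L2_space (lebesgue_on \<Omega>)" by (intro L2_add L2_cmult *)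
    show "\<bar>g (x, y) + c * g' (x, y)\<bar> \<le> h x + \<bar>c\<bar> * h' x" if "x \<in> \<Omega>" for x y
    proof -
      have "\<bar>g (x, y) + c * g' (x, y)\<bar> \<le> \<bar>g (x, y)\<bar> + \<bar>c\<bar> * \<bar>g' (x, y)\<bar>"
        by (rule order_trans[OF abs_triangle_ineq]) (simp add: abs_mult)
      also have "\<dots> \<le> h x + \<bar>c\<bar> * h' x" using *(5,6)[OF that] by (intro add_mono mult_left_mono) auto
      finally show ?thesis .
    qed
  qed (use * in measurable)
qed

definition osc_int ::
    "(real ^ 'n) set \<Rightarrow> real ^ 'n ^ 'm \<Rightarrow> real \<Rightarrow> (real ^ 'n \<Rightarrow> real) \<Rightarrow> ((real ^ 'n) \<times> (real ^ 'm) \<Rightarrow> real) \<Rightarrow> real" where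
  "osc_int \<Omega> R \<epsilon> f g = (\<integral>x. f x * g (x, (R *v x) /\<^sub>R \<epsilon>) \<partial>lebesgue_on \<Omega>)"

definition cell_int ::
    "(real ^ 'n) set \<Rightarrow> ((real ^ 'n) \<times> (real ^ 'm) \<Rightarrow> real) \<Rightarrow> ((real ^ 'n) \<times> (real ^ 'm) \<Rightarrow> real) \<Rightarrow> real" where
  "cell_int \<Omega> u g = (\<integral>z. u z * g z \<partial>lebesgue_on (\<Omega> \<times> unit_cell))"

lemma trace_L2:
  fixes g :: "(real ^ 'n) \<times> (real ^ 'm) \<Rightarrow> real" and R :: "real ^ 'n ^ 'm"
  assumes g: "g \<in> borel_measurable (lebesgue_on \<Omega> \<Otimes>\<^sub>M borel)" and h: "h \<in> L2_space (lebesgue_on \<Omega>)"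
    and le: "\<And>x y. x \<in> \<Omega> \<Longrightarrow> \<bar>g (x, y)\<bar> \<le> (h x :: real)"
  shows "(\<lambda>x. g (x, (R *v x) /\<^sub>R \<epsilon>)) \<in> L2_space (lebesgue_on \<Omega>)"
    and "norm_L2 (lebesgue_on \<Omega>) (\<lambda>x. g (x, (R *v x) /\<^sub>R \<epsilon>)) \<le> norm_L2 (lebesgue_on \<Omega>) h"
proof -
  have m: "(\<lambda>x. g (x, (R *v x) /\<^sub>R \<epsilon>)) \<in> borel_measurable (lebesgue_on \<Omega>)"
    by (rule measurable_compose[OF osc_measurable g])
  have ae: "AE x in lebesgue_on \<Omega>. \<bar>g (x, (R *v x) /\<^sub>R \<epsilon>)\<bar> \<le> norm (h x)"
  proof (rule AE_I2)
    fix x assume "x \<in> space (lebesgue_on \<Omega>)"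
    then have "x \<in> \<Omega>" by simp
    from le[OF this, of "(R *v x) /\<^sub>R \<epsilon>"] show "\<bar>g (x, (R *v x) /\<^sub>R \<epsilon>)\<bar> \<le> norm (h x)" by simp
  qed
  show "(\<lambda>x. g (x, (R *v x) /\<^sub>R \<epsilon>)) \<in> L2_space (lebesgue_on \<Omega>)" by (rule L2_bound[OF m h ae])
  show "norm_L2 (lebesgue_on \<Omega>) (\<lambda>x. g (x, (R *v x) /\<^sub>R \<epsilon>)) \<le> norm_L2 (lebesgue_on \<Omega>) h"
    by (rule L2_norm_mono[OF m h ae])
qed

lemma cell_L2:
  fixes g :: "(real ^ 'n) \<times> (real ^ 'm) \<Rightarrow> real"
  assumes \<Omega>: "\<Omega> \<in> sets lebesgue"
    and g: "g \<in> borel_measurable (lebesgue_on \<Omega> \<Otimes>\<^sub>M borel)" and h: "h \<in> L2_space (lebesgue_on \<Omega>)"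
    and le: "\<And>x y. x \<in> \<Omega> \<Longrightarrow> \<bar>g (x, y)\<bar> \<le> (h x :: real)"
  shows "g \<in> L2_space (lebesgue_on (\<Omega> \<times> unit_cell))"
    and "norm_L2 (lebesgue_on (\<Omega> \<times> unit_cell)) g \<le> norm_L2 (lebesgue_on \<Omega>) h"
proof -
  let ?N = "lebesgue_on (\<Omega> \<times> (unit_cell :: (real ^ 'm) set))"
  have m: "g \<in> borel_measurable ?N"
    using measurable_compose[OF pair_measurable[OF \<Omega>] g] by simp
  note fst = fst_measure_preserving[OF \<Omega>, where 'm='m]
  have hm: "h \<in> borel_measurable (lebesgue_on \<Omega>)" "integrable (lebesgue_on \<Omega>) (\<lambda>x. (h x)\<^sup>2)"
    using h by (auto simp: L2_space_real_iff)
  have hf: "(\<lambda>z. h (fst z)) \<in> L2_space ?N"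
  proof -
    have "integrable (distr ?N (lebesgue_on \<Omega>) fst) (\<lambda>x. (h x)\<^sup>2)" unfolding fst(2) by (rule hm)
    from integrable_distr[OF fst(1) this] show ?thesis
      using measurable_compose[OF fst(1) hm(1)] by (simp add: L2_space_real_iff)
  qed
  have hn: "norm_L2 ?N (\<lambda>z. h (fst z)) = norm_L2 (lebesgue_on \<Omega>) h"
  proof -
    have "(\<integral>x. (h x)\<^sup>2 \<partial>distr ?N (lebesgue_on \<Omega>) fst) = (\<integral>z. (h (fst z))\<^sup>2 \<partial>?N)"
      using hm by (intro integral_distr fst) auto
    then show ?thesis by (simp add: norm_L2_real fst(2))
  qed
  have ae: "AE z in ?N. \<bar>g z\<bar> \<le> norm (h (fst z))"
  proof (rule AE_I2)
    fix z assume "z \<in> space ?N"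
    then have "fst z \<in> \<Omega>" by auto
    from le[OF this, of "snd z"] show "\<bar>g z\<bar> \<le> norm (h (fst z))" by simp
  qed
  show "g \<in> L2_space ?N" by (rule L2_bound[OF m hf ae])
  show "norm_L2 ?N g \<le> norm_L2 (lebesgue_on \<Omega>) h"
    using L2_norm_mono[OF m hf ae] hn by simp
qed

lemma osc_int_bound:
  assumes "g \<in> borel_measurable (lebesgue_on \<Omega> \<Otimes>\<^sub>M borel)" "h \<in> L2_space (lebesgue_on \<Omega>)"
    "\<And>x y. x \<in> \<Omega> \<Longrightarrow> \<bar>g (x, y)\<bar> \<le> (h x :: real)" "f \<in> L2_space (lebesgue_on \<Omega>)"
  shows "\<bar>osc_int \<Omega> R \<epsilon> f g\<bar> \<le> norm_L2 (lebesgue_on \<Omega>) f * norm_L2 (lebesgue_on \<Omega>) h"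
  unfolding osc_int_def
  by (rule order_trans[OF L2_Cauchy_Schwarz[OF assms(4) trace_L2(1)[OF assms(1-3)]]])
     (auto intro!: mult_left_mono trace_L2(2)[OF assms(1-3)])

lemma cell_int_bound:
  assumes "\<Omega> \<in> sets lebesgue"
    "g \<in> borel_measurable (lebesgue_on \<Omega> \<Otimes>\<^sub>M borel)" "h \<in> L2_space (lebesgue_on \<Omega>)"
    "\<And>x y. x \<in> \<Omega> \<Longrightarrow> \<bar>g (x, y)\<bar> \<le> (h x :: real)" "u \<in> L2_space (lebesgue_on (\<Omega> \<times> unit_cell))"
  shows "\<bar>cell_int \<Omega> u g\<bar> \<le> norm_L2 (lebesgue_on (\<Omega> \<times> unit_cell)) u * norm_L2 (lebesgue_on \<Omega>) h"
  unfolding cell_int_def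
  by (rule order_trans[OF L2_Cauchy_Schwarz[OF assms(5) cell_L2(1)[OF assms(1-4)]]])
     (auto intro!: mult_left_mono cell_L2(2)[OF assms(1-4)])

lemma osc_int_add:
  assumes "f \<in> L2_space (lebesgue_on \<Omega>)" "g \<in> oscillating \<Omega>" "g' \<in> oscillating \<Omega>"
  shows "osc_int \<Omega> R \<epsilon> f (\<lambda>z. g z + c * g' z) = osc_int \<Omega> R \<epsilon> f g + c * osc_int \<Omega> R \<epsilon> f g'"
proof -
  have i: "integrable (lebesgue_on \<Omega>) (\<lambda>x. f x * g (x, (R *v x) /\<^sub>R \<epsilon>))" if "g \<in> oscillating \<Omega>" for g
    using that unfolding oscillating_def by (auto intro!: L2_mult_integrable assms(1) intro: trace_L2(1))
  show ?thesis
    unfolding osc_int_def using i[OF assms(2)] i[OF assms(3)]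
    by (simp add: distrib_left mult.left_commute[of _ c])
qed

lemma cell_int_add:
  assumes "\<Omega> \<in> sets lebesgue" "u \<in> L2_space (lebesgue_on (\<Omega> \<times> unit_cell))" "g \<in> oscillating \<Omega>" "g' \<in> oscillating \<Omega>"
  shows "cell_int \<Omega> u (\<lambda>z. g z + c * g' z) = cell_int \<Omega> u g + c * cell_int \<Omega> u g'"
proof -
  have i: "integrable (lebesgue_on (\<Omega> \<times> unit_cell)) (\<lambda>z. u z * g z)" if "g \<in> oscillating \<Omega>" for g
    using that unfolding oscillating_def by (auto intro!: L2_mult_integrable assms(2) intro: cell_L2(1)[OF assms(1)])
  show ?thesis
    unfolding cell_int_def using i[OF assms(3)] i[OF assms(4)]
    by (simp add: distrib_left mult.left_commute[of _ c])
qed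

definition osc_converges ::
    "(real ^ 'n) set \<Rightarrow> real ^ 'n ^ 'm \<Rightarrow> (nat \<Rightarrow> real) \<Rightarrow> (nat \<Rightarrow> real ^ 'n \<Rightarrow> real) \<Rightarrow>
      ((real ^ 'n) \<times> (real ^ 'm) \<Rightarrow> real) \<Rightarrow> ((real ^ 'n) \<times> (real ^ 'm) \<Rightarrow> real) set" where
  "osc_converges \<Omega> R \<eta> f u =
     {g \<in> oscillating \<Omega>. (\<lambda>n. osc_int \<Omega> R (\<eta> n) (f n) g) \<longlonglongrightarrow> cell_int \<Omega> u g}"

lemma osc_converges_add:
  assumes "\<Omega> \<in> sets lebesgue" "\<And>n. f n \<in> L2_space (lebesgue_on \<Omega>)"
    "u \<in> L2_space (lebesgue_on (\<Omega> \<times> unit_cell))"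
    "g \<in> osc_converges \<Omega> R \<eta> f u" "g' \<in> osc_converges \<Omega> R \<eta> f u"
  shows "(\<lambda>z. g z + c * g' z) \<in> osc_converges \<Omega> R \<eta> f u"
  using assms
  by (auto simp: osc_converges_def osc_int_add cell_int_add intro!: tendsto_intros oscillating_add)

text \<open>
  Both sides of the limit are bounded by the norm of the dominating function, the oscillating
  side uniformly in \<open>n\<close>; hence the functions along which the limit holds form a closed set.
\<close>

lemma osc_converges_closed:
  assumes \<Omega>: "\<Omega> \<in> sets lebesgue" and f: "\<And>n. f n \<in> L2_space (lebesgue_on \<Omega>)"
    and fC: "\<And>n. norm_L2 (lebesgue_on \<Omega>) (f n) \<le> C"
    and u: "u \<in> L2_space (lebesgue_on (\<Omega> \<times> unit_cell))"
    and g: "g \<in> oscillating \<Omega>"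
    and approx: "\<And>e. e > 0 \<Longrightarrow> \<exists>g'\<in>osc_converges \<Omega> R \<eta> f u. \<exists>h\<in>L2_space (lebesgue_on \<Omega>).
      (\<forall>x\<in>\<Omega>. \<forall>y. \<bar>g (x, y) - g' (x, y)\<bar> \<le> (h x :: real)) \<and> norm_L2 (lebesgue_on \<Omega>) h \<le> e"
  shows "g \<in> osc_converges \<Omega> R \<eta> f u"
proof -
  let ?L = "\<lambda>n g. osc_int \<Omega> R (\<eta> n) (f n) g"
  define B where "B = \<bar>C\<bar> + norm_L2 (lebesgue_on (\<Omega> \<times> unit_cell)) u + 1"
  have B: "B > 0" by (simp add: B_def add_nonneg_pos)
  have "(\<lambda>n. ?L n g) \<longlonglongrightarrow> cell_int \<Omega> u g"
  proof (rule LIMSEQ_I)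
    fix e :: real assume "e > 0"
    define d where "d = e / (2 * B)"
    have d: "d > 0" using \<open>e > 0\<close> B by (simp add: d_def)
    obtain g' h where g': "g' \<in> osc_converges \<Omega> R \<eta> f u" and h: "h \<in> L2_space (lebesgue_on \<Omega>)"
      "\<And>x y. x \<in> \<Omega> \<Longrightarrow> \<bar>g (x, y) - g' (x, y)\<bar> \<le> h x" "norm_L2 (lebesgue_on \<Omega>) h \<le> d"
      using approx[OF d] by blast
    have g'o: "g' \<in> oscillating \<Omega>" and g'c: "(\<lambda>n. ?L n g') \<longlonglongrightarrow> cell_int \<Omega> u g'"
      using g' by (auto simp: osc_converges_def)
    have dm: "(\<lambda>z. g z + (-1) * g' z) \<in> borel_measurable (lebesgue_on \<Omega> \<Otimes>\<^sub>M borel)"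
      using oscillating_add[OF g g'o, of "-1"] by (simp add: oscillating_def)
    have dl: "\<bar>g (x, y) + (-1) * g' (x, y)\<bar> \<le> h x" if "x \<in> \<Omega>" for x y using h(2)[OF that] by simp
    have b1: "\<bar>?L n g - ?L n g'\<bar> \<le> \<bar>C\<bar> * d" for n
    proof -
      have "\<bar>?L n g - ?L n g'\<bar> = \<bar>?L n (\<lambda>z. g z + (-1) * g' z)\<bar>"
        using osc_int_add[OF f[of n] g g'o, of R "\<eta> n" "-1"] by simp
      also have "\<dots> \<le> norm_L2 (lebesgue_on \<Omega>) (f n) * norm_L2 (lebesgue_on \<Omega>) h"
        by (rule osc_int_bound[OF dm h(1) dl f])
      also have "\<dots> \<le> \<bar>C\<bar> * d" using fC[of n] h(3) by (intro mult_mono) auto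
      finally show ?thesis .
    qed
    have b2: "\<bar>cell_int \<Omega> u g - cell_int \<Omega> u g'\<bar> \<le> norm_L2 (lebesgue_on (\<Omega> \<times> unit_cell)) u * d"
    proof -
      have "\<bar>cell_int \<Omega> u g - cell_int \<Omega> u g'\<bar> = \<bar>cell_int \<Omega> u (\<lambda>z. g z + (-1) * g' z)\<bar>"
        using cell_int_add[OF \<Omega> u g g'o, of "-1"] by simp
      also have "\<dots> \<le> norm_L2 (lebesgue_on (\<Omega> \<times> unit_cell)) u * norm_L2 (lebesgue_on \<Omega>) h"
        by (rule cell_int_bound[OF \<Omega> dm h(1) dl u])
      also have "\<dots> \<le> norm_L2 (lebesgue_on (\<Omega> \<times> unit_cell)) u * d"
        using h(3) by (intro mult_left_mono) auto
      finally show ?thesis .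
    qed
    have "\<exists>N. \<forall>n\<ge>N. norm (?L n g' - cell_int \<Omega> u g') < d" by (rule LIMSEQ_D[OF g'c d])
    then obtain N where N: "\<And>n. n \<ge> N \<Longrightarrow> \<bar>?L n g' - cell_int \<Omega> u g'\<bar> < d" by auto
    have Bd: "B * d = e / 2" using B by (simp add: d_def)
    show "\<exists>N. \<forall>n\<ge>N. norm (?L n g - cell_int \<Omega> u g) < e"
    proof (intro exI allI impI)
      fix n assume "n \<ge> N"
      have "\<bar>?L n g - cell_int \<Omega> u g\<bar> \<le> \<bar>?L n g - ?L n g'\<bar> + \<bar>?L n g' - cell_int \<Omega> u g'\<bar> + \<bar>cell_int \<Omega> u g - cell_int \<Omega> u g'\<bar>"
        by linarith
      also have "\<dots> \<le> \<bar>C\<bar> * d + d + norm_L2 (lebesgue_on (\<Omega> \<times> unit_cell)) u * d"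
        using b1[of n] b2 N[OF \<open>n \<ge> N\<close>] by linarith
      also have "\<dots> = B * d" by (simp add: B_def algebra_simps)
      also have "\<dots> < e" using Bd \<open>e > 0\<close> by simp
      finally show "norm (?L n g - cell_int \<Omega> u g) < e" by simp
    qed
  qed
  then show ?thesis using g by (simp add: osc_converges_def)
qed

lemma finite_measure_lebesgue_on_open:
  fixes \<Omega> :: "'a::euclidean_space set"
  assumes "open \<Omega>" "bounded \<Omega>"
  shows "finite_measure (lebesgue_on \<Omega>)" "\<Omega> \<in> sets lebesgue" "emeasure lborel \<Omega> < \<infinity>"
proof -
  have "\<Omega> \<in> lmeasurable" using assms by (rule lmeasurable_open[rotated])
  then show "finite_measure (lebesgue_on \<Omega>)" "\<Omega> \<in> sets lebesgue"
    by (auto intro: finite_measure_lebesgue_on)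
  show "emeasure lborel \<Omega> < \<infinity>" by (rule emeasure_bounded_finite[OF assms(2)])
qed

lemma finite_measure_Times_cell:
  fixes \<Omega> :: "'a::euclidean_space set"
  assumes "open \<Omega>" "bounded \<Omega>"
  shows "finite_measure (lebesgue_on (\<Omega> \<times> (unit_cell :: (real ^ 'm) set)))"
  using assms unit_cell_facts(1) bounded_box[of 0 "1 :: real ^ 'm"]
  by (intro finite_measure_lebesgue_on_open open_Times bounded_Times) (auto simp: unit_cell_eq_box)

lemma oscillating_indicator:
  fixes q :: "(real ^ 'm) \<Rightarrow>\<^sub>C real"
  assumes fin: "finite_measure (lebesgue_on \<Omega>)" and A: "A \<in> sets (lebesgue_on \<Omega>)"
  shows "(\<lambda>z. indicator A (fst z) * apply_bcontfun q (snd z)) \<in> oscillating \<Omega>"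
proof (rule oscillatingI)
  have [measurable]: "apply_bcontfun q \<in> borel_measurable borel"
    by (intro borel_measurable_continuous_onI) simp
  show "(\<lambda>z. indicator A (fst z) * apply_bcontfun q (snd z)) \<in> borel_measurable (lebesgue_on \<Omega> \<Otimes>\<^sub>M borel)"
    using A by measurable
  show "(\<lambda>x. norm q * indicator A x) \<in> L2_space (lebesgue_on \<Omega>)"
    by (rule norm_L2_indicator_le[OF fin _ norm_ge_zero[of q] A]) (use A in \<open>auto simp: abs_mult\<close>)
  show "\<bar>indicator A (fst (x, y)) * apply_bcontfun q (snd (x, y))\<bar> \<le> norm q * indicator A x" for x y
    using norm_bounded[of q y] by (simp add: indicator_def)
qed

lemma oscillating_indicator_trig:
  assumes "finite_measure (lebesgue_on \<Omega>)" "A \<in> sets (lebesgue_on \<Omega>)"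
  shows "(\<lambda>z. indicator A (fst z) * trig k j (snd z)) \<in> oscillating \<Omega>"
  using oscillating_indicator[OF assms, of "trigB k j"] by simp

text \<open>
  A function with values in a separable space selects the first element of a dense sequence that
  is close enough; the selection is measurable as a least index.
\<close>

lemma countable_valued_approximation:
  fixes \<phi> :: "'a \<Rightarrow> ((real ^ 'm) \<Rightarrow>\<^sub>C real)"
  assumes \<phi>: "\<phi> \<in> borel_measurable M" and C: "\<And>x. x \<in> space M \<Longrightarrow> \<phi> x \<in> C_sharp"
  obtains d :: "nat \<Rightarrow> (real ^ 'm) \<Rightarrow>\<^sub>C real" where "range d \<subseteq> C_sharp"
    "\<And>e. e > 0 \<Longrightarrow> \<exists>j\<in>M \<rightarrow>\<^sub>M count_space UNIV. \<forall>x\<in>space M. norm (\<phi> x - d (j x)) < e"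
proof -
  obtain D :: "((real ^ 'm) \<Rightarrow>\<^sub>C real) set"
    where D: "countable D" "D \<subseteq> C_sharp" "\<And>q e. q \<in> C_sharp \<Longrightarrow> e > 0 \<Longrightarrow> \<exists>d\<in>D. norm (q - d) < e"
    by (rule countable_dense_C_sharp) blast
  have "D \<noteq> {}" using D(3)[of 0 1] subspace_0[OF subspace_C_sharp] by auto
  define d where "d = from_nat_into D"
  have rd: "range d = D" unfolding d_def by (rule range_from_nat_into[OF \<open>D \<noteq> {}\<close> D(1)])
  show ?thesis
  proof (rule that)
    show "range d \<subseteq> C_sharp" using rd D(2) by simp
    fix e :: real assume e: "e > 0"
    define j where "j x = (LEAST n. norm (\<phi> x - d n) < e)" for x
    have "j \<in> M \<rightarrow>\<^sub>M count_space UNIV"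
      unfolding j_def
    proof (rule measurable_Least)
      fix n
      have "(\<lambda>b. norm (b - d n)) \<in> borel_measurable borel"
        by (intro borel_measurable_continuous_onI continuous_intros)
      from measurable_compose[OF \<phi> this] show "Measurable.pred M (\<lambda>x. norm (\<phi> x - d n) < e)"
        by measurable
    qed
    moreover have "norm (\<phi> x - d (j x)) < e" if "x \<in> space M" for x
    proof -
      have "\<exists>n. norm (\<phi> x - d n) < e" using D(3)[OF C[OF that] e] rd by (metis rangeE)
      then show ?thesis unfolding j_def by (rule LeastI_ex)
    qed
    ultimately show "\<exists>j\<in>M \<rightarrow>\<^sub>M count_space UNIV. \<forall>x\<in>space M. norm (\<phi> x - d (j x)) < e" by blast
  qed
qed

lemma countable_valued_measurable:
  fixes d :: "nat \<Rightarrow> (real ^ 'm) \<Rightarrow>\<^sub>C real"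
  assumes j: "j \<in> M \<rightarrow>\<^sub>M count_space UNIV"
  shows "(\<lambda>z. apply_bcontfun (d (j (fst z))) (snd z)) \<in> borel_measurable (M \<Otimes>\<^sub>M borel)"
proof (rule measurable_compose_countable)
  fix n
  have [measurable]: "apply_bcontfun (d n) \<in> borel_measurable borel"
    by (intro borel_measurable_continuous_onI) simp
  show "(\<lambda>z. apply_bcontfun (d n) (snd z)) \<in> borel_measurable (M \<Otimes>\<^sub>M borel)" by measurable
qed (use j in measurable)

lemma oscillating_L2_C_sharp:
  fixes \<phi> :: "real ^ 'n \<Rightarrow> ((real ^ 'm) \<Rightarrow>\<^sub>C real)"
  assumes \<phi>: "\<phi> \<in> L2_space (lebesgue_on \<Omega>)" "\<And>x. x \<in> \<Omega> \<Longrightarrow> \<phi> x \<in> C_sharp"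
  shows "(\<lambda>z. apply_bcontfun (\<phi> (fst z)) (snd z)) \<in> oscillating \<Omega>"
proof (rule oscillatingI)
  let ?M = "lebesgue_on \<Omega>"
  have \<phi>m: "\<phi> \<in> borel_measurable ?M" using \<phi> by (simp add: L2_space_def)
  have nm: "(\<lambda>x. norm (\<phi> x)) \<in> borel_measurable ?M"
    by (rule measurable_compose[OF \<phi>m]) (intro borel_measurable_continuous_onI continuous_intros)
  obtain d :: "nat \<Rightarrow> (real ^ 'm) \<Rightarrow>\<^sub>C real" where
    d: "\<And>e. e > 0 \<Longrightarrow> \<exists>j\<in>?M \<rightarrow>\<^sub>M count_space UNIV. \<forall>x\<in>space ?M. norm (\<phi> x - d (j x)) < e"
    using countable_valued_approximation[OF \<phi>m] \<phi>(2) by auto metis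
  have "\<exists>j\<in>?M \<rightarrow>\<^sub>M count_space UNIV. \<forall>x\<in>space ?M. norm (\<phi> x - d (j x)) < 1 / real (Suc n)" for n
    by (rule d) simp
  then obtain j where j: "\<And>n. j n \<in> ?M \<rightarrow>\<^sub>M count_space UNIV"
    "\<And>n x. x \<in> space ?M \<Longrightarrow> norm (\<phi> x - d (j n x)) < 1 / real (Suc n)" by metis
  show "(\<lambda>z. apply_bcontfun (\<phi> (fst z)) (snd z)) \<in> borel_measurable (?M \<Otimes>\<^sub>M borel)"
  proof (rule borel_measurable_LIMSEQ_real)
    show "(\<lambda>z. apply_bcontfun (d (j n (fst z))) (snd z)) \<in> borel_measurable (?M \<Otimes>\<^sub>M borel)" for n
      by (rule countable_valued_measurable[OF j(1)])
    fix z :: "(real ^ 'n) \<times> (real ^ 'm)" assume "z \<in> space (?M \<Otimes>\<^sub>M borel)"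
    then have z: "fst z \<in> space ?M" by (auto simp: space_pair_measure)
    show "(\<lambda>n. apply_bcontfun (d (j n (fst z))) (snd z)) \<longlonglongrightarrow> apply_bcontfun (\<phi> (fst z)) (snd z)"
    proof (rule LIM_zero_cancel, rule Lim_null_comparison)
      show "\<forall>\<^sub>F n in sequentially. norm (apply_bcontfun (d (j n (fst z))) (snd z) - apply_bcontfun (\<phi> (fst z)) (snd z)) \<le> 1 / real (Suc n)"
      proof (rule always_eventually, rule allI)
        fix n
        have "norm (apply_bcontfun (d (j n (fst z))) (snd z) - apply_bcontfun (\<phi> (fst z)) (snd z)) \<le> norm (\<phi> (fst z) - d (j n (fst z)))"
          using norm_bounded[of "\<phi> (fst z) - d (j n (fst z))" "snd z"] by simp
        also have "\<dots> \<le> 1 / real (Suc n)" using j(2)[OF z, of n] by simp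
        finally show "norm (apply_bcontfun (d (j n (fst z))) (snd z) - apply_bcontfun (\<phi> (fst z)) (snd z)) \<le> 1 / real (Suc n)" .
      qed
      show "(\<lambda>n. 1 / real (Suc n)) \<longlonglongrightarrow> 0" by (rule LIMSEQ_Suc[OF lim_1_over_n])
    qed
  qed
  show "(\<lambda>x. norm (\<phi> x)) \<in> L2_space ?M"
    using \<phi> nm by (simp add: L2_space_def)
  show "\<bar>apply_bcontfun (\<phi> (fst (x, y))) (snd (x, y))\<bar> \<le> norm (\<phi> x)" for x y
    using norm_bounded[of "\<phi> x" y] by simp
qed

text \<open>
  The set of functions along which the limit holds is a closed linear space. It is enlarged in
  stages: from box unions to measurable sets, from trigonometric functions to \<open>C\<^sub>\<sharp>\<close>, from products to
  functions with countably many values in \<open>C\<^sub>\<sharp>\<close>, and from these to all of \<open>L\<^sup>2(\<Omega>, C\<^sub>\<sharp>)\<close>.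
\<close>

lemma osc_converges_from_basis:
  fixes \<Omega> :: "(real ^ 'n) set" and \<phi> :: "real ^ 'n \<Rightarrow> ((real ^ 'm) \<Rightarrow>\<^sub>C real)"
  assumes \<Omega>: "open \<Omega>" "bounded \<Omega>"
    and f: "\<And>n. f n \<in> L2_space (lebesgue_on \<Omega>)" and fC: "\<And>n. norm_L2 (lebesgue_on \<Omega>) (f n) \<le> C"
    and u: "u \<in> L2_space (lebesgue_on (\<Omega> \<times> unit_cell))"
    and base: "\<And>U k j. U \<in> box_unions \<Omega> \<Longrightarrow>
      (\<lambda>z. indicator U (fst z) * trig k j (snd z)) \<in> osc_converges \<Omega> R \<eta> f u"
    and \<phi>: "\<phi> \<in> L2_space (lebesgue_on \<Omega>)" "\<And>x. x \<in> \<Omega> \<Longrightarrow> \<phi> x \<in> C_sharp"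
  shows "(\<lambda>z. apply_bcontfun (\<phi> (fst z)) (snd z)) \<in> osc_converges \<Omega> R \<eta> f u"
proof -
  let ?M = "lebesgue_on \<Omega>" and ?W = "osc_converges \<Omega> R \<eta> f u"
  note fin = finite_measure_lebesgue_on_open(1)[OF \<Omega>] and \<Omega>s = finite_measure_lebesgue_on_open(2)[OF \<Omega>]
  interpret finite_measure ?M by (rule fin)
  note closed = osc_converges_closed[OF \<Omega>s f fC u]
  note add = osc_converges_add[OF \<Omega>s f u]
  \<comment> \<open>The norm of the constant function \<open>1\<close> is \<open>s - 1\<close>; the extra \<open>1\<close> only keeps \<open>s\<close> positive when \<open>\<Omega>\<close>
    is empty.\<close>
  define s where "s = sqrt (measure ?M (space ?M)) + 1"
  have s: "s > 0" by (simp add: s_def add_nonneg_pos)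
  have const: "(\<lambda>_. c) \<in> L2_space ?M" "norm_L2 ?M (\<lambda>_. c) \<le> c * s" if "c \<ge> 0" for c :: real
    using that by (auto simp: L2_space_real_iff norm_L2_real real_sqrt_mult s_def algebra_simps)
  have 1: "(\<lambda>z. indicator A (fst z) * trig k j (snd z)) \<in> ?W" if A: "A \<in> sets ?M" for A k j
  proof (rule closed)
    show "(\<lambda>z. indicator A (fst z) * trig k j (snd z)) \<in> oscillating \<Omega>"
      by (rule oscillating_indicator_trig[OF fin A])
    fix e :: real assume e: "e > 0"
    then obtain U where U: "U \<in> box_unions \<Omega>" "(\<integral>x. \<bar>indicator A x - indicator U x\<bar> \<partial>?M) < e\<^sup>2"
      using box_unions_approx[OF \<Omega> A, of "e\<^sup>2"] by auto
    have UM: "U \<in> sets ?M"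
      using box_unions_open[OF U(1)] box_unions_subset[OF U(1)] \<Omega>s by (simp add: sets_restrict_space_iff)
    define h where "h x = \<bar>indicator A x - indicator U x :: real\<bar>" for x
    have hm: "h \<in> borel_measurable ?M" unfolding h_def using A UM by measurable
    have h2: "(h x)\<^sup>2 = h x" for x by (simp add: h_def indicator_def)
    have "h \<in> L2_space ?M"
      by (rule norm_L2_indicator_le[OF fin hm, of 1 "space ?M"]) (auto simp: h_def indicator_def)
    moreover have "norm_L2 ?M h \<le> e"
      using U(2) e unfolding norm_L2_real h2 by (intro real_le_lsqrt) (auto simp: h_def)
    moreover have "\<bar>indicator A (fst (x, y)) * trig k j (snd (x, y)) - indicator U (fst (x, y)) * trig k j (snd (x, y))\<bar> \<le> h x" for x y
    proof -
      have "\<bar>indicator A x * trig k j y - indicator U x * trig k j y\<bar> = h x * \<bar>trig k j y\<bar>"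
        by (simp add: h_def abs_mult[symmetric] left_diff_distrib)
      also have "\<dots> \<le> h x * 1" by (intro mult_left_mono abs_trig_le) (simp add: h_def)
      finally show ?thesis by simp
    qed
    ultimately show "\<exists>g'\<in>?W. \<exists>h\<in>L2_space ?M. (\<forall>x\<in>\<Omega>. \<forall>y. \<bar>indicator A (fst (x, y)) * trig k j (snd (x, y)) - g' (x, y)\<bar> \<le> (h x :: real)) \<and> norm_L2 ?M h \<le> e"
      by (intro bexI[OF _ base[OF U(1), of k j]] bexI[of _ h]) auto
  qed
  have 2: "(\<lambda>z. indicator A (fst z) * apply_bcontfun p (snd z)) \<in> ?W"
    if A: "A \<in> sets ?M" and p: "p \<in> trig_polynomials" for A p
    using p unfolding trig_polynomials_def
  proof (induction rule: span_induct_alt)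
    case base
    have "(\<lambda>z. indicator A (fst z) * trig 0 0 (snd z) + (-1) * (indicator A (fst z) * trig 0 0 (snd z))) \<in> ?W"
      by (intro add 1 A)
    then show ?case by simp
  next
    case (step c x y)
    then obtain k j where x: "x = trigB k j" by auto
    have "(\<lambda>z. indicator A (fst z) * apply_bcontfun y (snd z) + c * (indicator A (fst z) * trig k j (snd z))) \<in> ?W"
      by (intro add 1 A step)
    then show ?case by (simp add: x algebra_simps)
  qed
  have 3: "(\<lambda>z. indicator A (fst z) * apply_bcontfun q (snd z)) \<in> ?W"
    if A: "A \<in> sets ?M" and q: "q \<in> C_sharp" for A and q :: "(real ^ 'm) \<Rightarrow>\<^sub>C real"
  proof (rule closed)
    show "(\<lambda>z. indicator A (fst z) * apply_bcontfun q (snd z)) \<in> oscillating \<Omega>"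
      by (rule oscillating_indicator[OF fin A])
    fix e :: real assume e: "e > 0"
    then obtain p where p: "p \<in> trig_polynomials" "norm (q - p) < e / s"
      using trig_polynomials_dense[OF q, of "e / s"] s by auto
    have "norm_L2 ?M (\<lambda>_. e / s) \<le> e / s * s" using e s by (intro const) auto
    moreover have "\<bar>indicator A x * apply_bcontfun q y - indicator A x * apply_bcontfun p y\<bar> \<le> e / s" for x y
      using norm_bounded[of "q - p" y] p(2) e s by (auto simp: indicator_def)
    ultimately show "\<exists>g'\<in>?W. \<exists>h\<in>L2_space ?M. (\<forall>x\<in>\<Omega>. \<forall>y. \<bar>indicator A (fst (x, y)) * apply_bcontfun q (snd (x, y)) - g' (x, y)\<bar> \<le> (h x :: real)) \<and> norm_L2 ?M h \<le> e"
      using e s by (intro bexI[OF _ 2[OF A p(1)]] bexI[of _ "\<lambda>_. e / s"] const) auto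
  qed
  have \<phi>m: "\<phi> \<in> borel_measurable ?M" using \<phi> by (simp add: L2_space_def)
  have nm: "(\<lambda>x. norm (\<phi> x)) \<in> borel_measurable ?M"
    by (rule measurable_compose[OF \<phi>m]) (intro borel_measurable_continuous_onI continuous_intros)
  have nL2: "(\<lambda>x. norm (\<phi> x)) \<in> L2_space ?M"
    using \<phi> nm by (simp add: L2_space_def)
  obtain d :: "nat \<Rightarrow> (real ^ 'm) \<Rightarrow>\<^sub>C real" where dC: "range d \<subseteq> C_sharp" and
    d: "\<And>e. e > 0 \<Longrightarrow> \<exists>j\<in>?M \<rightarrow>\<^sub>M count_space UNIV. \<forall>x\<in>space ?M. norm (\<phi> x - d (j x)) < e"
    using countable_valued_approximation[OF \<phi>m] \<phi>(2) by auto
  have 4: "(\<lambda>z. apply_bcontfun (d (j (fst z))) (snd z)) \<in> ?W"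
    if j: "j \<in> ?M \<rightarrow>\<^sub>M count_space UNIV" and jd: "\<And>x. x \<in> space ?M \<Longrightarrow> norm (\<phi> x - d (j x)) < e" and e: "e > 0"
    for j :: "real ^ 'n \<Rightarrow> nat" and e
  proof (rule closed)
    define h where "h x = norm (\<phi> x) + e" for x
    have hL2: "h \<in> L2_space ?M" unfolding h_def using e by (intro L2_add nL2 const) auto
    have h_nn: "h x \<ge> 0" for x using e by (simp add: h_def)
    have dh: "norm (d (j x)) \<le> h x" if "x \<in> \<Omega>" for x
      using jd[of x] that norm_triangle_sub[of "d (j x)" "\<phi> x"] by (simp add: h_def norm_minus_commute)
    have dy: "\<bar>apply_bcontfun (d (j x)) y\<bar> \<le> h x" if "x \<in> \<Omega>" for x y
      using norm_bounded[of "d (j x)" y] dh[OF that] by simp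
    show "(\<lambda>z. apply_bcontfun (d (j (fst z))) (snd z)) \<in> oscillating \<Omega>"
      by (rule oscillatingI[OF countable_valued_measurable[OF j] hL2]) (use dy in auto)
    define A where "A n = {x\<in>space ?M. j x = n}" for n
    have A: "A n \<in> sets ?M" for n
    proof -
      have "A n = j -` {n} \<inter> space ?M" by (auto simp: A_def)
      then show ?thesis using measurable_sets[OF j, of "{n}"] by simp
    qed
    \<comment> \<open>A function with countably many values is cut off after \<open>N\<close> values to become a finite sum.\<close>
    define tr where "tr N z = (\<Sum>n<N. indicator (A n) (fst z) * apply_bcontfun (d n) (snd z))" for N z
    have trW: "tr N \<in> ?W" for N
    proof (induction N)
      case 0
      have "(\<lambda>z. indicator {} (fst z) * apply_bcontfun (d 0) (snd z)) \<in> ?W" using dC by (intro 3) auto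
      then show ?case by (simp add: tr_def[abs_def])
    next
      case (Suc N)
      have "(\<lambda>z. tr N z + 1 * (indicator (A N) (fst z) * apply_bcontfun (d N) (snd z))) \<in> ?W"
        using dC by (intro add Suc 3 A) auto
      then show ?case by (simp only: tr_def[abs_def] sum.lessThan_Suc mult_1)
    qed
    have tr_eq: "tr N (x, y) = (if j x < N then apply_bcontfun (d (j x)) y else 0)" if "x \<in> \<Omega>" for N x y
    proof -
      have "tr N (x, y) = (\<Sum>n<N. if n = j x then apply_bcontfun (d n) y else 0)"
        unfolding tr_def using that by (intro sum.cong) (auto simp: A_def indicator_def)
      then show ?thesis by simp
    qed
    define hN where "hN N x = (if j x < N then 0 else h x)" for N x
    have hNm: "hN N \<in> borel_measurable ?M" for N
    proof -
      have [measurable]: "h \<in> borel_measurable ?M" using hL2 by (simp add: L2_space_real_iff)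
      note [measurable] = j
      show ?thesis unfolding hN_def by measurable
    qed
    have hNL2: "hN N \<in> L2_space ?M" for N
      by (rule L2_bound[OF hNm hL2]) (auto simp: hN_def)
    have "(\<lambda>N. \<integral>x. (hN N x)\<^sup>2 \<partial>?M) \<longlonglongrightarrow> (\<integral>x. 0 \<partial>?M)"
    proof (rule integral_dominated_convergence[where w="\<lambda>x. (h x)\<^sup>2"])
      show "integrable ?M (\<lambda>x. (h x)\<^sup>2)" using hL2 by (simp add: L2_space_real_iff)
      show "(\<lambda>x. (hN N x)\<^sup>2) \<in> borel_measurable ?M" for N using hNm by measurable
      show "AE x in ?M. (\<lambda>N. (hN N x)\<^sup>2) \<longlonglongrightarrow> 0"
      proof (rule AE_I2)
        fix x
        have "eventually (\<lambda>N. (hN N x)\<^sup>2 = 0) sequentially"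
          using eventually_gt_at_top[of "j x"] by eventually_elim (simp add: hN_def)
        then show "(\<lambda>N. (hN N x)\<^sup>2) \<longlonglongrightarrow> 0" by (rule tendsto_eventually)
      qed
      show "AE x in ?M. norm ((hN N x)\<^sup>2) \<le> (h x)\<^sup>2" for N by (auto simp: hN_def)
    qed simp
    then have lim: "(\<lambda>N. norm_L2 ?M (hN N)) \<longlonglongrightarrow> 0"
      unfolding norm_L2_real using tendsto_real_sqrt by fastforce
    fix \<epsilon> :: real assume \<epsilon>: "\<epsilon> > 0"
    obtain N where "norm_L2 ?M (hN N) < \<epsilon>"
      using LIMSEQ_D[OF lim \<epsilon>] by auto
    moreover have "\<bar>apply_bcontfun (d (j x)) y - tr N (x, y)\<bar> \<le> hN N x" if "x \<in> \<Omega>" for x y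
      using dy[OF that] by (simp add: tr_eq[OF that] hN_def)
    ultimately show "\<exists>g'\<in>?W. \<exists>h\<in>L2_space ?M. (\<forall>x\<in>\<Omega>. \<forall>y. \<bar>apply_bcontfun (d (j (fst (x, y)))) (snd (x, y)) - g' (x, y)\<bar> \<le> (h x :: real)) \<and> norm_L2 ?M h \<le> \<epsilon>"
      by (intro bexI[OF _ trW[of N]] bexI[OF _ hNL2[of N]]) auto
  qed
  show ?thesis
  proof (rule closed)
    show "(\<lambda>z. apply_bcontfun (\<phi> (fst z)) (snd z)) \<in> oscillating \<Omega>"
      by (rule oscillating_L2_C_sharp[OF \<phi>])
    fix e :: real assume e: "e > 0"
    then have es: "e / s > 0" using s by simp
    obtain j where j: "j \<in> ?M \<rightarrow>\<^sub>M count_space UNIV" "\<And>x. x \<in> space ?M \<Longrightarrow> norm (\<phi> x - d (j x)) < e / s"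
      using d[OF es] by blast
    have "norm_L2 ?M (\<lambda>_. e / s) \<le> e / s * s" using es by (intro const) auto
    moreover have "\<bar>apply_bcontfun (\<phi> x) y - apply_bcontfun (d (j x)) y\<bar> \<le> e / s" if "x \<in> \<Omega>" for x y
      using norm_bounded[of "\<phi> x - d (j x)" y] j(2)[of x] that by simp
    ultimately show "\<exists>g'\<in>?W. \<exists>h\<in>L2_space ?M. (\<forall>x\<in>\<Omega>. \<forall>y. \<bar>apply_bcontfun (\<phi> (fst (x, y))) (snd (x, y)) - g' (x, y)\<bar> \<le> (h x :: real)) \<and> norm_L2 ?M h \<le> e"
      using s es by (intro bexI[OF _ 4[OF j es]] bexI[of _ "\<lambda>_. e / s"] const) auto
  qed
qed

section \<open>Two-scale compactness\<close>

text \<open>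
  With the constant functions \<open>1\<close> in place of the sequence and of its limit, membership in
  \<open>osc_converges\<close> is the mean value property: integrals of \<open>g(x, R x / \<eta>)\<close> tend to the integral of
  \<open>g\<close> over \<open>\<Omega> \<times> Y\<close>.
\<close>

lemma trig_mean_value:
  fixes \<Omega> :: "(real ^ 'n) set" and R :: "real ^ 'n ^ 'm"
  assumes \<Omega>: "open \<Omega>" "bounded \<Omega>"
    and R: "\<And>k :: int ^ 'm. k \<noteq> 0 \<Longrightarrow> transpose R *v int_vec k \<noteq> 0"
    and \<eta>: "\<And>n. \<eta> n > 0" "\<eta> \<longlonglongrightarrow> 0"
    and W: "open W" "W \<subseteq> \<Omega>"
  shows "(\<lambda>z. indicator W (fst z) * trig k j (snd z)) \<in> osc_converges \<Omega> R \<eta> (\<lambda>_ _. 1) (\<lambda>_. 1)"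
proof -
  let ?M = "lebesgue_on \<Omega>"
  note fin = finite_measure_lebesgue_on_open[OF \<Omega>]
  have \<Omega>b: "\<Omega> \<in> sets borel" and Wb[measurable]: "W \<in> sets borel" using \<Omega> W by auto
  have Wfin: "emeasure lborel W < \<infinity>"
    using emeasure_mono[OF W(2), of lborel] fin(3) \<Omega>b by (auto simp: order_le_less_trans)
  have WM: "W \<in> sets ?M" using W fin(2) by (simp add: sets_restrict_space_iff)
  let ?g = "\<lambda>z :: (real ^ 'n) \<times> (real ^ 'm). indicator W (fst z) * trig k j (snd z) :: real"
  have o: "?g \<in> oscillating \<Omega>" by (rule oscillating_indicator_trig[OF fin(1) WM])
  have gb: "?g \<in> borel_measurable borel"
    unfolding borel_prod[symmetric] by measurable
  have ind: "indicator \<Omega> x * (indicator W x * c) = indicator W x * c" for x and c :: real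
    using W(2) by (auto simp: indicator_def)
  have "osc_int \<Omega> R (\<eta> n) (\<lambda>_. 1) ?g = (\<integral>x. indicator W x * trig k j ((R *v x) /\<^sub>R \<eta> n) \<partial>lborel)" for n
  proof -
    have [measurable]: "(\<lambda>x. (R *v x) /\<^sub>R \<eta> n) \<in> borel_measurable borel"
      by (intro borel_measurable_continuous_onI continuous_intros)
    have "(\<lambda>x. indicator W x * trig k j ((R *v x) /\<^sub>R \<eta> n)) \<in> borel_measurable borel" by measurable
    from lebesgue_on_borel(2)[OF \<Omega>b this] show ?thesis by (simp add: osc_int_def ind)
  qed
  moreover have "cell_int \<Omega> (\<lambda>_. 1) ?g = measure lborel W * (\<integral>y. trig k j y \<partial>lebesgue_on unit_cell)"
  proof -
    have "?g \<in> L2_space (lebesgue_on (\<Omega> \<times> unit_cell))"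
      using o cell_L2(1)[OF fin(2)] unfolding oscillating_def by blast
    then have int: "integrable (lebesgue_on (\<Omega> \<times> unit_cell)) ?g"
      by (intro L2_integrable finite_measure_Times_cell \<Omega>)
    have "(\<integral>z. ?g z \<partial>lebesgue_on (\<Omega> \<times> unit_cell)) = (\<integral>x. (\<integral>y. ?g (x, y) \<partial>lebesgue_on unit_cell) \<partial>?M)"
      by (rule Fubini_cell(3)[OF \<Omega>b gb int])
    also have "\<dots> = (\<integral>x. indicator W x * (\<integral>y. trig k j y \<partial>lebesgue_on unit_cell) \<partial>?M)" by simp
    also have "\<dots> = (\<integral>x. indicator W x * (\<integral>y. trig k j y \<partial>lebesgue_on unit_cell) \<partial>lborel)"
      by (subst lebesgue_on_borel(2)[OF \<Omega>b]) (simp_all add: ind)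
    also have "\<dots> = measure lborel W * (\<integral>y. trig k j y \<partial>lebesgue_on unit_cell)"
      using Wfin by simp
    finally show ?thesis by (simp add: cell_int_def)
  qed
  ultimately show ?thesis
    using trig_equidistribution[OF R \<eta> W(1) Wfin, of k j] o by (simp add: osc_converges_def)
qed

text \<open>
  The linear span of the products of an indicator of a box union and a trigonometric function.
\<close>

inductive_set trig_steps :: "(real ^ 'n) set \<Rightarrow> ((real ^ 'n) \<times> (real ^ 'm) \<Rightarrow> real) set"
  for \<Omega> :: "(real ^ 'n) set" where
  zero: "(\<lambda>_. 0) \<in> trig_steps \<Omega>"
| step: "g \<in> trig_steps \<Omega> \<Longrightarrow> U \<in> box_unions \<Omega> \<Longrightarrow>
    (\<lambda>z. g z + c * (indicator U (fst z) * trig k j (snd z))) \<in> trig_steps \<Omega>"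

lemma trig_steps_add:
  assumes "h \<in> trig_steps \<Omega>" "g \<in> trig_steps \<Omega>"
  shows "(\<lambda>z. g z + c * h z) \<in> trig_steps \<Omega>"
  using assms(1)
proof (induction rule: trig_steps.induct)
  case zero
  then show ?case using assms(2) by simp
next
  case (step h U c' k j)
  have "(\<lambda>z. (g z + c * h z) + (c * c') * (indicator U (fst z) * trig k j (snd z))) \<in> trig_steps \<Omega>"
    by (intro trig_steps.step step)
  then show ?case by (simp add: algebra_simps)
qed

lemma trig_steps_basis: "U \<in> box_unions \<Omega> \<Longrightarrow> (\<lambda>z. indicator U (fst z) * trig k j (snd z)) \<in> trig_steps \<Omega>"
  using trig_steps.step[OF trig_steps.zero, of U \<Omega> 1 k j] by simp

lemma box_unions_measurable:
  assumes "open \<Omega>" "bounded \<Omega>" "U \<in> box_unions \<Omega>"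
  shows "U \<in> sets (lebesgue_on \<Omega>)"
  using box_unions_open[OF assms(3)] box_unions_subset[OF assms(3)] finite_measure_lebesgue_on_open(2)[OF assms(1,2)]
  by (simp add: sets_restrict_space_iff)

lemma trig_steps_oscillating:
  assumes \<Omega>: "open \<Omega>" "bounded \<Omega>" and "g \<in> trig_steps \<Omega>"
  shows "g \<in> oscillating \<Omega>"
  using assms(3)
proof (induction rule: trig_steps.induct)
  case zero
  show ?case by (rule oscillatingI[where h="\<lambda>_. 0"]) (auto simp: L2_space_def)
next
  case (step g U c k j)
  then show ?case
    by (intro oscillating_add oscillating_indicator_trig finite_measure_lebesgue_on_open box_unions_measurable \<Omega>)
qed

text \<open>
  Taken with \<open>g = h\<close>, this says that the norm of \<open>g(x, R x / \<eta>)\<close> tends to the norm of \<open>g\<close> in \<open>L\<^sup>2(\<Omega> \<times> Y)\<close>.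
  It holds because products of generators are again combinations of such functions.
\<close>

lemma trig_steps_mult_mean_value:
  fixes \<Omega> :: "(real ^ 'n) set" and R :: "real ^ 'n ^ 'm"
  assumes \<Omega>: "open \<Omega>" "bounded \<Omega>"
    and R: "\<And>k :: int ^ 'm. k \<noteq> 0 \<Longrightarrow> transpose R *v int_vec k \<noteq> 0"
    and \<eta>: "\<And>n. \<eta> n > 0" "\<eta> \<longlonglongrightarrow> 0"
    and g: "g \<in> trig_steps \<Omega>" and h: "h \<in> trig_steps \<Omega>"
  shows "(\<lambda>z. g z * h z) \<in> osc_converges \<Omega> R \<eta> (\<lambda>_ _. 1) (\<lambda>_. 1)"
proof -
  let ?W = "osc_converges \<Omega> R \<eta> (\<lambda>_ _. 1) (\<lambda>_. 1)"
  note fin = finite_measure_lebesgue_on_open[OF \<Omega>]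
  have one: "(\<lambda>_. 1 :: real) \<in> L2_space (lebesgue_on \<Omega>)"
    "(\<lambda>_. 1 :: real) \<in> L2_space (lebesgue_on (\<Omega> \<times> (unit_cell :: (real ^ 'm) set)))"
    using finite_measure.integrable_const[OF fin(1)] finite_measure.integrable_const[OF finite_measure_Times_cell[OF \<Omega>]]
    by (auto simp: L2_space_real_iff)
  note add = osc_converges_add[OF fin(2) one(1) one(2)]
  note basis = trig_mean_value[OF \<Omega> R \<eta>]
  have zero: "(\<lambda>_. 0) \<in> ?W"
    using basis[of "{}" 0 0] by simp
  have bb: "(\<lambda>z. (indicator U (fst z) * trig k j (snd z)) * (indicator U' (fst z) * trig k' j' (snd z))) \<in> ?W"
    if U: "U \<in> box_unions \<Omega>" "U' \<in> box_unions \<Omega>" for U U' k j k' j'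
  proof -
    have I: "open (U \<inter> U')" "U \<inter> U' \<subseteq> \<Omega>"
      using box_unions_open[OF U(1)] box_unions_open[OF U(2)] box_unions_subset[OF U(1)] by auto
    have "(\<lambda>z. ((\<lambda>_. 0) z + 1/2 * (indicator (U \<inter> U') (fst z) * trig (k + k') (j + j') (snd z))) +
       1/2 * (indicator (U \<inter> U') (fst z) * trig (k - k') (j - j') (snd z))) \<in> ?W"
      by (intro add zero basis I)
    moreover have "(indicator U (fst z) * trig k j (snd z)) * (indicator U' (fst z) * trig k' j' (snd z)) =
       ((\<lambda>_. 0) z + 1/2 * (indicator (U \<inter> U') (fst z) * trig (k + k') (j + j') (snd z))) +
       1/2 * (indicator (U \<inter> U') (fst z) * trig (k - k') (j - j') (snd z))" for z :: "(real ^ 'n) \<times> (real ^ 'm)"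
      using trig_mult[of k j "snd z" k' j'] by (simp add: indicator_def)
    ultimately show ?thesis by (simp only:)
  qed
  have bh: "(\<lambda>z. h z * (indicator U (fst z) * trig k j (snd z))) \<in> ?W"
    if U: "U \<in> box_unions \<Omega>" and "h \<in> trig_steps \<Omega>" for U k j h
    using that(2)
  proof (induction rule: trig_steps.induct)
    case zero
    show ?case using \<open>(\<lambda>_. 0) \<in> ?W\<close> by simp
  next
    case (step g U' c k' j')
    have "(\<lambda>z. g z * (indicator U (fst z) * trig k j (snd z)) +
       c * ((indicator U' (fst z) * trig k' j' (snd z)) * (indicator U (fst z) * trig k j (snd z)))) \<in> ?W"
      by (intro add step bb U)
    then show ?case by (simp only: distrib_right mult.assoc)
  qed
  show ?thesis
    using g
  proof (induction rule: trig_steps.induct)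
    case zero
    show ?case using \<open>(\<lambda>_. 0) \<in> ?W\<close> by simp
  next
    case (step g U c k j)
    have "(\<lambda>z. g z * h z + c * (h z * (indicator U (fst z) * trig k j (snd z)))) \<in> ?W"
      by (intro add step bh h)
    then show ?case by (simp add: algebra_simps)
  qed
qed

text \<open>
  A diagonal subsequence makes the integrals against the countably many generators converge. By
  the mean value property of squares the limit functional is bounded by \<open>C\<close> times the norm in
  \<open>L\<^sup>2(\<Omega> \<times> Y)\<close>, hence represented by some \<open>u\<close>. A Borel representative of \<open>u\<close> is chosen so that all its
  sections are measurable.
\<close>

lemma two_scale_compactness:
  fixes \<Omega> :: "(real ^ 3) set" and R :: "real ^ 3 ^ 'm"
  assumes \<Omega>: "open \<Omega>" "bounded \<Omega>"
    and R: "\<And>k :: int ^ 'm. k \<noteq> 0 \<Longrightarrow> transpose R *v int_vec k \<noteq> 0"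
    and \<eta>: "\<And>n. \<eta> n > 0" "\<eta> \<longlonglongrightarrow> 0"
    and f: "L2_bounded_seq (lebesgue_on \<Omega>) (f :: nat \<Rightarrow> real ^ 3 \<Rightarrow> real)"
  obtains r u where "strict_mono (r :: nat \<Rightarrow> nat)" "u \<in> borel_measurable borel"
    "two_scale_converges \<Omega> R (\<eta> \<circ> r) (f \<circ> r) (\<lambda>x y. u (x, y))"
proof -
  let ?M = "lebesgue_on \<Omega>" and ?N = "lebesgue_on (\<Omega> \<times> (unit_cell :: (real ^ 'm) set))"
  note fin = finite_measure_lebesgue_on_open[OF \<Omega>] and finN = finite_measure_Times_cell[OF \<Omega>, where 'm='m]
  have fL2: "f n \<in> L2_space ?M" for n using f by (simp add: L2_bounded_seq_def)
  obtain C where C: "\<And>n. norm_L2 ?M (f n) \<le> C" using f by (auto simp: L2_bounded_seq_def)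
  have C0: "C \<ge> 0" using C[of 0] norm_L2_nonneg[of ?M "f 0"] by linarith
  define b where "b = (\<lambda>(U, k, j). \<lambda>z :: (real ^ 3) \<times> (real ^ 'm). indicator U (fst z) * trig k j (snd z) :: real)"
  define I where "I = box_unions \<Omega> \<times> (UNIV :: (int ^ 'm) set) \<times> (UNIV :: int set)"
  have "countable I" unfolding I_def
    by (intro countable_SIGMA countable_box_unions countable_int_vec) auto
  have one: "(\<lambda>_. 1 :: real) \<in> L2_space ?M"
    using finite_measure.integrable_const[OF fin(1)] by (auto simp: L2_space_real_iff)
  have bound: "norm (osc_int \<Omega> R (\<eta> n) (f n) (b i)) \<le> C * norm_L2 ?M (\<lambda>_. 1 :: real)" if "i \<in> I" for n i
  proof -
    obtain U k j where i: "i = (U, k, j)" "U \<in> box_unions \<Omega>" using \<open>i \<in> I\<close> by (auto simp: I_def)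
    have bo: "b i \<in> oscillating \<Omega>"
      unfolding b_def i using box_unions_measurable[OF \<Omega> i(2)] by (auto intro!: oscillating_indicator_trig fin)
    have "\<bar>osc_int \<Omega> R (\<eta> n) (f n) (b i)\<bar> \<le> norm_L2 ?M (f n) * norm_L2 ?M (\<lambda>_. 1 :: real)"
    proof (rule osc_int_bound[OF _ one _ fL2])
      show "b i \<in> borel_measurable (?M \<Otimes>\<^sub>M borel)" using bo by (simp add: oscillating_def)
      show "\<bar>b i (x, y)\<bar> \<le> 1" for x y by (simp add: b_def i abs_mult indicator_def abs_trig_le)
    qed
    also have "\<dots> \<le> C * norm_L2 ?M (\<lambda>_. 1 :: real)" by (intro mult_right_mono C) simp
    finally show ?thesis by simp
  qed
  obtain r where r: "strict_mono (r :: nat \<Rightarrow> nat)"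
    and rconv: "\<And>i. i \<in> I \<Longrightarrow> \<exists>l. (\<lambda>n. osc_int \<Omega> R (\<eta> (r n)) (f (r n)) (b i)) \<longlonglongrightarrow> l"
    using function_convergent_subsequence[OF \<open>countable I\<close>,
        of "\<lambda>n i. osc_int \<Omega> R (\<eta> n) (f n) (b i)" "C * norm_L2 ?M (\<lambda>_. 1 :: real)"] bound by blast
  define L where "L n g = osc_int \<Omega> R (\<eta> (r n)) (f (r n)) g" for n and g :: "(real ^ 3) \<times> (real ^ 'm) \<Rightarrow> real"
  define F where "F g = lim (\<lambda>n. L n g)" for g
  note osc = trig_steps_oscillating[OF \<Omega>]
  have Ladd: "L n (\<lambda>z. g z + c * h z) = L n g + c * L n h" if "g \<in> oscillating \<Omega>" "h \<in> oscillating \<Omega>" for n g h c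
    unfolding L_def by (rule osc_int_add[OF fL2 that])
  have conv: "convergent (\<lambda>n. L n g)" if "g \<in> trig_steps \<Omega>" for g
    using that
  proof (induction rule: trig_steps.induct)
    case zero
    show ?case by (simp add: L_def osc_int_def convergent_const)
  next
    case (step g U c k j)
    have bo: "(\<lambda>z. indicator U (fst z) * trig k j (snd z)) \<in> oscillating \<Omega>"
      by (intro osc trig_steps_basis step)
    have "convergent (\<lambda>n. L n (\<lambda>z. indicator U (fst z) * trig k j (snd z)))"
      using rconv[of "(U, k, j)"] step by (auto simp: I_def b_def L_def convergent_def)
    then have "convergent (\<lambda>n. L n g + c * L n (\<lambda>z. indicator U (fst z) * trig k j (snd z)))"
      by (intro convergent_add step convergent_mult convergent_const)
    then show ?case by (simp only: Ladd[OF osc[OF step(1)] bo])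
  qed
  have lim: "(\<lambda>n. L n g) \<longlonglongrightarrow> F g" if "g \<in> trig_steps \<Omega>" for g
    using conv[OF that] by (simp add: F_def convergent_LIMSEQ_iff)
  have Fadd: "F (\<lambda>z. g z + c * h z) = F g + c * F h" if g: "g \<in> trig_steps \<Omega>" and h: "h \<in> trig_steps \<Omega>" for g h c
  proof -
    have "(\<lambda>n. L n (\<lambda>z. g z + c * h z)) \<longlonglongrightarrow> F g + c * F h"
      unfolding Ladd[OF osc[OF g] osc[OF h]] by (intro tendsto_intros lim g h)
    then show ?thesis using lim[OF trig_steps_add[OF h g, of c]] LIMSEQ_unique by blast
  qed
  have gL2: "g \<in> L2_space ?N" if "g \<in> oscillating \<Omega>" for g :: "(real ^ 3) \<times> (real ^ 'm) \<Rightarrow> real"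
    using that cell_L2(1)[OF fin(2)] unfolding oscillating_def by blast
  have \<eta>r: "\<And>n. (\<eta> \<circ> r) n > 0" "(\<eta> \<circ> r) \<longlonglongrightarrow> 0"
    using \<eta>(1) LIMSEQ_subseq_LIMSEQ[OF \<eta>(2) r] by auto
  have Fbound: "\<bar>F g\<bar> \<le> C * norm_L2 ?N g" if g: "g \<in> trig_steps \<Omega>" for g
  proof (rule LIMSEQ_le)
    show "(\<lambda>n. \<bar>L n g\<bar>) \<longlonglongrightarrow> \<bar>F g\<bar>" by (intro tendsto_rabs lim g)
    have "(\<lambda>n. osc_int \<Omega> R (\<eta> (r n)) (\<lambda>_. 1) (\<lambda>z. g z * g z)) \<longlonglongrightarrow> cell_int \<Omega> (\<lambda>_. 1) (\<lambda>z. g z * g z)"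
      using trig_steps_mult_mean_value[OF \<Omega> R \<eta>r g g] by (simp add: osc_converges_def)
    then have "(\<lambda>n. C * sqrt (osc_int \<Omega> R (\<eta> (r n)) (\<lambda>_. 1) (\<lambda>z. g z * g z))) \<longlonglongrightarrow>
       C * sqrt (cell_int \<Omega> (\<lambda>_. 1) (\<lambda>z. g z * g z))"
      by (intro tendsto_intros)
    then show "(\<lambda>n. C * sqrt (osc_int \<Omega> R (\<eta> (r n)) (\<lambda>_. 1) (\<lambda>z. g z * g z))) \<longlonglongrightarrow> C * norm_L2 ?N g"
      by (simp add: cell_int_def norm_L2_real power2_eq_square)
    have "\<bar>L n g\<bar> \<le> C * sqrt (osc_int \<Omega> R (\<eta> (r n)) (\<lambda>_. 1) (\<lambda>z. g z * g z))" for n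
    proof -
      let ?t = "\<lambda>x. g (x, (R *v x) /\<^sub>R \<eta> (r n))"
      have "?t \<in> L2_space ?M" using osc[OF g] trace_L2(1) unfolding oscillating_def by blast
      then have "\<bar>L n g\<bar> \<le> norm_L2 ?M (f (r n)) * norm_L2 ?M ?t"
        unfolding L_def osc_int_def by (intro L2_Cauchy_Schwarz fL2)
      also have "\<dots> \<le> C * norm_L2 ?M ?t" by (intro mult_right_mono C) simp
      finally show ?thesis by (simp add: osc_int_def norm_L2_real power2_eq_square)
    qed
    then show "\<exists>N. \<forall>n\<ge>N. \<bar>L n g\<bar> \<le> C * sqrt (osc_int \<Omega> R (\<eta> (r n)) (\<lambda>_. 1) (\<lambda>z. g z * g z))" by blast
  qed
  obtain u where u: "u \<in> L2_space ?N" and uF: "\<And>g. g \<in> trig_steps \<Omega> \<Longrightarrow> F g = (\<integral>z. u z * g z \<partial>?N)"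
  proof (rule Riesz_representation_subspace[OF finN _ trig_steps.zero trig_steps_add Fadd Fbound])
    show "trig_steps \<Omega> \<subseteq> L2_space ?N" using osc gL2 by blast
  qed (use that in blast)+
  have NS: "\<Omega> \<times> (unit_cell :: (real ^ 'm) set) \<inter> space lebesgue \<in> sets lebesgue"
    using lebesgue_Times_cell(1)[OF fin(2)] by simp
  have "(\<lambda>z. indicator (\<Omega> \<times> unit_cell) z *\<^sub>R u z) \<in> borel_measurable lebesgue"
    using u borel_measurable_restrict_space_iff[OF NS, of u] by (simp add: L2_space_def)
  \<comment> \<open>The Borel representative of \<open>u\<close>, extended by \<open>0\<close> outside \<open>\<Omega> \<times> Y\<close>.\<close>
  then obtain v where v: "v \<in> borel_measurable lborel" "AE z in lborel. indicator (\<Omega> \<times> unit_cell) z *\<^sub>R u z = v z"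
    using completion_ex_borel_measurable_real by blast
  have vb: "v \<in> borel_measurable borel" using v(1) by simp
  have vm: "v \<in> borel_measurable ?N" by (rule lebesgue_on_borel_measurable[OF vb])
  have uv: "AE z in ?N. u z = v z"
    using v(2) NS by (subst AE_lebesgue_on) (auto elim!: eventually_mono)
  have vL2: "v \<in> L2_space ?N"
    by (rule L2_bound[OF vm u]) (use uv in \<open>auto elim!: eventually_mono\<close>)
  have vF: "F g = cell_int \<Omega> v g" if g: "g \<in> trig_steps \<Omega>" for g
  proof -
    have "g \<in> borel_measurable ?N" using gL2[OF osc[OF g]] by (simp add: L2_space_def)
    then show ?thesis
      unfolding uF[OF g] cell_int_def
      using u vm uv by (intro integral_cong_AE) (auto simp: L2_space_def elim!: eventually_mono)
  qed
  have base: "(\<lambda>z. indicator U (fst z) * trig k j (snd z)) \<in> osc_converges \<Omega> R (\<eta> \<circ> r) (f \<circ> r) v"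
    if U: "U \<in> box_unions \<Omega>" for U k j
    using lim[OF trig_steps_basis[OF U, of k j]] osc[OF trig_steps_basis[OF U, of k j]]
    unfolding vF[OF trig_steps_basis[OF U, of k j]] by (simp add: osc_converges_def L_def)
  have fr: "\<And>n. (f \<circ> r) n \<in> L2_space ?M" "\<And>n. norm_L2 ?M ((f \<circ> r) n) \<le> C"
    using fL2 C by auto
  have "two_scale_converges \<Omega> R (\<eta> \<circ> r) (f \<circ> r) (\<lambda>x y. v (x, y))"
    unfolding two_scale_converges_def
  proof (intro conjI allI ballI)
    show "(f \<circ> r) n \<in> L2_space ?M" for n by (rule fr)
    show "(\<lambda>(x, y). v (x, y)) \<in> L2_space ?N" using vL2 by simp
    fix \<phi> :: "real ^ 3 \<Rightarrow> (real ^ 'm) \<Rightarrow>\<^sub>C real" assume "\<phi> \<in> L2_C_sharp \<Omega>"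
    then have \<phi>: "\<phi> \<in> L2_space ?M" "\<And>x. x \<in> \<Omega> \<Longrightarrow> \<phi> x \<in> C_sharp" by (auto simp: L2_C_sharp_def)
    have "(\<lambda>z. apply_bcontfun (\<phi> (fst z)) (snd z)) \<in> osc_converges \<Omega> R (\<eta> \<circ> r) (f \<circ> r) v"
      by (rule osc_converges_from_basis[OF \<Omega> fr vL2 base \<phi>])
    then show "(\<lambda>n. \<integral>x. (f \<circ> r) n x * apply_bcontfun (\<phi> x) ((R *v x) /\<^sub>R (\<eta> \<circ> r) n) \<partial>?M) \<longlonglongrightarrow>
        (\<integral>(x, y). v (x, y) * apply_bcontfun (\<phi> x) y \<partial>?N)"
      by (simp add: osc_converges_def osc_int_def cell_int_def split_beta')
  qed
  with r vb show ?thesis by (rule that)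
qed

section \<open>Identification of the divergence\<close>

lemma two_scale_converges_subseq:
  assumes "two_scale_converges \<Omega> R \<eta> f u" "strict_mono r"
  shows "two_scale_converges \<Omega> R (\<eta> \<circ> r) (f \<circ> r) u"
  unfolding two_scale_converges_def
proof (intro conjI allI ballI)
  show "(f \<circ> r) n \<in> L2_space (lebesgue_on \<Omega>)" for n
    using assms(1) by (simp add: two_scale_converges_def)
  show "(\<lambda>(x, y). u x y) \<in> L2_space (lebesgue_on (\<Omega> \<times> unit_cell))"
    using assms(1) by (simp add: two_scale_converges_def)
  fix \<phi> :: "real ^ 3 \<Rightarrow> (real ^ 'a) \<Rightarrow>\<^sub>C real" assume "\<phi> \<in> L2_C_sharp \<Omega>"
  then have "(\<lambda>n. \<integral>x. f n x * apply_bcontfun (\<phi> x) ((R *v x) /\<^sub>R \<eta> n) \<partial>lebesgue_on \<Omega>)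
      \<longlonglongrightarrow> (\<integral>(x, y). u x y * apply_bcontfun (\<phi> x) y \<partial>lebesgue_on (\<Omega> \<times> unit_cell))"
    using assms(1) by (simp add: two_scale_converges_def)
  from LIMSEQ_subseq_LIMSEQ[OF this assms(2)]
  show "(\<lambda>n. \<integral>x. (f \<circ> r) n x * apply_bcontfun (\<phi> x) ((R *v x) /\<^sub>R (\<eta> \<circ> r) n) \<partial>lebesgue_on \<Omega>)
      \<longlonglongrightarrow> (\<integral>(x, y). u x y * apply_bcontfun (\<phi> x) y \<partial>lebesgue_on (\<Omega> \<times> unit_cell))"
    by (simp add: o_def)
qed

lemma two_scale_converges_cong:
  assumes "two_scale_converges \<Omega> R \<eta> f u" and eq: "\<And>x y. y \<in> unit_cell \<Longrightarrow> u' x y = u x y"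
  shows "two_scale_converges \<Omega> R \<eta> f u'"
proof -
  have L2: "(\<lambda>(x, y). u' x y) \<in> L2_space (lebesgue_on (\<Omega> \<times> unit_cell)) \<longleftrightarrow>
      (\<lambda>(x, y). u x y) \<in> L2_space (lebesgue_on (\<Omega> \<times> unit_cell))"
    unfolding L2_space_def mem_Collect_eq
    by (intro arg_cong2[where f="(\<and>)"] measurable_cong Bochner_Integration.integrable_cong refl) (auto simp: eq)
  have int: "(\<integral>(x, y). u' x y * apply_bcontfun (\<phi> x) y \<partial>lebesgue_on (\<Omega> \<times> unit_cell)) =
      (\<integral>(x, y). u x y * apply_bcontfun (\<phi> x) y \<partial>lebesgue_on (\<Omega> \<times> unit_cell))" for \<phi> :: "real ^ 3 \<Rightarrow> (real ^ 'a) \<Rightarrow>\<^sub>C real"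
    by (intro Bochner_Integration.integral_cong refl) (auto simp: eq)
  show ?thesis using assms(1) unfolding two_scale_converges_def L2 int .
qed

lemma two_scale_compactness_finite:
  fixes \<Omega> :: "(real ^ 3) set" and R :: "real ^ 3 ^ 'm" and f :: "'i \<Rightarrow> nat \<Rightarrow> real ^ 3 \<Rightarrow> real"
  assumes \<Omega>: "open \<Omega>" "bounded \<Omega>"
    and R: "\<And>k :: int ^ 'm. k \<noteq> 0 \<Longrightarrow> transpose R *v int_vec k \<noteq> 0"
    and \<eta>: "\<And>n. \<eta> n > 0" "\<eta> \<longlonglongrightarrow> 0"
    and f: "\<And>i. L2_bounded_seq (lebesgue_on \<Omega>) (f i)" and A: "finite A"
  shows "\<exists>r. strict_mono (r :: nat \<Rightarrow> nat) \<and> (\<forall>i\<in>A. \<exists>u\<in>borel_measurable borel.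
    two_scale_converges \<Omega> R (\<eta> \<circ> r) (f i \<circ> r) (\<lambda>x y. u (x, y)))"
  using A
proof (induction A)
  case empty
  then show ?case by (auto intro: strict_mono_id)
next
  case (insert i A)
  then obtain r where r: "strict_mono (r :: nat \<Rightarrow> nat)" and conv: "\<And>i. i \<in> A \<Longrightarrow> \<exists>u\<in>borel_measurable borel.
    two_scale_converges \<Omega> R (\<eta> \<circ> r) (f i \<circ> r) (\<lambda>x y. u (x, y))" by blast
  have \<eta>r: "\<And>n. (\<eta> \<circ> r) n > 0" "(\<eta> \<circ> r) \<longlonglongrightarrow> 0"
    using \<eta>(1) LIMSEQ_subseq_LIMSEQ[OF \<eta>(2) r] by auto
  have "L2_bounded_seq (lebesgue_on \<Omega>) (f i \<circ> r)"
    using f[of i] by (auto simp: L2_bounded_seq_def)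
  then obtain r' u where r': "strict_mono (r' :: nat \<Rightarrow> nat)" "u \<in> borel_measurable borel"
    "two_scale_converges \<Omega> R ((\<eta> \<circ> r) \<circ> r') ((f i \<circ> r) \<circ> r') (\<lambda>x y. u (x, y))"
    using two_scale_compactness[OF \<Omega> R \<eta>r] by metis
  have "\<exists>u\<in>borel_measurable borel. two_scale_converges \<Omega> R (\<eta> \<circ> (r \<circ> r')) (f l \<circ> (r \<circ> r')) (\<lambda>x y. u (x, y))"
    if "l \<in> insert i A" for l
  proof (cases "l = i")
    case True
    then show ?thesis using r' by (auto simp: o_assoc)
  next
    case False
    then show ?thesis
      using that conv[of l] two_scale_converges_subseq[OF _ r'(1)] by (force simp: o_assoc)
  qed
  then show ?case using strict_mono_o[OF r r'(1)] by blast
qed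

text \<open>
  Composition with this map extends a function from the cell to a periodic function.
\<close>

definition cell_rep :: "real ^ 'm \<Rightarrow> real ^ 'm" where
  "cell_rep y = (\<chi> i. frac (y $ i))"

lemma cell_rep_periodic: "cell_rep (y + int_vec k) = cell_rep y"
  by (simp add: cell_rep_def int_vec_def vec_eq_iff frac_def)

lemma cell_rep_unit_cell: "y \<in> unit_cell \<Longrightarrow> cell_rep y = y"
  by (simp add: cell_rep_def unit_cell_def vec_eq_iff frac_eq less_imp_le)

lemma periodic_continuous_bcontfun:
  fixes f :: "real ^ 'm \<Rightarrow> real"
  assumes cont: "continuous_on UNIV f" and per: "cell_periodic f"
  shows "f \<in> bcontfun"
proof -
  have "compact (f ` cbox 0 1)"
    using cont by (intro compact_continuous_image) (auto intro: continuous_on_subset)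
  then have "bounded (f ` cbox 0 1)" by (rule compact_imp_bounded)
  then obtain b where b: "\<And>y. y \<in> cbox 0 1 \<Longrightarrow> norm (f y) \<le> b"
    by (auto simp: bounded_iff)
  show ?thesis
  proof (rule bcontfun_normI[OF cont])
    fix y :: "real ^ 'm"
    have "y + int_vec (\<chi> i. - \<lfloor>y $ i\<rfloor>) \<in> cbox 0 1"
      by (auto simp: mem_box_cart int_vec_def) linarith+
    from b[OF this] show "norm (f y) \<le> b" using per by (simp add: cell_periodic_def)
  qed
qed

lemma derivative_eq_grad:
  assumes "f differentiable (at z)"
  shows "frechet_derivative f (at z) v = grad f z \<bullet> v"
proof -
  have lin: "linear (frechet_derivative f (at z))"
    using assms by (intro linear_frechet_derivative)
  have "v = (\<Sum>i\<in>UNIV. (v $ i) *\<^sub>R axis i 1)"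
    using basis_expansion[of v] by (simp add: scalar_mult_eq_scaleR)
  then have "frechet_derivative f (at z) v = frechet_derivative f (at z) (\<Sum>i\<in>UNIV. (v $ i) *\<^sub>R axis i 1)"
    by (rule arg_cong)
  also have "\<dots> = (\<Sum>i\<in>UNIV. v $ i * frechet_derivative f (at z) (axis i 1))"
    by (simp add: linear_sum[OF lin] linear_scale[OF lin])
  finally have "frechet_derivative f (at z) v = (\<Sum>i\<in>UNIV. v $ i * frechet_derivative f (at z) (axis i 1))" .
  then show ?thesis by (simp add: grad_def inner_vec_def mult.commute)
qed

lemma C_infinity_differentiable: "C_infinity f \<Longrightarrow> f differentiable (at z)"
  unfolding C_infinity_def using C_k.simps(2) by blast

lemma C_infinity_continuous: "C_infinity f \<Longrightarrow> continuous_on UNIV f"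
  unfolding C_infinity_def using C_k.simps(1) by blast

lemma C_infinity_grad_continuous: "C_infinity f \<Longrightarrow> continuous_on UNIV (\<lambda>z. grad f z $ i)"
proof -
  assume "C_infinity f"
  then have "C_k (Suc 0) f" by (simp add: C_infinity_def del: C_k.simps)
  moreover have "axis i 1 \<in> (Basis :: (real ^ 'a) set)" by (simp add: axis_in_Basis_iff)
  ultimately show ?thesis by (simp add: grad_def)
qed

lemma grad_periodic:
  assumes "C_infinity w" "cell_periodic w"
  shows "grad w (y + int_vec k) = grad w y"
proof -
  have "(w has_derivative frechet_derivative w (at (y + int_vec k))) (at (y + int_vec k))"
    using C_infinity_differentiable[OF assms(1)] frechet_derivative_works by blast
  moreover have "((\<lambda>z. z + int_vec k) has_derivative (\<lambda>h. h)) (at y)"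
    by (auto intro!: derivative_eq_intros)
  ultimately have "((\<lambda>z. w (z + int_vec k)) has_derivative frechet_derivative w (at (y + int_vec k))) (at y)"
    using has_derivative_compose by blast
  moreover have "(\<lambda>z. w (z + int_vec k)) = w" using assms(2) by (simp add: cell_periodic_def)
  ultimately have "frechet_derivative w (at (y + int_vec k)) = frechet_derivative w (at y)"
    using frechet_derivative_at by metis
  then show ?thesis by (simp add: grad_def)
qed

lemma C_sharp_scaleR_L2:
  fixes g :: "real ^ 3 \<Rightarrow> real" and W :: "(real ^ 'm) \<Rightarrow>\<^sub>C real"
  assumes \<Omega>: "open \<Omega>" "bounded \<Omega>" and g: "continuous_on UNIV g" and W: "W \<in> C_sharp"
  shows "(\<lambda>x. g x *\<^sub>R W) \<in> L2_C_sharp \<Omega>"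
proof -
  note fin = finite_measure_lebesgue_on_open[OF \<Omega>]
  have gm: "g \<in> borel_measurable (lebesgue_on \<Omega>)"
    using g by (intro lebesgue_on_borel_measurable borel_measurable_continuous_onI)
  have "compact (g ` closure \<Omega>)"
    using g \<Omega>(2) by (intro compact_continuous_image) (auto intro: continuous_on_subset)
  then obtain B where B: "\<And>x. x \<in> closure \<Omega> \<Longrightarrow> norm (g x) \<le> B"
    using compact_imp_bounded by (fastforce simp: bounded_iff)
  have B': "\<bar>g x\<bar> \<le> \<bar>B\<bar> * indicator (space (lebesgue_on \<Omega>)) x" if "x \<in> space (lebesgue_on \<Omega>)" for x
    using B[of x] that closure_subset[of \<Omega>] by fastforce
  have "g \<in> L2_space (lebesgue_on \<Omega>)"
    by (rule norm_L2_indicator_le(1)[OF fin(1) gm _ _ B']) auto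
  then have int: "integrable (lebesgue_on \<Omega>) (\<lambda>x. (g x)\<^sup>2)" by (simp add: L2_space_real_iff)
  have "(\<lambda>t. t *\<^sub>R W) \<in> borel_measurable borel"
    by (intro borel_measurable_continuous_onI continuous_intros)
  from measurable_compose[OF gm this] have "(\<lambda>x. g x *\<^sub>R W) \<in> borel_measurable (lebesgue_on \<Omega>)" .
  moreover have "integrable (lebesgue_on \<Omega>) (\<lambda>x. (norm (g x *\<^sub>R W))\<^sup>2)"
    using int by (simp add: power_mult_distrib)
  ultimately show ?thesis
    using subspace_scale[OF subspace_C_sharp W] by (simp add: L2_C_sharp_def L2_space_def)
qed

text \<open>
  A subset of a separable metric space is separable: for every point of a countable dense set of
  the ambient space and every radius \<open>1 / (n + 1)\<close> one element of \<open>X\<close> nearby is chosen, if there is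
  any.
\<close>

lemma countable_dense_family:
  fixes P :: "'x \<Rightarrow> 'i::finite \<Rightarrow> ((real ^ 'm) \<Rightarrow>\<^sub>C real)"
  assumes P: "\<And>w i. w \<in> X \<Longrightarrow> P w i \<in> C_sharp"
  obtains X0 where "countable X0" "X0 \<subseteq> X"
    "\<And>w e. w \<in> X \<Longrightarrow> e > 0 \<Longrightarrow> \<exists>w'\<in>X0. \<forall>i. norm (P w i - P w' i) < e"
proof -
  obtain D :: "((real ^ 'm) \<Rightarrow>\<^sub>C real) set"
    where D: "countable D" "D \<subseteq> C_sharp" "\<And>q e. q \<in> C_sharp \<Longrightarrow> e > 0 \<Longrightarrow> \<exists>d\<in>D. norm (q - d) < e"
    by (rule countable_dense_C_sharp) blast
  define near where "near c n w \<longleftrightarrow> w \<in> X \<and> (\<forall>i. norm (P w i - c i) < 1 / real (Suc n))" for c n w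
  define J where "J = {(c, n). c \<in> (UNIV \<rightarrow>\<^sub>E D) \<and> (\<exists>w. near c n w)}"
  define X0 where "X0 = (\<lambda>(c, n). SOME w. near c n w) ` J"
  have sel: "near c n (SOME w. near c n w)" if "(c, n) \<in> J" for c n
    using that by (auto simp: J_def intro: someI_ex)
  have cP: "countable ((UNIV :: 'i set) \<rightarrow>\<^sub>E D)" by (intro countable_PiE) (auto simp: D)
  have "countable (((UNIV :: 'i set) \<rightarrow>\<^sub>E D) \<times> (UNIV :: nat set))"
    by (intro countable_SIGMA cP) auto
  then have "countable J" by (rule countable_subset[rotated]) (auto simp: J_def)
  then have "countable X0" unfolding X0_def by (rule countable_image)
  moreover have "X0 \<subseteq> X"
  proof
    fix w assume "w \<in> X0"
    then obtain c n where "(c, n) \<in> J" "w = (SOME w. near c n w)" by (auto simp: X0_def)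
    then show "w \<in> X" using sel[of c n] by (simp add: near_def)
  qed
  moreover have "\<exists>w'\<in>X0. \<forall>i. norm (P w i - P w' i) < e" if w: "w \<in> X" and e: "e > 0" for w e
  proof -
    obtain n where n: "1 / real (Suc n) < e / 2" using nat_approx_posE[of "e / 2"] e by auto
    have "\<exists>d\<in>D. norm (P w i - d) < 1 / real (Suc n)" for i by (rule D(3)[OF P[OF w]]) simp
    then obtain c where c: "\<And>i. c i \<in> D" "\<And>i. norm (P w i - c i) < 1 / real (Suc n)" by metis
    have J: "(c, n) \<in> J" using c w by (auto simp: J_def near_def)
    define w' where "w' = (SOME w. near c n w)"
    have "w' \<in> X0" unfolding X0_def w'_def using J by (intro image_eqI[of _ _ "(c, n)"]) auto
    moreover have "norm (P w i - P w' i) < e" for i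
    proof -
      have "norm (P w' i - c i) < 1 / real (Suc n)" using sel[OF J] by (simp add: near_def w'_def)
      then show ?thesis
        using norm_triangle_lt[of "P w i - c i" "c i - P w' i" e] c(2)[of i] n by (simp add: norm_minus_commute)
    qed
    ultimately show ?thesis by blast
  qed
  ultimately show ?thesis by (rule that)
qed

text \<open>
  The chain rule produces the factor \<open>1 / \<epsilon>\<close> and the operator \<open>R\<^sup>T \<nabla>\<close>.
\<close>

lemma test_function_times_oscillation:
  fixes R :: "real ^ 3 ^ 'm" and \<epsilon> :: real
  assumes \<psi>: "\<psi> \<in> test_functions \<Omega>" and w: "C_infinity w"
  defines "\<theta> \<equiv> \<lambda>x. \<psi> x * w ((R *v x) /\<^sub>R \<epsilon>)"
  shows "\<theta> \<in> test_functions \<Omega>"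
    and "grad \<theta> x = w ((R *v x) /\<^sub>R \<epsilon>) *\<^sub>R grad \<psi> x + (\<psi> x / \<epsilon>) *\<^sub>R (transpose R *v grad w ((R *v x) /\<^sub>R \<epsilon>))"
proof -
  define L where "L x = (R *v x) /\<^sub>R \<epsilon>" for x
  have L: "bounded_linear L"
    unfolding L_def by (intro bounded_linear_scaleR_right[THEN bounded_linear_compose] matrix_vector_mul_bounded_linear)
  have \<psi>C: "C_infinity \<psi>" using \<psi> by (simp add: test_functions_def)
  have \<theta>: "\<theta> = (\<lambda>x. \<psi> x * w (L x))" by (simp add: \<theta>_def L_def)
  have "C_infinity \<theta>"
    unfolding \<theta> C_infinity_def using \<psi>C w by (auto simp: C_infinity_def intro!: C_k_mult C_k_linear_compose[OF L])
  then show "\<theta> \<in> test_functions \<Omega>"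
    using \<psi> unfolding test_functions_def by (auto simp: \<theta>_def)
  have der: "(\<psi> has_derivative frechet_derivative \<psi> (at x)) (at x)"
    "(w has_derivative frechet_derivative w (at (L x))) (at (L x))"
    using C_infinity_differentiable[OF \<psi>C, of x] C_infinity_differentiable[OF w, of "L x"]
    unfolding frechet_derivative_works .
  have "(\<theta> has_derivative (\<lambda>h. \<psi> x * frechet_derivative w (at (L x)) (L h) + frechet_derivative \<psi> (at x) h * w (L x))) (at x)"
    unfolding \<theta>
    by (intro has_derivative_mult has_derivative_compose[OF bounded_linear_imp_has_derivative[OF L]] der)
  then have fd: "frechet_derivative \<theta> (at x) = (\<lambda>h. \<psi> x * frechet_derivative w (at (L x)) (L h) + frechet_derivative \<psi> (at x) h * w (L x))"
    by (rule frechet_derivative_at[symmetric])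
  have "grad \<theta> x $ i = (w (L x) *\<^sub>R grad \<psi> x + (\<psi> x / \<epsilon>) *\<^sub>R (transpose R *v grad w (L x))) $ i" for i
  proof -
    have "grad w (L x) \<bullet> L (axis i 1) = (transpose R *v grad w (L x)) $ i / \<epsilon>"
    proof -
      have "grad w (L x) \<bullet> (R *v axis i 1) = (transpose R *v grad w (L x)) \<bullet> axis i 1"
        by (simp add: transpose_matrix_vector dot_lmul_matrix)
      then show ?thesis by (simp add: L_def inner_axis divide_inverse mult.commute)
    qed
    then show ?thesis
      using derivative_eq_grad[OF C_infinity_differentiable[OF w], of "L x" "L (axis i 1)"]
      by (simp add: grad_def[of \<theta>] fd) (simp add: grad_def)
  qed
  then show "grad \<theta> x = w ((R *v x) /\<^sub>R \<epsilon>) *\<^sub>R grad \<psi> x + (\<psi> x / \<epsilon>) *\<^sub>R (transpose R *v grad w ((R *v x) /\<^sub>R \<epsilon>))"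
    by (simp add: vec_eq_iff L_def)
qed

text \<open>
  The function \<open>w\<close> together with the three components of \<open>R\<^sup>T \<nabla> w\<close>. Pairing them with a scalar \<open>d\<close> and
  the components of a field \<open>v\<close> gives \<open>\<integral> d w + v \<cdot> R\<^sup>T \<nabla> w\<close>, which vanishes for all \<open>w\<close> exactly when
  \<open>d = div\<^sub>R v\<close>.
\<close>

definition div_test :: "real ^ 3 ^ 'm \<Rightarrow> (real ^ 'm \<Rightarrow> real) \<Rightarrow> 3 option \<Rightarrow> ((real ^ 'm) \<Rightarrow>\<^sub>C real)" where
  "div_test R w l = (case l of None \<Rightarrow> Bcontfun w | Some i \<Rightarrow> Bcontfun (\<lambda>y. (transpose R *v grad w y) $ i))"

lemma sum_UNIV_option: "(\<Sum>l\<in>UNIV. f l) = f None + (\<Sum>i\<in>UNIV. f (Some i))"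
  for f :: "'i::finite option \<Rightarrow> 'a::comm_monoid_add"
  by (simp add: UNIV_option_conv sum.reindex)

lemma div_test_facts:
  fixes R :: "real ^ 3 ^ 'm"
  assumes w: "C_infinity w" "cell_periodic w"
  shows "apply_bcontfun (div_test R w None) = w"
    and "apply_bcontfun (div_test R w (Some i)) = (\<lambda>y. (transpose R *v grad w y) $ i)"
    and "div_test R w l \<in> C_sharp"
proof -
  have cont: "continuous_on UNIV (\<lambda>y. (transpose R *v grad w y) $ i)" for i
    by (auto simp: matrix_vector_mult_def intro!: continuous_intros C_infinity_grad_continuous w)
  have per: "cell_periodic (\<lambda>y. (transpose R *v grad w y) $ i)" for i
    using grad_periodic[OF w] by (simp add: cell_periodic_def)
  show 1: "apply_bcontfun (div_test R w None) = w"
    using periodic_continuous_bcontfun[OF C_infinity_continuous[OF w(1)] w(2)]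
    by (simp add: div_test_def Bcontfun_inverse)
  show 2: "apply_bcontfun (div_test R w (Some i)) = (\<lambda>y. (transpose R *v grad w y) $ i)" for i
    using periodic_continuous_bcontfun[OF cont per] by (simp add: div_test_def Bcontfun_inverse)
  show "div_test R w l \<in> C_sharp"
    using w(2) per by (cases l) (simp_all add: C_sharp_def 1 2)
qed

lemma trace_integrable:
  fixes \<phi> :: "real ^ 3 \<Rightarrow> ((real ^ 'm) \<Rightarrow>\<^sub>C real)" and R :: "real ^ 3 ^ 'm"
  assumes "f \<in> L2_space (lebesgue_on \<Omega>)" "\<phi> \<in> L2_C_sharp \<Omega>"
  shows "integrable (lebesgue_on \<Omega>) (\<lambda>x. f x * apply_bcontfun (\<phi> x) ((R *v x) /\<^sub>R \<epsilon>))"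
proof -
  have "(\<lambda>z. apply_bcontfun (\<phi> (fst z)) (snd z)) \<in> oscillating \<Omega>"
    using assms(2) by (intro oscillating_L2_C_sharp) (auto simp: L2_C_sharp_def)
  then obtain h where h: "(\<lambda>z. apply_bcontfun (\<phi> (fst z)) (snd z)) \<in> borel_measurable (lebesgue_on \<Omega> \<Otimes>\<^sub>M borel)"
    "h \<in> L2_space (lebesgue_on \<Omega>)" "\<And>x y. x \<in> \<Omega> \<Longrightarrow> \<bar>apply_bcontfun (\<phi> (fst (x, y))) (snd (x, y))\<bar> \<le> h x"
    unfolding oscillating_def by blast
  from trace_L2(1)[OF this] L2_mult_integrable[OF assms(1)] show ?thesis by simp
qed

text \<open>
  The weak divergence is tested with \<open>\<psi>(x) w(R x / \<eta>)\<close> and multiplied by \<open>\<eta>\<close>. The term with \<open>\<nabla> \<psi>\<close> is \<open>\<eta>\<close>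
  times a convergent sequence, so it disappears in the limit; the others converge in the
  two-scale sense.
\<close>

lemma two_scale_div_identity:
  fixes \<Omega> :: "(real ^ 3) set" and R :: "real ^ 3 ^ 'm" and V :: "3 option \<Rightarrow> (real ^ 3) \<times> (real ^ 'm) \<Rightarrow> real"
  assumes \<Omega>: "open \<Omega>" "bounded \<Omega>" and \<eta>: "\<And>n. \<eta> n > 0" "\<eta> \<longlonglongrightarrow> 0"
    and div: "\<And>n. has_weak_div \<Omega> (u n) (g n)"
    and lim_u: "\<And>i. two_scale_converges \<Omega> R \<eta> (\<lambda>n x. u n x $ i) (\<lambda>x y. V (Some i) (x, y))"
    and lim_g: "two_scale_converges \<Omega> R \<eta> (\<lambda>n x. \<eta> n * g n x) (\<lambda>x y. V None (x, y))"
    and \<psi>: "\<psi> \<in> test_functions \<Omega>" and w: "C_infinity w" "cell_periodic w"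
  shows "(\<Sum>l\<in>UNIV. \<integral>z. V l z * (\<psi> (fst z) * apply_bcontfun (div_test R w l) (snd z))
    \<partial>lebesgue_on (\<Omega> \<times> unit_cell)) = 0"
proof -
  let ?M = "lebesgue_on \<Omega>" and ?N = "lebesgue_on (\<Omega> \<times> (unit_cell :: (real ^ 'm) set))"
  define T where "T n f \<phi> = (\<integral>x. f x * apply_bcontfun (\<phi> x) ((R *v x) /\<^sub>R \<eta> n) \<partial>?M)"
    for n and f :: "real ^ 3 \<Rightarrow> real" and \<phi> :: "real ^ 3 \<Rightarrow> (real ^ 'm) \<Rightarrow>\<^sub>C real"
  have \<psi>C: "C_infinity \<psi>" using \<psi> by (simp add: test_functions_def)
  have \<phi>: "(\<lambda>x. \<psi> x *\<^sub>R div_test R w l) \<in> L2_C_sharp \<Omega>" for l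
    by (intro C_sharp_scaleR_L2 \<Omega> C_infinity_continuous \<psi>C div_test_facts w)
  have \<phi>': "(\<lambda>x. (grad \<psi> x $ i) *\<^sub>R div_test R w None) \<in> L2_C_sharp \<Omega>" for i
    by (intro C_sharp_scaleR_L2 \<Omega> C_infinity_grad_continuous \<psi>C div_test_facts w)
  have uL2: "(\<lambda>x. u n x $ i) \<in> L2_space ?M" for n i using lim_u[of i] by (simp add: two_scale_converges_def)
  have lim1: "(\<lambda>n. T n (\<lambda>x. u n x $ i) \<phi>) \<longlonglongrightarrow> (\<integral>(x, y). V (Some i) (x, y) * apply_bcontfun (\<phi> x) y \<partial>?N)"
    if "\<phi> \<in> L2_C_sharp \<Omega>" for \<phi> i
    using lim_u[of i] that by (simp add: two_scale_converges_def T_def)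
  have lim2: "(\<lambda>n. T n (\<lambda>x. \<eta> n * g n x) \<phi>) \<longlonglongrightarrow> (\<integral>(x, y). V None (x, y) * apply_bcontfun (\<phi> x) y \<partial>?N)"
    if "\<phi> \<in> L2_C_sharp \<Omega>" for \<phi>
    using lim_g that by (simp add: two_scale_converges_def T_def)
  \<comment> \<open>The weak divergence, tested and multiplied by \<open>\<eta>\<close>, before the passage to the limit.\<close>
  have eq: "T n (\<lambda>x. \<eta> n * g n x) (\<lambda>x. \<psi> x *\<^sub>R div_test R w None) +
      (\<Sum>i\<in>UNIV. \<eta> n * T n (\<lambda>x. u n x $ i) (\<lambda>x. (grad \<psi> x $ i) *\<^sub>R div_test R w None) +
        T n (\<lambda>x. u n x $ i) (\<lambda>x. \<psi> x *\<^sub>R div_test R w (Some i))) = 0" for n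
  proof -
    define L where "L x = (R *v x) /\<^sub>R \<eta> n" for x
    define \<theta> where "\<theta> x = \<psi> x * w (L x)" for x
    note test = test_function_times_oscillation[OF \<psi> w(1), where R=R and \<epsilon>="\<eta> n", folded L_def, folded \<theta>_def]
    have grad_eq: "u n x \<bullet> grad \<theta> x = (\<Sum>i\<in>UNIV. u n x $ i * (w (L x) * grad \<psi> x $ i) +
        (1 / \<eta> n) * (u n x $ i * (\<psi> x * (transpose R *v grad w (L x)) $ i)))" for x
      unfolding test(2) inner_vec_def by (intro sum.cong) (auto simp: algebra_simps)
    have i1: "integrable ?M (\<lambda>x. u n x $ i * (w (L x) * grad \<psi> x $ i))" for i
      using trace_integrable[OF uL2[of n i] \<phi>'[of i], where R=R and \<epsilon>="\<eta> n"] by (simp add: div_test_facts[OF w] L_def mult_ac)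
    have i2: "integrable ?M (\<lambda>x. u n x $ i * (\<psi> x * (transpose R *v grad w (L x)) $ i))" for i
      using trace_integrable[OF uL2[of n i] \<phi>[of "Some i"], where R=R and \<epsilon>="\<eta> n"] by (simp add: div_test_facts[OF w] L_def)
    have A: "(\<integral>x. u n x \<bullet> grad \<theta> x \<partial>?M) =
       (\<Sum>i\<in>UNIV. T n (\<lambda>x. u n x $ i) (\<lambda>x. (grad \<psi> x $ i) *\<^sub>R div_test R w None) +
        (1 / \<eta> n) * T n (\<lambda>x. u n x $ i) (\<lambda>x. \<psi> x *\<^sub>R div_test R w (Some i)))"
      unfolding grad_eq using i1 i2 by (simp add: T_def div_test_facts[OF w] L_def mult.commute)
    have "(\<integral>x. u n x \<bullet> grad \<theta> x \<partial>?M) = - (\<integral>x. g n x * \<theta> x \<partial>?M)"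
      using div[of n] test(1) by (simp add: has_weak_div_def)
    with A have B: "(\<integral>x. g n x * \<theta> x \<partial>?M) =
      - (\<Sum>i\<in>UNIV. T n (\<lambda>x. u n x $ i) (\<lambda>x. (grad \<psi> x $ i) *\<^sub>R div_test R w None) +
        (1 / \<eta> n) * T n (\<lambda>x. u n x $ i) (\<lambda>x. \<psi> x *\<^sub>R div_test R w (Some i)))"
      by linarith
    have "T n (\<lambda>x. \<eta> n * g n x) (\<lambda>x. \<psi> x *\<^sub>R div_test R w None) = \<eta> n * (\<integral>x. g n x * \<theta> x \<partial>?M)"
      by (simp add: T_def div_test_facts[OF w] \<theta>_def L_def mult.assoc)
    then have "T n (\<lambda>x. \<eta> n * g n x) (\<lambda>x. \<psi> x *\<^sub>R div_test R w None) = - \<eta> n *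
       (\<Sum>i\<in>UNIV. T n (\<lambda>x. u n x $ i) (\<lambda>x. (grad \<psi> x $ i) *\<^sub>R div_test R w None) +
        (1 / \<eta> n) * T n (\<lambda>x. u n x $ i) (\<lambda>x. \<psi> x *\<^sub>R div_test R w (Some i)))"
      unfolding B by simp
    also have "\<dots> = - (\<Sum>i\<in>UNIV. \<eta> n * T n (\<lambda>x. u n x $ i) (\<lambda>x. (grad \<psi> x $ i) *\<^sub>R div_test R w None) +
        T n (\<lambda>x. u n x $ i) (\<lambda>x. \<psi> x *\<^sub>R div_test R w (Some i)))"
      using \<eta>(1)[of n] by (simp add: sum_distrib_left distrib_left sum_negf[symmetric] del: sum_negf)
    finally show ?thesis by simp
  qed
  have "(\<lambda>n. T n (\<lambda>x. \<eta> n * g n x) (\<lambda>x. \<psi> x *\<^sub>R div_test R w None) +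
      (\<Sum>i\<in>UNIV. \<eta> n * T n (\<lambda>x. u n x $ i) (\<lambda>x. (grad \<psi> x $ i) *\<^sub>R div_test R w None) +
        T n (\<lambda>x. u n x $ i) (\<lambda>x. \<psi> x *\<^sub>R div_test R w (Some i)))) \<longlonglongrightarrow>
      (\<integral>(x, y). V None (x, y) * apply_bcontfun (\<psi> x *\<^sub>R div_test R w None) y \<partial>?N) +
      (\<Sum>i\<in>UNIV. 0 * (\<integral>(x, y). V (Some i) (x, y) * apply_bcontfun ((grad \<psi> x $ i) *\<^sub>R div_test R w None) y \<partial>?N) +
        (\<integral>(x, y). V (Some i) (x, y) * apply_bcontfun (\<psi> x *\<^sub>R div_test R w (Some i)) y \<partial>?N))"
    by (intro tendsto_add tendsto_sum tendsto_mult lim1 lim2 \<phi> \<phi>' \<eta>)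
  then have "(\<integral>(x, y). V None (x, y) * apply_bcontfun (\<psi> x *\<^sub>R div_test R w None) y \<partial>?N) +
      (\<Sum>i\<in>UNIV. 0 * (\<integral>(x, y). V (Some i) (x, y) * apply_bcontfun ((grad \<psi> x $ i) *\<^sub>R div_test R w None) y \<partial>?N) +
        (\<integral>(x, y). V (Some i) (x, y) * apply_bcontfun (\<psi> x *\<^sub>R div_test R w (Some i)) y \<partial>?N)) = 0"
    unfolding eq by (simp add: LIMSEQ_const_iff)
  then show ?thesis by (simp add: sum_UNIV_option split_beta')
qed

lemma zero_integral_dense_extension:
  fixes v :: "'i::finite \<Rightarrow> real ^ 'm \<Rightarrow> real" and P :: "'x \<Rightarrow> 'i \<Rightarrow> (real ^ 'm) \<Rightarrow>\<^sub>C real"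
  assumes v: "\<And>l. integrable (lebesgue_on unit_cell) (v l)"
    and zero: "\<And>w. w \<in> A \<Longrightarrow> (\<integral>y. (\<Sum>l\<in>UNIV. v l y * apply_bcontfun (P w l) y) \<partial>lebesgue_on unit_cell) = 0"
    and dense: "\<And>e. e > 0 \<Longrightarrow> \<exists>w'\<in>A. \<forall>l. norm (P w l - P w' l) < e"
  shows "(\<integral>y. (\<Sum>l\<in>UNIV. v l y * apply_bcontfun (P w l) y) \<partial>lebesgue_on unit_cell) = 0"
proof -
  let ?Y = "lebesgue_on (unit_cell :: (real ^ 'm) set)"
  let ?I = "\<lambda>w. \<integral>y. (\<Sum>l\<in>UNIV. v l y * apply_bcontfun (P w l) y) \<partial>?Y"
  have bm: "apply_bcontfun q \<in> borel_measurable ?Y" for q :: "(real ^ 'm) \<Rightarrow>\<^sub>C real"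
    by (intro lebesgue_on_borel_measurable borel_measurable_continuous_onI) simp
  have int: "integrable ?Y (\<lambda>y. v l y * apply_bcontfun q y)" for l q
  proof (rule Bochner_Integration.integrable_bound[where f="\<lambda>y. norm q * v l y"])
    show "AE y in ?Y. norm (v l y * apply_bcontfun q y) \<le> norm (norm q * v l y)"
      using norm_bounded[of q] by (intro AE_I2) (simp add: abs_mult mult.commute mult_left_mono mult_right_mono)
  qed (use v bm in auto)
  define S where "S = (\<Sum>l\<in>UNIV. \<integral>y. \<bar>v l y\<bar> \<partial>?Y)"
  have S0: "S \<ge> 0" unfolding S_def by (intro sum_nonneg) auto
  have "\<bar>?I w\<bar> \<le> 0 + e" if e: "e > 0" for e
  proof -
    define d where "d = e / (S + 1)"
    have d: "d > 0" using e S0 by (simp add: d_def)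
    obtain w' where w': "w' \<in> A" "\<And>l. norm (P w l - P w' l) < d" using dense[OF d] by blast
    have "?I w = ?I w - ?I w'" using zero[OF w'(1)] by simp
    also have "\<dots> = (\<Sum>l\<in>UNIV. \<integral>y. v l y * apply_bcontfun (P w l - P w' l) y \<partial>?Y)"
      using int by (simp add: sum_subtractf right_diff_distrib)
    also have "\<bar>\<dots>\<bar> \<le> (\<Sum>l\<in>UNIV. \<bar>\<integral>y. v l y * apply_bcontfun (P w l - P w' l) y \<partial>?Y\<bar>)" by (rule sum_abs)
    also have "\<dots> \<le> (\<Sum>l\<in>UNIV. \<integral>y. d * \<bar>v l y\<bar> \<partial>?Y)"
    proof (rule sum_mono)
      fix l
      have "\<bar>\<integral>y. v l y * apply_bcontfun (P w l - P w' l) y \<partial>?Y\<bar> \<le> (\<integral>y. \<bar>v l y * apply_bcontfun (P w l - P w' l) y\<bar> \<partial>?Y)"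
        by (rule integral_abs_bound)
      also have "\<dots> \<le> (\<integral>y. d * \<bar>v l y\<bar> \<partial>?Y)"
      proof (rule integral_mono)
        show "integrable ?Y (\<lambda>y. \<bar>v l y * apply_bcontfun (P w l - P w' l) y\<bar>)" by (intro integrable_abs int)
        show "integrable ?Y (\<lambda>y. d * \<bar>v l y\<bar>)" using v by auto
        fix y
        have "\<bar>apply_bcontfun (P w l - P w' l) y\<bar> \<le> d"
          using norm_bounded[of "P w l - P w' l" y] w'(2)[of l] by (simp del: minus_bcontfun.rep_eq)
        then show "\<bar>v l y * apply_bcontfun (P w l - P w' l) y\<bar> \<le> d * \<bar>v l y\<bar>"
          unfolding abs_mult by (subst mult.commute) (rule mult_right_mono, auto)
      qed
      finally show "\<bar>\<integral>y. v l y * apply_bcontfun (P w l - P w' l) y \<partial>?Y\<bar> \<le> (\<integral>y. d * \<bar>v l y\<bar> \<partial>?Y)" .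
    qed
    also have "\<dots> = d * S" by (simp add: S_def sum_distrib_left)
    also have "\<dots> \<le> e" using e S0 by (simp add: d_def field_simps)
    finally show ?thesis by simp
  qed
  then have "\<bar>?I w\<bar> \<le> 0" by (rule field_le_epsilon)
  then show ?thesis by simp
qed

text \<open>
  For each \<open>w\<close> separately the fundamental lemma gives the identity for almost every \<open>x\<close>. Countably many
  \<open>w\<close> share one null set, and those of \<open>countable_dense_family\<close> determine the identity for all \<open>w\<close>.
\<close>

lemma AE_has_div_R:
  fixes \<Omega> :: "(real ^ 3) set" and R :: "real ^ 3 ^ 'm" and V :: "3 option \<Rightarrow> (real ^ 3) \<times> (real ^ 'm) \<Rightarrow> real"
  assumes \<Omega>: "open \<Omega>" "bounded \<Omega>"
    and V: "\<And>l. V l \<in> borel_measurable borel" "\<And>l. V l \<in> L2_space (lebesgue_on (\<Omega> \<times> unit_cell))"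
    and zero: "\<And>\<psi> w. \<psi> \<in> test_functions \<Omega> \<Longrightarrow> C_infinity w \<Longrightarrow> cell_periodic w \<Longrightarrow>
      (\<Sum>l\<in>UNIV. \<integral>z. V l z * (\<psi> (fst z) * apply_bcontfun (div_test R w l) (snd z)) \<partial>lebesgue_on (\<Omega> \<times> unit_cell)) = 0"
  shows "AE x in lebesgue_on \<Omega>. (\<forall>l. (\<lambda>y. V l (x, y)) \<in> L2_space (lebesgue_on unit_cell)) \<and>
    has_div_R R (\<lambda>y. \<chi> i. V (Some i) (x, y)) (\<lambda>y. V None (x, y))"
proof -
  let ?M = "lebesgue_on \<Omega>" and ?Y = "lebesgue_on (unit_cell :: (real ^ 'm) set)"
  let ?N = "lebesgue_on (\<Omega> \<times> (unit_cell :: (real ^ 'm) set))"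
  note fin = finite_measure_lebesgue_on_open[OF \<Omega>]
  have \<Omega>b: "\<Omega> \<in> sets borel" using \<Omega> by simp
  define X where "X = {w :: real ^ 'm \<Rightarrow> real. C_infinity w \<and> cell_periodic w}"
  define J where "J w z = (\<Sum>l\<in>UNIV. V l z * apply_bcontfun (div_test R w l) (snd z))" for w z
  have qb: "(\<lambda>z. apply_bcontfun q (snd z)) \<in> borel_measurable borel" for q :: "(real ^ 'm) \<Rightarrow>\<^sub>C real" 
    by (intro borel_measurable_continuous_onI continuous_on_compose2[OF continuous_on_apply_bcontfun[of UNIV]] continuous_on_snd) auto
  have Jb: "J w \<in> borel_measurable borel" for w
    unfolding J_def by (intro borel_measurable_sum borel_measurable_times V qb)
  have prodL2: "(\<lambda>z. \<psi> (fst z) * apply_bcontfun (div_test R w l) (snd z)) \<in> L2_space ?N"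
    if "continuous_on UNIV \<psi>" "w \<in> X" for \<psi> w l
  proof -
    have "(\<lambda>x. \<psi> x *\<^sub>R div_test R w l) \<in> L2_C_sharp \<Omega>"
      using that by (intro C_sharp_scaleR_L2 \<Omega> div_test_facts) (auto simp: X_def)
    then have "(\<lambda>z. apply_bcontfun (\<psi> (fst z) *\<^sub>R div_test R w l) (snd z)) \<in> oscillating \<Omega>"
      by (intro oscillating_L2_C_sharp) (auto simp: L2_C_sharp_def)
    then have "(\<lambda>z. apply_bcontfun (\<psi> (fst z) *\<^sub>R div_test R w l) (snd z)) \<in> L2_space ?N"
      using cell_L2(1)[OF fin(2)] unfolding oscillating_def by blast
    then show ?thesis by simp
  qed
  have ae: "AE x in ?M. (\<integral>y. J w (x, y) \<partial>?Y) = 0" if w: "w \<in> X" for w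
  proof (rule fundamental_lemma_calculus_of_variations[OF \<Omega>])
    have J\<psi>: "integrable ?N (\<lambda>z. \<psi> (fst z) * J w z)"
      "(\<integral>z. \<psi> (fst z) * J w z \<partial>?N) =
       (\<Sum>l\<in>UNIV. \<integral>z. V l z * (\<psi> (fst z) * apply_bcontfun (div_test R w l) (snd z)) \<partial>?N)"
      if c: "continuous_on UNIV \<psi>" for \<psi>
    proof -
      have i: "integrable ?N (\<lambda>z. V l z * (\<psi> (fst z) * apply_bcontfun (div_test R w l) (snd z)))" for l
        by (rule L2_mult_integrable[OF V(2) prodL2[OF c w]])
      have eq: "\<psi> (fst z) * J w z = (\<Sum>l\<in>UNIV. V l z * (\<psi> (fst z) * apply_bcontfun (div_test R w l) (snd z)))" for z
        unfolding J_def sum_distrib_left by (intro sum.cong) (auto simp: mult_ac)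
      show "integrable ?N (\<lambda>z. \<psi> (fst z) * J w z)"
        unfolding eq by (intro Bochner_Integration.integrable_sum i)
      show "(\<integral>z. \<psi> (fst z) * J w z \<partial>?N) =
       (\<Sum>l\<in>UNIV. \<integral>z. V l z * (\<psi> (fst z) * apply_bcontfun (div_test R w l) (snd z)) \<partial>?N)"
        unfolding eq by (intro Bochner_Integration.integral_sum i)
    qed
    have "integrable ?N (J w)" using J\<psi>(1)[of "\<lambda>_. 1"] by simp
    then show "integrable ?M (\<lambda>x. \<integral>y. J w (x, y) \<partial>?Y)" by (rule Fubini_cell(2)[OF \<Omega>b Jb])
    fix \<psi> assume \<psi>: "\<psi> \<in> test_functions \<Omega>"
    note \<psi>c = test_functions_measurable(2)[OF \<psi>]
    have "(\<lambda>z. \<psi> (fst z) :: real) \<in> borel_measurable (borel :: ((real ^ 3) \<times> (real ^ 'm)) measure)"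
      by (intro borel_measurable_continuous_onI continuous_on_compose2[OF \<psi>c] continuous_on_fst) auto
    then have "(\<lambda>z. \<psi> (fst z) * J w z) \<in> borel_measurable borel" by (intro borel_measurable_times Jb)
    from Fubini_cell(3)[OF \<Omega>b this J\<psi>(1)[OF \<psi>c]]
    have "(\<integral>z. \<psi> (fst z) * J w z \<partial>?N) = (\<integral>x. \<psi> x * (\<integral>y. J w (x, y) \<partial>?Y) \<partial>?M)" by simp
    then show "(\<integral>x. \<psi> x * (\<integral>y. J w (x, y) \<partial>?Y) \<partial>?M) = 0"
      using J\<psi>(2)[OF \<psi>c] zero[OF \<psi>] w by (simp add: X_def)
  qed
  have "div_test R w l \<in> C_sharp" if "w \<in> X" for w l using that by (auto simp: X_def intro: div_test_facts)
  then obtain X\<^sub>0 where X\<^sub>0: "countable X\<^sub>0" "X\<^sub>0 \<subseteq> X"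
    "\<And>w e. w \<in> X \<Longrightarrow> e > 0 \<Longrightarrow> \<exists>w'\<in>X\<^sub>0. \<forall>l. norm (div_test R w l - div_test R w' l) < e"
    using countable_dense_family[of X "div_test R"] by blast
  have ae0: "AE x in ?M. \<forall>w\<in>X\<^sub>0. (\<integral>y. J w (x, y) \<partial>?Y) = 0"
    using X\<^sub>0 ae by (intro AE_ball_countable[THEN iffD2]) auto
  have sec: "(\<lambda>y. V l (x, y)) \<in> borel_measurable borel" for l x
    by (rule measurable_compose[OF _ V(1)]) (simp add: borel_prod[symmetric])
  have "AE x in ?M. integrable ?Y (\<lambda>y. (V l (x, y))\<^sup>2)" for l
  proof -
    have "(\<lambda>z. (V l z)\<^sup>2) \<in> borel_measurable borel" using V(1) by measurable
    then show ?thesis using V(2)[of l] by (intro Fubini_cell(1)[OF \<Omega>b]) (auto simp: L2_space_real_iff)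
  qed
  then have "AE x in ?M. \<forall>l\<in>UNIV. integrable ?Y (\<lambda>y. (V l (x, y))\<^sup>2)"
    by (intro AE_ball_countable[THEN iffD2] countable_finite) auto
  with ae0 show ?thesis
  proof eventually_elim
    case (elim x)
    have L2: "(\<lambda>y. V l (x, y)) \<in> L2_space ?Y" for l
      using elim(2) lebesgue_on_borel_measurable[OF sec] by (auto simp: L2_space_real_iff)
    have finY: "finite_measure ?Y"
      using unit_cell_facts[where 'm='m] by (intro finite_measureI) (simp add: emeasure_restrict_space)
    have "has_div_R R (\<lambda>y. \<chi> i. V (Some i) (x, y)) (\<lambda>y. V None (x, y))"
      unfolding has_div_R_def
    proof (intro allI impI)
      fix w :: "real ^ 'm \<Rightarrow> real" assume w: "C_infinity w \<and> cell_periodic w"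
      then have wX: "w \<in> X" by (simp add: X_def)
      have "(\<integral>y. (\<Sum>l\<in>UNIV. V l (x, y) * apply_bcontfun (div_test R w l) y) \<partial>?Y) = 0"
      proof (rule zero_integral_dense_extension[where P="div_test R" and v="\<lambda>l y. V l (x, y)" and A=X\<^sub>0])
        show "integrable ?Y (\<lambda>y. V l (x, y))" for l by (rule L2_integrable[OF finY L2])
        show "(\<integral>y. (\<Sum>l\<in>UNIV. V l (x, y) * apply_bcontfun (div_test R w l) y) \<partial>?Y) = 0" if "w \<in> X\<^sub>0" for w
          using elim(1) that by (simp add: J_def)
        show "\<exists>w'\<in>X\<^sub>0. \<forall>l. norm (div_test R w l - div_test R w' l) < e" if "e > 0" for e
          by (rule X\<^sub>0(3)[OF wX that])
      qed
      moreover have "integrable ?Y (\<lambda>y. V l (x, y) * apply_bcontfun (div_test R w l) y)" for l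
      proof (rule Bochner_Integration.integrable_bound[where f="\<lambda>y. norm (div_test R w l) * V l (x, y)"])
        show "integrable ?Y (\<lambda>y. norm (div_test R w l) * V l (x, y))"
          using L2_integrable[OF finY L2] by auto
        show "(\<lambda>y. V l (x, y) * apply_bcontfun (div_test R w l) y) \<in> borel_measurable ?Y"
          by (intro lebesgue_on_borel_measurable borel_measurable_times sec borel_measurable_continuous_onI) simp
        show "AE y in ?Y. norm (V l (x, y) * apply_bcontfun (div_test R w l) y) \<le> norm (norm (div_test R w l) * V l (x, y))"
          using norm_bounded[of "div_test R w l"]
          by (intro AE_I2) (auto simp: abs_mult mult.commute[of "norm (div_test R w l)"] intro!: mult_left_mono)
      qed
      ultimately have "(\<integral>y. (\<Sum>i\<in>UNIV. V (Some i) (x, y) * apply_bcontfun (div_test R w (Some i)) y) \<partial>?Y) =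
          - (\<integral>y. V None (x, y) * apply_bcontfun (div_test R w None) y \<partial>?Y)"
        by (simp add: sum_UNIV_option)
      then show "(\<integral>y. (\<chi> i. V (Some i) (x, y)) \<bullet> (transpose R *v grad w y) \<partial>?Y) = - (\<integral>y. V None (x, y) * w y \<partial>?Y)"
        using w by (simp add: div_test_facts inner_vec_def)
    qed
    with L2 show ?case by blast
  qed
qed

theorem proposition9:
  fixes \<Omega> :: "(real ^ 3) set"
    and R :: "real ^ 3 ^ 'm"
    and \<eta> :: "nat \<Rightarrow> real"
    and u :: "nat \<Rightarrow> real ^ 3 \<Rightarrow> real ^ 3"
    and div_u :: "nat \<Rightarrow> real ^ 3 \<Rightarrow> real"
  assumes "open \<Omega>" and "bounded \<Omega>" and "Lipschitz_boundary \<Omega>"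
    and "CARD('m) > 3"
    and "\<And>k :: int ^ 'm. k \<noteq> 0 \<Longrightarrow> transpose R *v int_vec k \<noteq> 0"
    and "\<And>n. \<eta> n > 0" and "\<eta> \<longlonglongrightarrow> 0"
    and "\<And>n. has_weak_div \<Omega> (u n) (div_u n)"
    and "L2_bounded_seq (lebesgue_on \<Omega>) u"
    and "L2_bounded_seq (lebesgue_on \<Omega>) (\<lambda>n x. \<eta> n * div_u n x)"
  shows "\<exists>r u0 div_R_u0. strict_mono (r :: nat \<Rightarrow> nat) \<and>
           u0 \<in> L2_H_sharp_div_R \<Omega> R \<and>
           has_div_R_field \<Omega> R u0 div_R_u0 \<and>
           two_scale_converges_vec \<Omega> R (\<eta> \<circ> r) (u \<circ> r) u0 \<and>
           two_scale_converges \<Omega> R (\<eta> \<circ> r) (\<lambda>k x. \<eta> (r k) * div_u (r k) x) div_R_u0"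
proof -
  let ?M = "lebesgue_on \<Omega>" and ?N = "lebesgue_on (\<Omega> \<times> (unit_cell :: (real ^ 'm) set))"
  note \<Omega> = assms(1,2) and R = assms(5) and \<eta> = assms(6,7)
  \<comment> \<open>Index \<open>None\<close> stands for the scaled divergence and \<open>Some i\<close> for the component \<open>i\<close> of the field, so
    that one subsequence is extracted for all four sequences.\<close>
  define f where "f l n x = (case l of None \<Rightarrow> \<eta> n * div_u n x | Some i \<Rightarrow> u n x $ i)" for l :: "3 option" and n x
  have "L2_bounded_seq ?M (f l)" for l
  proof (cases l)
    case None
    then show ?thesis using assms(10) by (simp add: f_def[abs_def])
  next
    case (Some i)
    obtain C where C: "\<And>n. norm_L2 ?M (u n) \<le> C" and uL2: "\<And>n. u n \<in> L2_space ?M"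
      using assms(9) by (auto simp: L2_bounded_seq_def)
    have m: "(\<lambda>x. u n x $ i) \<in> borel_measurable ?M" for n
    proof -
      have "u n \<in> borel_measurable ?M" using uL2 by (simp add: L2_space_def)
      moreover have "(\<lambda>v :: real ^ 3. v $ i) \<in> borel_measurable borel"
        by (intro borel_measurable_continuous_onI continuous_intros)
      ultimately show ?thesis by (rule measurable_compose)
    qed
    have le: "AE x in ?M. \<bar>u n x $ i\<bar> \<le> norm (u n x)" for n by (simp add: component_le_norm_cart)
    have "(\<lambda>x. u n x $ i) \<in> L2_space ?M" "norm_L2 ?M (\<lambda>x. u n x $ i) \<le> C" for n
      using L2_bound[OF m uL2 le] order_trans[OF L2_norm_mono[OF m uL2 le] C] by auto
    then show ?thesis using Some by (auto simp: f_def[abs_def] L2_bounded_seq_def)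
  qed
  then obtain r where r: "strict_mono (r :: nat \<Rightarrow> nat)" and
    "\<forall>l\<in>UNIV. \<exists>v\<in>borel_measurable borel. two_scale_converges \<Omega> R (\<eta> \<circ> r) (f l \<circ> r) (\<lambda>x y. v (x, y))"
    using two_scale_compactness_finite[OF \<Omega> R \<eta>, of f UNIV] by auto
  then have "\<forall>l. \<exists>v. v \<in> borel_measurable borel \<and>
    two_scale_converges \<Omega> R (\<eta> \<circ> r) (f l \<circ> r) (\<lambda>x y. v (x, y))" by blast
  from choice[OF this] obtain V where V: "\<And>l. V l \<in> borel_measurable borel"
    and conv: "\<And>l. two_scale_converges \<Omega> R (\<eta> \<circ> r) (f l \<circ> r) (\<lambda>x y. V l (x, y))" by blast
  have VL2: "V l \<in> L2_space ?N" for l using conv[of l] by (simp add: two_scale_converges_def)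
  have \<eta>r: "\<And>n. (\<eta> \<circ> r) n > 0" "(\<eta> \<circ> r) \<longlonglongrightarrow> 0"
    using \<eta>(1) LIMSEQ_subseq_LIMSEQ[OF \<eta>(2) r] by auto
  have conv_u: "two_scale_converges \<Omega> R (\<eta> \<circ> r) (\<lambda>n x. (u \<circ> r) n x $ i) (\<lambda>x y. V (Some i) (x, y))" for i
    using conv[of "Some i"] by (simp add: f_def[abs_def] o_def)
  have conv_d: "two_scale_converges \<Omega> R (\<eta> \<circ> r) (\<lambda>n x. (\<eta> \<circ> r) n * (div_u \<circ> r) n x) (\<lambda>x y. V None (x, y))"
    using conv[of None] by (simp add: f_def[abs_def] o_def)
  have wd: "has_weak_div \<Omega> ((u \<circ> r) n) ((div_u \<circ> r) n)" for n using assms(8) by simp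
  have ae: "AE x in ?M. (\<forall>l. (\<lambda>y. V l (x, y)) \<in> L2_space (lebesgue_on unit_cell)) \<and>
    has_div_R R (\<lambda>y. \<chi> i. V (Some i) (x, y)) (\<lambda>y. V None (x, y))"
    using two_scale_div_identity[OF \<Omega> \<eta>r wd conv_u conv_d] by (intro AE_has_div_R \<Omega> V VL2)
  \<comment> \<open>The limits are determined on the open cell only; their periodic extensions are used.\<close>
  define u0 where "u0 x y = (\<chi> i. V (Some i) (x, cell_rep y))" for x y
  define d0 where "d0 x y = V None (x, cell_rep y)" for x y
  have cu: "two_scale_converges \<Omega> R (\<eta> \<circ> r) (\<lambda>n x. (u \<circ> r) n x $ i) (\<lambda>x y. u0 x y $ i)" for i
    by (rule two_scale_converges_cong[OF conv_u[of i]]) (simp add: u0_def cell_rep_unit_cell)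
  have cd: "two_scale_converges \<Omega> R (\<eta> \<circ> r) (\<lambda>n x. (\<eta> \<circ> r) n * (div_u \<circ> r) n x) d0"
    by (rule two_scale_converges_cong[OF conv_d]) (simp add: d0_def cell_rep_unit_cell)
  have vecL2: "F \<in> L2_space K" if "\<And>i. (\<lambda>z. F z $ i) \<in> L2_space K" for F :: "'z \<Rightarrow> real ^ 3" and K
  proof -
    have "(\<lambda>z. F z \<bullet> b) \<in> borel_measurable K" if "b \<in> Basis" for b
      using that \<open>\<And>i. (\<lambda>z. F z $ i) \<in> L2_space K\<close> by (auto simp: Basis_vec_def inner_axis L2_space_real_iff)
    then have "F \<in> borel_measurable K" by (subst borel_measurable_euclidean_space) auto
    moreover have "(norm (F z))\<^sup>2 = (\<Sum>i\<in>UNIV. (F z $ i)\<^sup>2)" for z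
      unfolding power2_norm_eq_inner inner_vec_def by (simp add: power2_eq_square)
    then have "integrable K (\<lambda>z. (norm (F z))\<^sup>2)"
      using that by (simp add: L2_space_real_iff)
    ultimately show ?thesis by (simp add: L2_space_def)
  qed
  have u0L2: "(\<lambda>(x, y). u0 x y) \<in> L2_space ?N"
    using cu by (intro vecL2) (auto simp: two_scale_converges_def split_beta')
  have d0L2: "(\<lambda>(x, y). d0 x y) \<in> L2_space ?N" using cd by (simp add: two_scale_converges_def)
  have "AE x in ?M. u0 x \<in> L2_sharp \<and> d0 x \<in> L2_sharp \<and> has_div_R R (u0 x) (d0 x)"
    using ae
  proof eventually_elim
    case (elim x)
    have cong: "F \<in> L2_space (lebesgue_on unit_cell)"
      if "G \<in> L2_space (lebesgue_on unit_cell)" "\<And>y. y \<in> unit_cell \<Longrightarrow> F y = G y"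
      for F G :: "real ^ 'm \<Rightarrow> real"
    proof -
      have "F \<in> borel_measurable (lebesgue_on unit_cell) \<longleftrightarrow> G \<in> borel_measurable (lebesgue_on unit_cell)"
        using that(2) by (intro measurable_cong) simp
      moreover have "integrable (lebesgue_on unit_cell) (\<lambda>y. (F y)\<^sup>2) \<longleftrightarrow> integrable (lebesgue_on unit_cell) (\<lambda>y. (G y)\<^sup>2)"
        using that(2) by (intro Bochner_Integration.integrable_cong) auto
      ultimately show ?thesis using that(1) by (simp add: L2_space_real_iff)
    qed
    have sec: "(\<lambda>y. V l (x, y)) \<in> L2_space (lebesgue_on unit_cell)" for l
      using elim by blast
    have "u0 x \<in> L2_space (lebesgue_on unit_cell)"
    proof (rule vecL2)
      show "(\<lambda>y. u0 x y $ i) \<in> L2_space (lebesgue_on unit_cell)" for i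
        by (rule cong[OF sec[of "Some i"]]) (simp add: u0_def cell_rep_unit_cell)
    qed
    moreover have "d0 x \<in> L2_space (lebesgue_on unit_cell)"
      by (rule cong[OF sec[of None]]) (simp add: d0_def cell_rep_unit_cell)
    moreover have "cell_periodic (u0 x)" "cell_periodic (d0 x)"
      by (simp_all add: cell_periodic_def u0_def d0_def cell_rep_periodic)
    moreover have "has_div_R R (u0 x) (d0 x)"
    proof -
      have "(\<integral>y. u0 x y \<bullet> (transpose R *v grad w y) \<partial>lebesgue_on unit_cell) =
          (\<integral>y. (\<chi> i. V (Some i) (x, y)) \<bullet> (transpose R *v grad w y) \<partial>lebesgue_on unit_cell)"
        "(\<integral>y. d0 x y * w y \<partial>lebesgue_on unit_cell) = (\<integral>y. V None (x, y) * w y \<partial>lebesgue_on unit_cell)"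
        for w :: "real ^ 'm \<Rightarrow> real"
        by (auto intro!: Bochner_Integration.integral_cong simp: u0_def d0_def cell_rep_unit_cell)
      then show ?thesis using conjunct2[OF elim] by (simp only: has_div_R_def)
    qed
    ultimately show ?case by (simp add: L2_sharp_def)
  qed
  note ae0 = this
  have ae_u: "AE x in ?M. u0 x \<in> H_sharp_div_R R"
    unfolding H_sharp_div_R_def using ae0 by eventually_elim blast
  have ae_d: "AE x in ?M. d0 x \<in> L2_sharp \<and> has_div_R R (u0 x) (d0 x)"
    using ae0 by eventually_elim blast
  have field: "has_div_R_field \<Omega> R u0 d0" using d0L2 ae_d by (simp add: has_div_R_field_def)
  have "u0 \<in> L2_H_sharp_div_R \<Omega> R"
    using u0L2 ae_u field by (auto simp: L2_H_sharp_div_R_def)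
  moreover have "two_scale_converges_vec \<Omega> R (\<eta> \<circ> r) (u \<circ> r) u0"
    using cu by (simp add: two_scale_converges_vec_def)
  moreover have "two_scale_converges \<Omega> R (\<eta> \<circ> r) (\<lambda>k x. \<eta> (r k) * div_u (r k) x) d0"
    using cd by simp
  ultimately show ?thesis using r field by blast
qed

end
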